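(* Let $\Xi(n,m)$ be an arbitrary network consisting of $n$ parties $\mathbf{A}_1,\dots,\mathbf{A}_n$ and $m$ sources. Let $h$ be its maximum independence number, let $\mathbf{A}_{i_1},\dots,\mathbf{A}_{i_h}$ be $h$ corresponding pairwise independent parties, and put $\Gamma=\{i_1,\dots,i_h\}$, $\bar\Gamma=\{1,\dots,n\}\setminus\Gamma$. Let $w$ be the smallest integer $v$ such that, whenever $v$ of the sources of the network are local, some party $\mathbf{A}_i$ with $i\in\Gamma$ receives only local sources. Each party $\mathbf{A}_i$ performs binary-input, binary-output measurements $A_{x_i=0}$, $A_{x_i=1}$. If the correlations generated by the network are $w$-level quantum network local ($w$-QNL), then $$|I|^{\frac1h}+|J|^{\frac1h}\le 2^{\frac{h-1}{2h}},$$ where $$I=\Big\langle \prod_{i\in\Gamma}A^+_{x_i}\prod_{j\in\bar\Gamma}A_{x_j=0}\Big\rangle,\qquad J=\Big\langle \prod_{i\in\Gamma}A^-_{x_i}\prod_{j\in\bar\Gamma}A_{x_j=1}\Big\rangle,\qquad A^{\pm}_{x_i}=\tfrac12\big(A_{x_i=0}\pm A_{x_i=1}\big).$$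
   Context: Network: there are $n$ parties and $m$ mutually independent sources; each source is distributed to a fixed set of at least two parties, and each party receives at least one source. $\Lambda_i$ denotes the set of sources received by party $\mathbf{A}_i$. Parties are independent if no two of them share a common source (the sets $\Lambda_i$ are pairwise disjoint); the maximum independence number is the largest size of a set of independent parties. Sources and correlations: a source is either local, meaning it is described by a classical hidden variable (a random variable $\lambda$ whose value is sent to all parties receiving the source), or it is an arbitrary quantum state shared by the parties receiving it (a density operator on a tensor product of Hilbert spaces, one factor per receiving party). The state of the whole network is the product over all sources (all hidden variables are independent of each other, and the quantum states are in tensor product). Given input $x_i\in\{0,1\}$, party $\mathbf{A}_i$ performs on all the quantum systems it receives a two-outcome measurement, which may depend on the values of the hidden variables it receives, with outcome $a_i\in\{+1,-1\}$. This yields a joint distribution $P(a_1,\dots,a_n\mid x_1,\dots,x_n)$, called the correlations generated by the network. Expectations: $\langle \prod_{i} A_{x_i}\rangle=\sum_{a_1,\dots,a_n}a_1\cdots a_n P(a_1,\dots,a_n\mid x_1,\dots,x_n)$, and expressions containing $A^{\pm}_{x_i}$ are defined by multilinear expansion. $l$-QNL: for an integer $l$, correlations are $l$-level quantum network local ($l$-QNL) if they can be reproduced by such a model on the given network in which at least $l$ of the sources are local (the remaining sources being arbitrary quantum states); otherwise they are $l$-level quantum network nonlocal ($l$-QNN). *)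

theory Defs
  imports "HOL-Probability.Probability"
begin

section \<open>Networks\<close>

text \<open>Parties are the elements of \<open>{1..n}\<close> and sources those of \<open>{1..m}\<close>; \<open>\<Lambda> i\<close> is the set of
  sources received by party \<open>i\<close>.\<close>

definition receivers :: "nat \<Rightarrow> (nat \<Rightarrow> nat set) \<Rightarrow> nat \<Rightarrow> nat set" where
  "receivers n \<Lambda> s = {i \<in> {1..n}. s \<in> \<Lambda> i}"

definition network :: "nat \<Rightarrow> nat \<Rightarrow> (nat \<Rightarrow> nat set) \<Rightarrow> bool" where
  "network n m \<Lambda> \<longleftrightarrow>
     (\<forall>i\<in>{1..n}. \<Lambda> i \<subseteq> {1..m} \<and> \<Lambda> i \<noteq> {}) \<and>
     (\<forall>s\<in>{1..m}. 2 \<le> card (receivers n \<Lambda> s))"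

definition independent_parties :: "(nat \<Rightarrow> nat set) \<Rightarrow> nat set \<Rightarrow> bool" where
  "independent_parties \<Lambda> S \<longleftrightarrow> (\<forall>i\<in>S. \<forall>j\<in>S. i \<noteq> j \<longrightarrow> \<Lambda> i \<inter> \<Lambda> j = {})"

definition max_independence_number :: "nat \<Rightarrow> (nat \<Rightarrow> nat set) \<Rightarrow> nat" where
  "max_independence_number n \<Lambda> = Max (card ` {S. S \<subseteq> {1..n} \<and> independent_parties \<Lambda> S})"

definition critical_level :: "nat \<Rightarrow> (nat \<Rightarrow> nat set) \<Rightarrow> nat set \<Rightarrow> nat" where
  "critical_level m \<Lambda> \<Gamma> =
     (LEAST v. \<forall>L. L \<subseteq> {1..m} \<and> card L = v \<longrightarrow> (\<exists>i\<in>\<Gamma>. \<Lambda> i \<subseteq> L))"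

section \<open>Operators on Hilbert spaces\<close>

text \<open>Every Hilbert space is presented as \<open>\<ell>\<^sup>2(X)\<close>, where \<open>X\<close> indexes an orthonormal basis; \<open>X\<close> may
  have any cardinality. Vectors vanish outside \<open>X\<close>. The tensor product of the spaces
  \<open>\<ell>\<^sup>2(B k)\<close>, for \<open>k\<close> in a finite set \<open>K\<close>, is \<open>\<ell>\<^sup>2(Pi\<^sub>E K B)\<close>.\<close>

type_synonym 'x vec = "'x \<Rightarrow> complex"
type_synonym 'x operator = "'x vec \<Rightarrow> 'x vec"

definition ell2 :: "'x set \<Rightarrow> 'x vec set" where
  "ell2 X = {v. (\<forall>x. x \<notin> X \<longrightarrow> v x = 0) \<and> (\<lambda>x. (cmod (v x))\<^sup>2) summable_on X}"

definition ell2_norm :: "'x set \<Rightarrow> 'x vec \<Rightarrow> real" where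
  "ell2_norm X v = sqrt (\<Sum>\<^sub>\<infinity>x\<in>X. (cmod (v x))\<^sup>2)"

definition ell2_inner :: "'x set \<Rightarrow> 'x vec \<Rightarrow> 'x vec \<Rightarrow> complex" where
  "ell2_inner X u v = (\<Sum>\<^sub>\<infinity>x\<in>X. cnj (u x) * v x)"

definition ket :: "'x \<Rightarrow> 'x vec" where
  "ket x = (\<lambda>y. if y = x then 1 else 0)"

definition bounded_operator :: "'x set \<Rightarrow> 'x operator \<Rightarrow> bool" where
  "bounded_operator X T \<longleftrightarrow>
     (\<forall>v\<in>ell2 X. T v \<in> ell2 X) \<and>
     (\<forall>u\<in>ell2 X. \<forall>v\<in>ell2 X. T (\<lambda>x. u x + v x) = (\<lambda>x. T u x + T v x)) \<and>
     (\<forall>c. \<forall>v\<in>ell2 X. T (\<lambda>x. c * v x) = (\<lambda>x. c * T v x)) \<and>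
     (\<exists>K. \<forall>v\<in>ell2 X. ell2_norm X (T v) \<le> K * ell2_norm X v)"

definition positive_operator :: "'x set \<Rightarrow> 'x operator \<Rightarrow> bool" where
  "positive_operator X T \<longleftrightarrow>
     bounded_operator X T \<and> (\<forall>v\<in>ell2 X. ell2_inner X v (T v) \<in> \<real>\<^sub>\<ge>\<^sub>0)"

definition mat_elem :: "'x set \<Rightarrow> 'x operator \<Rightarrow> 'x \<Rightarrow> 'x \<Rightarrow> complex" where
  "mat_elem X T x y = ell2_inner X (ket x) (T (ket y))"

definition op_trace :: "'x set \<Rightarrow> 'x operator \<Rightarrow> complex" where
  "op_trace X T = (\<Sum>\<^sub>\<infinity>x\<in>X. mat_elem X T x x)"

definition density_operator :: "'x set \<Rightarrow> 'x operator \<Rightarrow> bool" where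
  "density_operator X T \<longleftrightarrow>
     positive_operator X T \<and> ((\<lambda>x. mat_elem X T x x) has_sum 1) X"

text \<open>A two-outcome measurement (POVM); the effect of outcome \<open>a\<close> is \<open>E a\<close>.\<close>

definition two_outcome_measurement :: "'x set \<Rightarrow> (int \<Rightarrow> 'x operator) \<Rightarrow> bool" where
  "two_outcome_measurement X E \<longleftrightarrow>
     positive_operator X (E 1) \<and> positive_operator X (E (-1)) \<and>
     (\<forall>v\<in>ell2 X. (\<lambda>x. E 1 v x + E (-1) v x) = v)"

text \<open>The tensor product of the operators \<open>T k\<close> on \<open>\<ell>\<^sup>2(Y k)\<close>, for \<open>k\<close> in a finite set \<open>K\<close>, as an operator
  on \<open>\<ell>\<^sup>2(X)\<close>. Here \<open>x \<mapsto> (\<pi> k x)\<^sub>k\<close> is a bijection from \<open>X\<close> onto the product of the \<open>Y k\<close>, which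
  identifies \<open>ket x\<close> with the tensor product of the vectors \<open>ket (\<pi> k x)\<close>, so that the matrix
  elements of the tensor product are the products of the matrix elements of the factors. The
  projections are a parameter because the global space below is factorised in two ways, by sources
  and by parties.\<close>

definition tensor_operator ::
  "'x set \<Rightarrow> 'k set \<Rightarrow> ('k \<Rightarrow> 'x \<Rightarrow> 'y) \<Rightarrow> ('k \<Rightarrow> 'y set) \<Rightarrow> ('k \<Rightarrow> 'y operator) \<Rightarrow> 'x operator" where
  "tensor_operator X K \<pi> Y T v =
     (\<lambda>x. if x \<in> X
          then (\<Sum>\<^sub>\<infinity>y\<in>X. (\<Prod>k\<in>K. mat_elem (Y k) (T k) (\<pi> k x) (\<pi> k y)) * v y)
          else 0)"

section \<open>Network models\<close>

text \<open>A model in which the sources in \<open>L\<close> are local and the others are quantum.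
  \<^item> \<open>hidden M s\<close>: the law of the hidden variable of the local source \<open>s\<close>.
  \<^item> \<open>basis M s i\<close>: orthonormal basis of the system sent by the quantum source \<open>s\<close> to party \<open>i\<close>.
  \<^item> \<open>state M s\<close>: the state emitted by the quantum source \<open>s\<close>.
  \<^item> \<open>effect M i \<xi> x a\<close>: the effect of party \<open>i\<close> for outcome \<open>a\<close>, given the values
    \<open>\<xi>\<close> of the hidden variables it receives and its input \<open>x\<close>.

  A party receiving only local sources acts on \<open>\<ell>\<^sup>2\<close> of a one-point set, so its effects are just
  the conditional probabilities of its outcomes.\<close>

record ('l, 'b) net_model =
  hidden :: "nat \<Rightarrow> 'l measure"
  basis :: "nat \<Rightarrow> nat \<Rightarrow> 'b set"
  state :: "nat \<Rightarrow> (nat \<Rightarrow> 'b) operator"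
  effect :: "nat \<Rightarrow> (nat \<Rightarrow> 'l) \<Rightarrow> nat \<Rightarrow> int \<Rightarrow> (nat \<Rightarrow> 'b) operator"

definition source_basis ::
  "nat \<Rightarrow> (nat \<Rightarrow> nat set) \<Rightarrow> ('l, 'b) net_model \<Rightarrow> nat \<Rightarrow> (nat \<Rightarrow> 'b) set" where
  "source_basis n \<Lambda> M s = (\<Pi>\<^sub>E i\<in>receivers n \<Lambda> s. basis M s i)"

definition party_basis ::
  "(nat \<Rightarrow> nat set) \<Rightarrow> nat set \<Rightarrow> ('l, 'b) net_model \<Rightarrow> nat \<Rightarrow> (nat \<Rightarrow> 'b) set" where
  "party_basis \<Lambda> L M i = (\<Pi>\<^sub>E s\<in>\<Lambda> i - L. basis M s i)"

definition global_basis ::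
  "nat \<Rightarrow> nat \<Rightarrow> (nat \<Rightarrow> nat set) \<Rightarrow> nat set \<Rightarrow> ('l, 'b) net_model \<Rightarrow> (nat \<times> nat \<Rightarrow> 'b) set" where
  "global_basis n m \<Lambda> L M =
     (\<Pi>\<^sub>E (s, i)\<in>(SIGMA s:{1..m} - L. receivers n \<Lambda> s). basis M s i)"

definition source_part ::
  "nat \<Rightarrow> (nat \<Rightarrow> nat set) \<Rightarrow> nat \<Rightarrow> (nat \<times> nat \<Rightarrow> 'b) \<Rightarrow> nat \<Rightarrow> 'b" where
  "source_part n \<Lambda> s z = (\<lambda>i\<in>receivers n \<Lambda> s. z (s, i))"

definition party_part ::
  "(nat \<Rightarrow> nat set) \<Rightarrow> nat set \<Rightarrow> nat \<Rightarrow> (nat \<times> nat \<Rightarrow> 'b) \<Rightarrow> nat \<Rightarrow> 'b" where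
  "party_part \<Lambda> L i z = (\<lambda>s\<in>\<Lambda> i - L. z (s, i))"

text \<open>The effects are required to depend weakly measurably on the hidden variables, so that the
  integral in \<open>model_prob\<close> is meaningful.\<close>

definition valid_model ::
  "nat \<Rightarrow> nat \<Rightarrow> (nat \<Rightarrow> nat set) \<Rightarrow> nat set \<Rightarrow> ('l, 'b) net_model \<Rightarrow> bool" where
  "valid_model n m \<Lambda> L M \<longleftrightarrow>
     (\<forall>s\<in>L. prob_space (hidden M s)) \<and>
     (\<forall>s\<in>{1..m} - L. density_operator (source_basis n \<Lambda> M s) (state M s)) \<and>
     (\<forall>i\<in>{1..n}. \<forall>x\<in>{0, 1}.
        (\<forall>\<xi>\<in>space (Pi\<^sub>M (\<Lambda> i \<inter> L) (hidden M)).
           two_outcome_measurement (party_basis \<Lambda> L M i) (effect M i \<xi> x)) \<and>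
        (\<forall>a\<in>{1, -1}. \<forall>u\<in>ell2 (party_basis \<Lambda> L M i). \<forall>v\<in>ell2 (party_basis \<Lambda> L M i).
           (\<lambda>\<xi>. ell2_inner (party_basis \<Lambda> L M i) u (effect M i \<xi> x a v))
             \<in> borel_measurable (Pi\<^sub>M (\<Lambda> i \<inter> L) (hidden M))))"

definition global_state ::
  "nat \<Rightarrow> nat \<Rightarrow> (nat \<Rightarrow> nat set) \<Rightarrow> nat set \<Rightarrow> ('l, 'b) net_model \<Rightarrow> (nat \<times> nat \<Rightarrow> 'b) operator" where
  "global_state n m \<Lambda> L M =
     tensor_operator (global_basis n m \<Lambda> L M) ({1..m} - L)
       (source_part n \<Lambda>) (source_basis n \<Lambda> M) (state M)"

definition global_effect ::
  "nat \<Rightarrow> nat \<Rightarrow> (nat \<Rightarrow> nat set) \<Rightarrow> nat set \<Rightarrow> ('l, 'b) net_model \<Rightarrow>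
     (nat \<Rightarrow> 'l) \<Rightarrow> (nat \<Rightarrow> int) \<Rightarrow> (nat \<Rightarrow> nat) \<Rightarrow> (nat \<times> nat \<Rightarrow> 'b) operator" where
  "global_effect n m \<Lambda> L M \<xi> a x =
     tensor_operator (global_basis n m \<Lambda> L M) {1..n}
       (party_part \<Lambda> L) (party_basis \<Lambda> L M)
       (\<lambda>i. effect M i (restrict \<xi> (\<Lambda> i \<inter> L)) (x i) (a i))"

definition model_prob ::
  "nat \<Rightarrow> nat \<Rightarrow> (nat \<Rightarrow> nat set) \<Rightarrow> nat set \<Rightarrow> ('l, 'b) net_model \<Rightarrow>
     (nat \<Rightarrow> int) \<Rightarrow> (nat \<Rightarrow> nat) \<Rightarrow> real" where
  "model_prob n m \<Lambda> L M a x =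
     (\<integral>\<xi>. Re (op_trace (global_basis n m \<Lambda> L M)
               (global_state n m \<Lambda> L M \<circ> global_effect n m \<Lambda> L M \<xi> a x))
        \<partial>(Pi\<^sub>M L (hidden M)))"

section \<open>Correlations\<close>

definition outcomes :: "nat \<Rightarrow> (nat \<Rightarrow> int) set" where
  "outcomes n = (\<Pi>\<^sub>E i\<in>{1..n}. {1, -1})"

definition inputs :: "nat \<Rightarrow> (nat \<Rightarrow> nat) set" where
  "inputs n = (\<Pi>\<^sub>E i\<in>{1..n}. {0, 1})"

text \<open>\<open>P a x\<close> stands for \<open>P(a\<^sub>1,\<dots>,a\<^sub>n | x\<^sub>1,\<dots>,x\<^sub>n)\<close>. As HOL cannot quantify existentially over types, the
  types of the hidden variables and of the basis indices are parameters of the definition.\<close>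

definition QNL ::
  "'l itself \<Rightarrow> 'b itself \<Rightarrow> nat \<Rightarrow> nat \<Rightarrow> (nat \<Rightarrow> nat set) \<Rightarrow> nat \<Rightarrow>
     ((nat \<Rightarrow> int) \<Rightarrow> (nat \<Rightarrow> nat) \<Rightarrow> real) \<Rightarrow> bool" where
  "QNL _ _ n m \<Lambda> l P \<longleftrightarrow>
     (\<exists>L (M :: ('l, 'b) net_model).
        L \<subseteq> {1..m} \<and> l \<le> card L \<and> valid_model n m \<Lambda> L M \<and>
        (\<forall>a\<in>outcomes n. \<forall>x\<in>inputs n. P a x = model_prob n m \<Lambda> L M a x))"

definition full_correlator ::
  "nat \<Rightarrow> ((nat \<Rightarrow> int) \<Rightarrow> (nat \<Rightarrow> nat) \<Rightarrow> real) \<Rightarrow> (nat \<Rightarrow> nat) \<Rightarrow> real" where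
  "full_correlator n P x = (\<Sum>a\<in>outcomes n. of_int (\<Prod>i\<in>{1..n}. a i) * P a x)"

text \<open>A formal linear combination \<open>c 0 A\<^sub>0 + c 1 A\<^sub>1\<close> of the two observables of a party is
  represented by its coefficients; \<open>expectation_of n P C\<close> is the expectation of the product of the
  combinations \<open>C i\<close>, by multilinear expansion.\<close>

definition A_obs :: "nat \<Rightarrow> nat \<Rightarrow> real" where
  "A_obs k = (\<lambda>y. if y = k then 1 else 0)"

definition A_plus :: "nat \<Rightarrow> real" where
  "A_plus = (\<lambda>y. (A_obs 0 y + A_obs 1 y) / 2)"

definition A_minus :: "nat \<Rightarrow> real" where
  "A_minus = (\<lambda>y. (A_obs 0 y - A_obs 1 y) / 2)"

definition expectation_of ::
  "nat \<Rightarrow> ((nat \<Rightarrow> int) \<Rightarrow> (nat \<Rightarrow> nat) \<Rightarrow> real) \<Rightarrow> (nat \<Rightarrow> nat \<Rightarrow> real) \<Rightarrow> real" where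
  "expectation_of n P C = (\<Sum>x\<in>inputs n. (\<Prod>i\<in>{1..n}. C i (x i)) * full_correlator n P x)"

end

theory Submission
  imports Defs
begin

text \<open>
  Expanding \<open>\<langle>\<Prod>A\<rangle>\<close> conditionally on the hidden variables, the Cauchy-Schwarz inequality for the state and
  the contractivity of the observables outside \<open>\<Gamma>\<close> give
  \<open>\<bar>I\<bar> \<le> \<Prod> p\<^sub>i\<close> and \<open>\<bar>J\<bar> \<le> \<Prod> q\<^sub>i\<close> (products over \<open>\<Gamma>\<close>), where \<open>p\<^sub>i\<close> and \<open>q\<^sub>i\<close> are the averages over the hidden
  variables of the square roots of the expectations of \<open>(A\<^sup>+)\<^sup>2\<close> and \<open>(A\<^sup>-)\<^sup>2\<close>; the products arise because the
  parties in \<open>\<Gamma>\<close> share no source. As \<open>(A\<^sup>+)\<^sup>2 + (A\<^sup>-)\<^sup>2 = (A\<^sub>0\<^sup>2 + A\<^sub>1\<^sup>2) / 2 \<le> 1\<close>, we have \<open>p\<^sub>i + q\<^sub>i \<le> \<surd>2\<close>, and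
  \<open>p\<^sub>i + q\<^sub>i \<le> 1\<close> for the party that receives only local sources. Superadditivity of the geometric mean
  finishes the argument.

  Operators are handled through the kernels of their matrix elements, with the Schur product theorem
  as the main tool. The spaces are infinite-dimensional, so the trace is first replaced by its
  truncations to finite boxes of basis vectors, which approximate it uniformly in the hidden
  variables, the inputs and the outcomes.
\<close>

section \<open>Positive semidefinite kernels\<close>

text \<open>The kernel of a tensor product is the entrywise product of the kernels of its factors,
  each pulled back along a projection of the global basis. Closure of positivity under pullbacks and
  entrywise products therefore serves the factorisation by sources and the one by parties alike,
  although these group the coordinates \<open>(s, i)\<close> differently. In tr(\<rho> E) the
  entries pair up as \<rho>(z, w) E(w, z), so the operators of the parties meet the state with
  exchanged arguments.

  The error of a truncation is controlled by the diagonal of the state alone, because effects lie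
  between 0 and 1; this makes it uniform. The boxes are products of finite sets, so both
  factorisations survive, and truncated observables still lie between -1 and 1. Squares are formed
  after truncation, hence by finite sums.

  The purely local party contributes a factor 1 and each of the h - 1 other parties in \<Gamma> a
  factor \<surd>2; the h-th root of their product is the right-hand side.

  For complex z, \<open>0 \<le> z\<close> says that z is real and nonnegative, so positive kernels
  are hermitian.\<close>

definition psd :: "'x set \<Rightarrow> ('x \<Rightarrow> 'x \<Rightarrow> complex) \<Rightarrow> bool" where
  "psd X K \<longleftrightarrow> (\<forall>F v. finite F \<and> F \<subseteq> X \<longrightarrow> 0 \<le> (\<Sum>x\<in>F. \<Sum>y\<in>F. cnj (v x) * K x y * v y))"

lemma psdI:
  assumes "\<And>F v. finite F \<Longrightarrow> F \<subseteq> X \<Longrightarrow> 0 \<le> (\<Sum>x\<in>F. \<Sum>y\<in>F. cnj (v x) * K x y * v y)"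
  shows "psd X K"
  using assms by (auto simp: psd_def)

lemma psdD:
  "psd X K \<Longrightarrow> finite F \<Longrightarrow> F \<subseteq> X \<Longrightarrow> 0 \<le> (\<Sum>x\<in>F. \<Sum>y\<in>F. cnj (v x) * K x y * v y)"
  by (auto simp: psd_def)

lemma psd_subset: "psd X K \<Longrightarrow> Y \<subseteq> X \<Longrightarrow> psd Y K"
  unfolding psd_def by blast

lemma psd_cong:
  assumes "psd X K" "\<And>x y. x \<in> X \<Longrightarrow> y \<in> X \<Longrightarrow> K x y = K' x y"
  shows "psd X K'"
proof (rule psdI)
  fix F and v :: "'a \<Rightarrow> complex"
  assume F: "finite F" "F \<subseteq> X"
  have "(\<Sum>x\<in>F. \<Sum>y\<in>F. cnj (v x) * K' x y * v y) = (\<Sum>x\<in>F. \<Sum>y\<in>F. cnj (v x) * K x y * v y)"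
    using F assms(2) by (intro sum.cong refl) (simp add: subset_iff)
  then show "0 \<le> (\<Sum>x\<in>F. \<Sum>y\<in>F. cnj (v x) * K' x y * v y)"
    using psdD[OF assms(1) F] by simp
qed

lemma cnj_mult_self_nonneg: "0 \<le> cnj z * z"
  by (simp add: less_eq_complex_def)

lemma psd_rank_one: "psd X (\<lambda>x y. f x * cnj (f y))"
proof (rule psdI)
  fix F and v :: "'a \<Rightarrow> complex"
  assume "finite F" "F \<subseteq> X"
  have "(\<Sum>x\<in>F. \<Sum>y\<in>F. cnj (v x) * (f x * cnj (f y)) * v y)
      = cnj (\<Sum>x\<in>F. cnj (f x) * v x) * (\<Sum>y\<in>F. cnj (f y) * v y)"
    by (simp add: sum_product mult_ac cnj_sum)
  then show "0 \<le> (\<Sum>x\<in>F. \<Sum>y\<in>F. cnj (v x) * (f x * cnj (f y)) * v y)"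
    using cnj_mult_self_nonneg by presburger
qed

lemma psd_one: "psd X (\<lambda>x y. 1)"
  using psd_rank_one[of X "\<lambda>_. 1"] by simp

lemma psd_zero: "psd X (\<lambda>x y. 0)"
  by (simp add: psd_def)

lemma psd_add: "psd X K \<Longrightarrow> psd X K' \<Longrightarrow> psd X (\<lambda>x y. K x y + K' x y)"
  unfolding psd_def by (simp add: ring_distribs sum.distrib add_nonneg_nonneg)

lemma psd_sum: "(\<And>k. k \<in> S \<Longrightarrow> psd X (K k)) \<Longrightarrow> psd X (\<lambda>x y. \<Sum>k\<in>S. K k x y)"
  by (induction S rule: infinite_finite_induct) (auto intro: psd_add psd_zero)

lemma psd_scale:
  assumes "psd X K" "0 \<le> c" shows "psd X (\<lambda>x y. c * K x y)"
proof (rule psdI)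
  fix F and v :: "'a \<Rightarrow> complex"
  assume F: "finite F" "F \<subseteq> X"
  have "(\<Sum>x\<in>F. \<Sum>y\<in>F. cnj (v x) * (c * K x y) * v y)
      = c * (\<Sum>x\<in>F. \<Sum>y\<in>F. cnj (v x) * K x y * v y)"
    by (simp add: sum_distrib_left mult_ac)
  then show "0 \<le> (\<Sum>x\<in>F. \<Sum>y\<in>F. cnj (v x) * (c * K x y) * v y)"
    by (simp only: mult_nonneg_nonneg[OF assms(2) psdD[OF assms(1) F]])
qed

lemma psd_transpose:
  assumes "psd X K" shows "psd X (\<lambda>x y. K y x)"
proof (rule psdI)
  fix F and v :: "'a \<Rightarrow> complex"
  assume F: "finite F" "F \<subseteq> X"
  have "(\<Sum>x\<in>F. \<Sum>y\<in>F. cnj (v x) * K y x * v y)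
      = (\<Sum>y\<in>F. \<Sum>x\<in>F. cnj (cnj (v y)) * K y x * cnj (v x))"
    by (subst sum.swap) (simp add: mult_ac)
  then show "0 \<le> (\<Sum>x\<in>F. \<Sum>y\<in>F. cnj (v x) * K y x * v y)"
    using psdD[OF assms F, of "\<lambda>x. cnj (v x)"] by simp
qed

text \<open>The weights of each fibre of \<open>\<pi>\<close> are added up, so non-injective maps
  are covered. For a projection that forgets coordinates this is tensoring with the all-ones kernel
  on them, which extends kernels of one source or one party to the global basis.\<close>

lemma psd_pullback:
  assumes "psd Y K" "\<pi> ` X \<subseteq> Y" shows "psd X (\<lambda>x y. K (\<pi> x) (\<pi> y))"
proof (rule psdI)
  fix F and v :: "'b \<Rightarrow> complex"
  assume F: "finite F" "F \<subseteq> X"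
  define w where "w u = (\<Sum>x\<in>{x\<in>F. \<pi> x = u}. v x)" for u
  have cw: "(\<Sum>x\<in>{x\<in>F. \<pi> x = u}. cnj (v x)) = cnj (w u)" for u
    by (simp add: w_def cnj_sum)
  have "(\<Sum>x\<in>F. \<Sum>y\<in>F. cnj (v x) * K (\<pi> x) (\<pi> y) * v y)
     = (\<Sum>x\<in>F. \<Sum>t\<in>\<pi> ` F. cnj (v x) * K (\<pi> x) t * w t)"
    unfolding w_def sum_distrib_left
    by (intro sum.cong refl, subst sum.image_gen[OF F(1), of _ \<pi>]) (auto intro!: sum.cong)
  also have "\<dots> = (\<Sum>u\<in>\<pi> ` F. \<Sum>x\<in>{x\<in>F. \<pi> x = u}. \<Sum>t\<in>\<pi> ` F. cnj (v x) * K u t * w t)"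
    by (subst sum.image_gen[OF F(1), of _ \<pi>]) (auto intro!: sum.cong)
  also have "\<dots> = (\<Sum>u\<in>\<pi> ` F. \<Sum>t\<in>\<pi> ` F. \<Sum>x\<in>{x\<in>F. \<pi> x = u}. cnj (v x) * K u t * w t)"
    by (intro sum.cong refl sum.swap)
  also have "\<dots> = (\<Sum>u\<in>\<pi> ` F. \<Sum>t\<in>\<pi> ` F. cnj (w u) * K u t * w t)"
    by (simp add: sum_distrib_right[symmetric] cw)
  finally show "0 \<le> (\<Sum>x\<in>F. \<Sum>y\<in>F. cnj (v x) * K (\<pi> x) (\<pi> y) * v y)"
    using psdD[OF assms(1), of "\<pi> ` F" w] F assms(2) by (metis finite_imageI image_mono order_trans)
qed

section \<open>Entries, Gram decompositions and Schur products of positive kernels\<close>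

lemma psd_diag: "psd X K \<Longrightarrow> x \<in> X \<Longrightarrow> 0 \<le> K x x"
  using psdD[of X K "{x}" "\<lambda>_. 1"] by simp

lemma psd_pair:
  assumes "psd X K" "x \<in> X" "y \<in> X" "x \<noteq> y"
  shows "0 \<le> cnj a * K x x * a + cnj a * K x y * b + cnj b * K y x * a + cnj b * K y y * b"
  using psdD[OF assms(1), of "{x, y}" "\<lambda>z. if z = x then a else b"] assms
  by (simp add: add.assoc split: if_splits)

lemma psd_hermitian:
  assumes "psd X K" "x \<in> X" "y \<in> X" shows "K y x = cnj (K x y)"
proof (cases "x = y")
  case True
  then show ?thesis using psd_diag[OF assms(1,2)] by (simp add: less_eq_complex_def complex_eq_iff)
next
  case False
  note p = psd_pair[OF assms False] psd_diag[OF assms(1,2)] psd_diag[OF assms(1,3)]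
  \<comment> \<open>The forms at (1, 1) and (1, i) have imaginary part 0; this gives the imaginary
    and the real part of the claim.\<close>
  from p(1)[of 1 1] p(1)[of 1 \<i>] p(2,3) show ?thesis
    by (simp add: less_eq_complex_def complex_eq_iff)
qed

lemma psd_zero_diag:
  assumes "psd X K" "x \<in> X" "y \<in> X" "K x x = 0" shows "K x y = 0"
proof (cases "x = y")
  case False
  have yy: "0 \<le> Re (K y y)" "Im (K y y) = 0" using psd_diag[OF assms(1,3)] by (auto simp: less_eq_complex_def)
  \<comment> \<open>Test vector with value \<open>- t * K x y\<close> at x and 1 at y: as
    \<open>K x x = 0\<close>, its form is K(y, y) - 2 t |K(x, y)|^2. If K(x, y) were nonzero, this t
    would make it -1.\<close>
  define t where "t = (Re (K y y) + 1) / (2 * (cmod (K x y))\<^sup>2)"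
  have h: "K y x = cnj (K x y)" by (rule psd_hermitian[OF assms(1-3)])
  have "0 \<le> Re (cnj (- of_real t * K x y) * K x x * (- of_real t * K x y) + cnj (- of_real t * K x y) * K x y * 1
      + cnj 1 * K y x * (- of_real t * K x y) + cnj 1 * K y y * 1)"
    using psd_pair[OF assms(1-3) False, of "- of_real t * K x y" 1]
    by (simp only: less_eq_complex_def) simp
  moreover have "cnj (- of_real t * K x y) * K x x * (- of_real t * K x y) + cnj (- of_real t * K x y) * K x y * 1
      + cnj 1 * K y x * (- of_real t * K x y) + cnj 1 * K y y * 1
     = K y y - 2 * of_real t * of_real ((cmod (K x y))\<^sup>2)"
    by (simp only: complex_norm_square h assms(4)) (simp add: algebra_simps)
  ultimately have "0 \<le> Re (K y y - 2 * of_real t * of_real ((cmod (K x y))\<^sup>2))"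
    by metis
  then have t: "2 * t * (cmod (K x y))\<^sup>2 \<le> Re (K y y)"
    by simp
  have "(cmod (K x y))\<^sup>2 \<le> 0"
  proof (rule ccontr)
    assume "\<not> ?thesis"
    then have p: "0 < (cmod (K x y))\<^sup>2" by simp
    have "2 * t * (cmod (K x y))\<^sup>2 = Re (K y y) + 1"
      using p by (simp add: t_def field_simps)
    with t show False by simp
  qed
  then show ?thesis by simp
qed (use assms in simp)

text \<open>Cholesky decomposition: one step of Gaussian elimination leaves a positive kernel.\<close>

lemma psd_gram:
  assumes "finite X" "psd X K"
  shows "\<exists>c. \<forall>x\<in>X. \<forall>y\<in>X. K x y = (\<Sum>k\<in>X. c k x * cnj (c k y))"
  using assms
proof (induction X arbitrary: K rule: finite_induct)
  case (insert z X)
  define d where "d = K z z"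
  have d: "0 \<le> d" unfolding d_def by (rule psd_diag[OF insert.prems]) simp
  define r where "r = sqrt (Re d)"
  have dr: "d = of_real r * of_real r"
    using d by (simp add: r_def less_eq_complex_def complex_eq_iff)
  have herm: "K z x = cnj (K x z)" if "x \<in> insert z X" for x
    by (rule psd_hermitian[OF insert.prems]) (use that in auto)
  have zero: "K x z = 0" if "d = 0" "x \<in> insert z X" for x
    using psd_zero_diag[OF insert.prems, of z x] herm[of x] that d_def by simp
  define K' where "K' x y = K x y - K x z * K z y / d" for x y
  have "psd X K'"
  proof (rule psdI)
    fix F and v :: "'a \<Rightarrow> complex"
    assume F: "finite F" "F \<subseteq> X"
    then have zF: "z \<notin> F" using insert.hyps by auto
    define b where "b = (\<Sum>y\<in>F. K z y * v y)"
    \<comment> \<open>This value at z minimises the form of \<open>K\<close> among the extensions of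
      v; completing the square turns the minimum into the form of \<open>K'\<close>.\<close>
    define u where "u = v(z := - b / d)"
    have cb: "cnj b = (\<Sum>x\<in>F. cnj (v x) * K x z)"
      unfolding b_def using F herm by (simp add: cnj_sum mult_ac subset_iff cong: sum.cong)
    have uF: "(\<Sum>y\<in>F. f y (u y)) = (\<Sum>y\<in>F. f y (v y))" for f :: "'a \<Rightarrow> complex \<Rightarrow> complex"
      using zF by (intro sum.cong) (auto simp: u_def)
    have cd: "cnj d = d" using d by (simp add: less_eq_complex_def complex_eq_iff)
    have "(\<Sum>x\<in>insert z F. \<Sum>y\<in>insert z F. cnj (u x) * K x y * u y)
      = cnj (u z) * d * u z + cnj (u z) * b + cnj b * u z + (\<Sum>x\<in>F. \<Sum>y\<in>F. cnj (v x) * K x y * v y)"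
    proof -
      have 1: "(\<Sum>y\<in>F. cnj (u z) * K z y * u y) = cnj (u z) * b"
        unfolding b_def using uF[of "\<lambda>y t. cnj (u z) * K z y * t"] by (simp add: sum_distrib_left mult_ac)
      have 2: "(\<Sum>x\<in>F. cnj (u x) * K x z * u z) = cnj b * u z"
        unfolding cb using uF[of "\<lambda>x t. cnj t * K x z * u z"] by (simp add: sum_distrib_right)
      have 3: "(\<Sum>x\<in>F. \<Sum>y\<in>F. cnj (u x) * K x y * u y) = (\<Sum>x\<in>F. \<Sum>y\<in>F. cnj (v x) * K x y * v y)"
        using zF by (intro sum.cong refl) (auto simp: u_def)
      show ?thesis using F(1) zF by (simp add: sum.distrib 1 2 3 d_def)
    qed
    also have "\<dots> = (\<Sum>x\<in>F. \<Sum>y\<in>F. cnj (v x) * K x y * v y) - cnj b * b / d"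
      by (cases "d = 0") (simp_all add: u_def cd field_simps)
    also have "\<dots> = (\<Sum>x\<in>F. \<Sum>y\<in>F. cnj (v x) * K' x y * v y)"
    proof -
      have "cnj b * b / d = (\<Sum>x\<in>F. \<Sum>y\<in>F. cnj (v x) * (K x z * K z y / d) * v y)"
        unfolding cb unfolding b_def sum_product sum_divide_distrib
        by (intro sum.cong refl) (simp add: mult_ac)
      then show ?thesis
        by (simp add: K'_def sum_subtractf right_diff_distrib left_diff_distrib)
    qed
    finally have eq: "(\<Sum>x\<in>insert z F. \<Sum>y\<in>insert z F. cnj (u x) * K x y * u y)
      = (\<Sum>x\<in>F. \<Sum>y\<in>F. cnj (v x) * K' x y * v y)" .
    have "0 \<le> (\<Sum>x\<in>insert z F. \<Sum>y\<in>insert z F. cnj (u x) * K x y * u y)"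
      by (rule psdD[OF insert.prems]) (use F in auto)
    then show "0 \<le> (\<Sum>x\<in>F. \<Sum>y\<in>F. cnj (v x) * K' x y * v y)"
      unfolding eq .
  qed
  then obtain c where c: "\<And>x y. x \<in> X \<Longrightarrow> y \<in> X \<Longrightarrow> K' x y = (\<Sum>k\<in>X. c k x * cnj (c k y))"
    using insert.IH by blast
  \<comment> \<open>Column z of the Cholesky factor is K(x, z) / \<surd>d, and the other columns are
    those for \<open>K'\<close>, extended by 0 at z. For \<open>d = 0\<close> the column at z is 0 /
    0 = 0, in agreement with \<open>zero\<close>.\<close>
  define e where "e k x = (if k = z then K x z / of_real r else if x = z then 0 else c k x)" for k x
  have ez: "e z x * cnj (e z y) = K x z * K z y / d" if "y \<in> insert z X" for x y
    using herm[OF that] by (simp add: e_def dr)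
  have "K x y = (\<Sum>k\<in>insert z X. e k x * cnj (e k y))" if xy: "x \<in> insert z X" "y \<in> insert z X" for x y
  proof -
    have "(\<Sum>k\<in>X. e k x * cnj (e k y)) = K' x y"
    proof (cases "x = z \<or> y = z")
      case True
      have zx: "K z t = 0" if "d = 0" "t \<in> insert z X" for t
        using herm[OF that(2)] zero[OF that] by simp
      have "K' x y = 0"
      proof (cases "d = 0")
        case True
        then show ?thesis using zero[OF True] zx[OF True] xy \<open>x = z \<or> y = z\<close> by (auto simp: K'_def)
      next
        case False
        then show ?thesis using True by (auto simp: K'_def d_def)
      qed
      moreover have "e k x * cnj (e k y) = 0" if "k \<in> X" for k
        using True that insert.hyps by (auto simp: e_def)
      then have "(\<Sum>k\<in>X. e k x * cnj (e k y)) = 0" by (rule sum.neutral[OF ballI])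
      ultimately show ?thesis by (rule trans[OF _ sym, rotated])
    next
      case False
      then have xyX: "x \<in> X" "y \<in> X" "x \<noteq> z" "y \<noteq> z" using xy by auto
      have "e k x * cnj (e k y) = c k x * cnj (c k y)" if "k \<in> X" for k
        using xyX that insert.hyps by (auto simp: e_def)
      then show ?thesis unfolding c[OF xyX(1,2)] by (rule sum.cong[OF refl])
    qed
    then show ?thesis using insert.hyps ez[OF xy(2)] by (simp add: K'_def)
  qed
  then show ?case by blast
qed simp

text \<open>Schur product theorem: a Gram decomposition of \<open>K\<close> turns the form of the
  product into a sum of forms of \<open>K'\<close>, one for each k, at the vectors
  \<open>cnj (c k x) * v x\<close>.\<close>

lemma psd_mult:
  assumes "psd X K" "psd X K'" shows "psd X (\<lambda>x y. K x y * K' x y)"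
proof (rule psdI)
  fix F and v :: "'a \<Rightarrow> complex"
  assume F: "finite F" "F \<subseteq> X"
  obtain c where c: "\<And>x y. x \<in> F \<Longrightarrow> y \<in> F \<Longrightarrow> K x y = (\<Sum>k\<in>F. c k x * cnj (c k y))"
    using psd_gram[OF F(1) psd_subset[OF assms(1) F(2)]] by blast
  have "(\<Sum>x\<in>F. \<Sum>y\<in>F. cnj (v x) * (K x y * K' x y) * v y)
     = (\<Sum>x\<in>F. \<Sum>y\<in>F. \<Sum>k\<in>F. cnj (cnj (c k x) * v x) * K' x y * (cnj (c k y) * v y))"
    using c by (intro sum.cong refl) (simp add: sum_distrib_left sum_distrib_right mult_ac)
  also have "\<dots> = (\<Sum>x\<in>F. \<Sum>k\<in>F. \<Sum>y\<in>F. cnj (cnj (c k x) * v x) * K' x y * (cnj (c k y) * v y))"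
    by (intro sum.cong refl sum.swap)
  also have "\<dots> = (\<Sum>k\<in>F. \<Sum>x\<in>F. \<Sum>y\<in>F. cnj (cnj (c k x) * v x) * K' x y * (cnj (c k y) * v y))"
    by (rule sum.swap)
  also have "0 \<le> \<dots>"
    by (intro sum_nonneg psdD[OF assms(2) F])
  finally show "0 \<le> (\<Sum>x\<in>F. \<Sum>y\<in>F. cnj (v x) * (K x y * K' x y) * v y)" .
qed

lemma psd_prod:
  "(\<And>k. k \<in> S \<Longrightarrow> psd X (K k)) \<Longrightarrow> psd X (\<lambda>x y. \<Prod>k\<in>S. K k x y)"
  by (induction S rule: infinite_finite_induct) (auto intro: psd_mult psd_one)

text \<open>Induction by D_j D - E_j E = (D_j - E_j) D + E_j (D - E), where D and E are the products
  over the other indices. Both summands are Schur products of positive kernels.\<close>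

lemma psd_prod_mono:
  assumes "finite S" "\<And>k. k \<in> S \<Longrightarrow> psd X (E k)"
    and "\<And>k. k \<in> S \<Longrightarrow> psd X (\<lambda>x y. D k x y - E k x y)"
  shows "psd X (\<lambda>x y. (\<Prod>k\<in>S. D k x y) - (\<Prod>k\<in>S. E k x y))"
  using assms
proof (induction S rule: finite_induct)
  case (insert j S)
  have D: "psd X (\<lambda>x y. \<Prod>k\<in>S. D k x y)"
  proof (rule psd_prod)
    fix k assume "k \<in> S"
    then show "psd X (D k)"
      using psd_add[OF insert.prems(2)[of k] insert.prems(1)[of k]] by simp
  qed
  have "psd X (\<lambda>x y. (D j x y - E j x y) * (\<Prod>k\<in>S. D k x y)
     + E j x y * ((\<Prod>k\<in>S. D k x y) - (\<Prod>k\<in>S. E k x y)))"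
    by (intro psd_add psd_mult D insert) auto
  then show ?case using insert.hyps by (simp add: algebra_simps)
qed (simp add: psd_zero)

definition kdelta :: "'x \<Rightarrow> 'x \<Rightarrow> complex" where
  "kdelta x y = of_bool (x = y)"

lemma psd_kdelta: "psd X kdelta"
proof (rule psdI)
  fix F and v :: "'a \<Rightarrow> complex"
  assume F: "finite F" "F \<subseteq> X"
  have "cnj (v x) * kdelta x y * v y = (if x = y then cnj (v x) * v x else 0)" for x y
    by (simp add: kdelta_def)
  then have "(\<Sum>x\<in>F. \<Sum>y\<in>F. cnj (v x) * kdelta x y * v y) = (\<Sum>x\<in>F. cnj (v x) * v x)"
    using F by simp
  then show "0 \<le> (\<Sum>x\<in>F. \<Sum>y\<in>F. cnj (v x) * kdelta x y * v y)"
    by (simp add: sum_nonneg cnj_mult_self_nonneg del: complex_cnj_mult)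
qed

lemma psd_sum_nonneg:
  "psd X K \<Longrightarrow> finite A \<Longrightarrow> A \<subseteq> X \<Longrightarrow> 0 \<le> (\<Sum>x\<in>A. \<Sum>y\<in>A. K x y)"
  using psdD[of X K A "\<lambda>_. 1"] by simp

text \<open>In a Gram decomposition on \<open>A \<union> B\<close> the three sums are inner products
  of the vectors \<open>f A\<close> and \<open>f B\<close>, so this is the ordinary Cauchy-Schwarz
  inequality.\<close>

lemma psd_cauchy_schwarz:
  assumes "psd X K" "finite A" "A \<subseteq> X" "finite B" "B \<subseteq> X"
  shows "cmod (\<Sum>x\<in>A. \<Sum>y\<in>B. K x y)
    \<le> sqrt (Re (\<Sum>x\<in>A. \<Sum>y\<in>A. K x y)) * sqrt (Re (\<Sum>x\<in>B. \<Sum>y\<in>B. K x y))"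
proof -
  define U where "U = A \<union> B"
  have U: "finite U" "U \<subseteq> X" using assms by (auto simp: U_def)
  obtain c where c: "\<And>x y. x \<in> U \<Longrightarrow> y \<in> U \<Longrightarrow> K x y = (\<Sum>k\<in>U. c k x * cnj (c k y))"
    using psd_gram[OF U(1) psd_subset[OF assms(1) U(2)]] by blast
  define f where "f S k = (\<Sum>x\<in>S. c k x)" for S k
  have blk: "(\<Sum>x\<in>S. \<Sum>y\<in>T. K x y) = (\<Sum>k\<in>U. f S k * cnj (f T k))" if "S \<subseteq> U" "T \<subseteq> U" for S T
  proof -
    have "(\<Sum>x\<in>S. \<Sum>y\<in>T. K x y) = (\<Sum>x\<in>S. \<Sum>y\<in>T. \<Sum>k\<in>U. c k x * cnj (c k y))"
      using that c by (intro sum.cong refl) auto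
    also have "\<dots> = (\<Sum>x\<in>S. \<Sum>k\<in>U. \<Sum>y\<in>T. c k x * cnj (c k y))"
      by (intro sum.cong refl sum.swap)
    also have "\<dots> = (\<Sum>k\<in>U. \<Sum>x\<in>S. \<Sum>y\<in>T. c k x * cnj (c k y))"
      by (rule sum.swap)
    also have "\<dots> = (\<Sum>k\<in>U. f S k * cnj (f T k))"
      by (simp add: f_def sum_product cnj_sum)
    finally show ?thesis .
  qed
  have sq: "Re (\<Sum>x\<in>S. \<Sum>y\<in>S. K x y) = (\<Sum>k\<in>U. (cmod (f S k))\<^sup>2)" if "S \<subseteq> U" for S
    unfolding blk[OF that that] complex_norm_square[symmetric] by simp
  have "cmod (\<Sum>x\<in>A. \<Sum>y\<in>B. K x y) \<le> (\<Sum>k\<in>U. cmod (f A k) * cmod (f B k))"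
    unfolding blk[OF Un_upper1[of A B, folded U_def] Un_upper2[of B A, folded U_def]]
    by (rule order.trans[OF norm_sum]) (simp add: norm_mult)
  also have "\<dots> \<le> L2_set (\<lambda>k. cmod (f A k)) U * L2_set (\<lambda>k. cmod (f B k)) U"
    using L2_set_mult_ineq[of "\<lambda>k. cmod (f A k)" "\<lambda>k. cmod (f B k)" U] by simp
  finally show ?thesis
    unfolding L2_set_def sq[OF Un_upper1[of A B, folded U_def]] sq[OF Un_upper2[of B A, folded U_def]] .
qed

section \<open>Truncation of the trace\<close>

text \<open>Splitting a finite set by the sign of \<open>f\<close> bounds its absolute sum by two
  signed partial sums, hence by 2B, so the family is absolutely summable.\<close>

lemma real_summable_on_bounded:
  fixes f :: "'a \<Rightarrow> real"
  assumes "\<And>F. finite F \<Longrightarrow> F \<subseteq> A \<Longrightarrow> \<bar>sum f F\<bar> \<le> B"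
  shows "f summable_on A"
proof -
  have "(\<Sum>x\<in>F. \<bar>f x\<bar>) \<le> 2 * B" if F: "finite F" "F \<subseteq> A" for F
  proof -
    define P where "P = {x\<in>F. 0 \<le> f x}"
    have P: "P \<subseteq> F" by (auto simp: P_def)
    have "(\<Sum>x\<in>F. \<bar>f x\<bar>) = (\<Sum>x\<in>F - P. \<bar>f x\<bar>) + (\<Sum>x\<in>P. \<bar>f x\<bar>)"
      by (rule sum.subset_diff[OF P F(1)])
    also have "(\<Sum>x\<in>F - P. \<bar>f x\<bar>) = - sum f (F - P)"
      unfolding sum_negf[symmetric] by (rule sum.cong) (auto simp: P_def)
    also have "(\<Sum>x\<in>P. \<bar>f x\<bar>) = sum f P"
      by (rule sum.cong) (auto simp: P_def)
    finally have "(\<Sum>x\<in>F. \<bar>f x\<bar>) = sum f P - sum f (F - P)" by simp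
    moreover have "\<bar>sum f P\<bar> \<le> B"
      by (rule assms) (use F P finite_subset[OF P F(1)] in auto)
    moreover have "\<bar>sum f (F - P)\<bar> \<le> B"
      by (rule assms) (use F in auto)
    ultimately show ?thesis by linarith
  qed
  then have "bdd_above (sum (\<lambda>x. \<bar>f x\<bar>) ` {F. F \<subseteq> A \<and> finite F})"
    by (intro bdd_aboveI2[where M = "2 * B"]) auto
  then have "(\<lambda>x. \<bar>f x\<bar>) summable_on A"
    by (intro nonneg_bdd_above_summable_on) auto
  then show ?thesis unfolding real_norm_def[symmetric] by (rule abs_summable_summable)
qed

lemma complex_summable_on_bounded:
  fixes f :: "'a \<Rightarrow> complex"
  assumes "\<And>F. finite F \<Longrightarrow> F \<subseteq> A \<Longrightarrow> cmod (sum f F) \<le> B"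
  shows "f summable_on A"
proof -
  have "(\<lambda>x. Re (f x)) summable_on A"
  proof (rule real_summable_on_bounded)
    fix F assume "finite F" "F \<subseteq> A"
    then show "\<bar>\<Sum>x\<in>F. Re (f x)\<bar> \<le> B"
      using assms[of F] abs_Re_le_cmod[of "sum f F"] by simp
  qed
  moreover have "(\<lambda>x. Im (f x)) summable_on A"
  proof (rule real_summable_on_bounded)
    fix F assume "finite F" "F \<subseteq> A"
    then show "\<bar>\<Sum>x\<in>F. Im (f x)\<bar> \<le> B"
      using assms[of F] abs_Im_le_cmod[of "sum f F"] by simp
  qed
  ultimately have "(\<lambda>x. complex_of_real (Re (f x)) + \<i> * complex_of_real (Im (f x))) summable_on A"
    by (intro summable_on_add summable_on_cmult_right summable_on_bounded_linear[OF bounded_linear_of_real])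
  then show ?thesis by (simp add: complex_eq[symmetric])
qed

text \<open>The double series need not converge absolutely; the block bound is what makes the iterated sum
  close to its finite truncations.\<close>

lemma iterated_infsum_truncation:
  fixes H :: "'x \<Rightarrow> 'x \<Rightarrow> complex" and g :: "'x \<Rightarrow> real"
  assumes block: "\<And>A B. finite A \<Longrightarrow> A \<subseteq> X \<Longrightarrow> finite B \<Longrightarrow> B \<subseteq> X \<Longrightarrow>
      cmod (\<Sum>x\<in>A. \<Sum>y\<in>B. H x y) \<le> sqrt (sum g A) * sqrt (sum g B)"
    and g: "\<And>A. finite A \<Longrightarrow> A \<subseteq> X \<Longrightarrow> 0 \<le> sum g A"
    and le1: "\<And>A. finite A \<Longrightarrow> A \<subseteq> X \<Longrightarrow> sum g A \<le> 1"
    and F: "finite F" "F \<subseteq> X"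
    and tail: "\<And>A. finite A \<Longrightarrow> A \<subseteq> X - F \<Longrightarrow> sum g A \<le> \<epsilon>"
  shows "cmod ((\<Sum>\<^sub>\<infinity>x\<in>X. \<Sum>\<^sub>\<infinity>y\<in>X. H x y) - (\<Sum>x\<in>F. \<Sum>y\<in>F. H x y)) \<le> 2 * sqrt \<epsilon>"
proof -
  have \<epsilon>: "0 \<le> \<epsilon>" using tail[of "{}"] by simp
  define t where "t x = (\<Sum>\<^sub>\<infinity>y\<in>X. H x y)" for x
  have block1: "cmod (\<Sum>x\<in>A. \<Sum>y\<in>B. H x y) \<le> 1"
    if "finite A" "A \<subseteq> X" "finite B" "B \<subseteq> X" for A B
  proof -
    have "sqrt (sum g A) * sqrt (sum g B) \<le> 1 * 1"
      using le1[OF that(1,2)] le1[OF that(3,4)] g[of B] that by (intro mult_mono) auto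
    then show ?thesis using block[OF that] by simp
  qed
  have row: "((\<lambda>B. \<Sum>y\<in>B. H x y) \<longlongrightarrow> t x) (finite_subsets_at_top X)" if "x \<in> X" for x
  proof -
    have "H x summable_on X"
      by (rule complex_summable_on_bounded[where B = 1]) (use block1[of "{x}"] that in simp)
    then show ?thesis unfolding t_def by (rule infsum_tendsto)
  qed
  have rows: "((\<lambda>B. \<Sum>x\<in>A. \<Sum>y\<in>B. H x y) \<longlongrightarrow> sum t A) (finite_subsets_at_top X)" if "A \<subseteq> X" for A
    by (rule tendsto_sum) (use row that in auto)
  have "t summable_on X"
  proof (rule complex_summable_on_bounded[where B = 1])
    fix A assume A: "finite A" "A \<subseteq> X"
    show "cmod (sum t A) \<le> 1"
      by (rule tendsto_upperbound[OF tendsto_norm[OF rows[OF A(2)]]])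
        (use block1[OF A] in \<open>auto intro!: eventually_finite_subsets_at_top_weakI\<close>)
  qed
  then have lim: "((\<lambda>A. sum t A) \<longlongrightarrow> infsum t X) (finite_subsets_at_top X)"
    by (rule infsum_tendsto)
  \<comment> \<open>A \<times> B without F \<times> F consists of (A - F) \<times> B and F \<times>
    (B - F). In each piece the side avoiding F contributes \<surd>\<epsilon> and the other at most
    1.\<close>
  have rect: "cmod ((\<Sum>x\<in>A. \<Sum>y\<in>B. H x y) - (\<Sum>x\<in>F. \<Sum>y\<in>F. H x y)) \<le> 2 * sqrt \<epsilon>"
    if A: "finite A" "F \<subseteq> A" "A \<subseteq> X" and B: "finite B" "F \<subseteq> B" "B \<subseteq> X" for A B
  proof -
    have small: "sqrt (sum g C) * sqrt (sum g D) \<le> sqrt \<epsilon>"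
      if C: "finite C" "C \<subseteq> X - F" and D: "finite D" "D \<subseteq> X" for C D
    proof -
      have nn: "0 \<le> sum g C" "0 \<le> sum g D" using g[of C] g[of D] C D by auto
      have "sqrt (sum g C) * sqrt (sum g D) \<le> sqrt \<epsilon> * 1"
        by (intro mult_mono) (use nn tail[OF C] le1[OF D] \<epsilon> in auto)
      then show ?thesis by simp
    qed
    have "(\<Sum>x\<in>A. \<Sum>y\<in>B. H x y) = (\<Sum>x\<in>A - F. \<Sum>y\<in>B. H x y) + (\<Sum>x\<in>F. \<Sum>y\<in>B. H x y)"
      by (rule sum.subset_diff[OF A(2,1)])
    also have "(\<Sum>x\<in>F. \<Sum>y\<in>B. H x y) = (\<Sum>x\<in>F. \<Sum>y\<in>B - F. H x y) + (\<Sum>x\<in>F. \<Sum>y\<in>F. H x y)"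
      unfolding sum.distrib[symmetric] by (intro sum.cong refl sum.subset_diff[OF B(2,1)])
    finally have "cmod ((\<Sum>x\<in>A. \<Sum>y\<in>B. H x y) - (\<Sum>x\<in>F. \<Sum>y\<in>F. H x y))
        \<le> cmod (\<Sum>x\<in>A - F. \<Sum>y\<in>B. H x y) + cmod (\<Sum>x\<in>F. \<Sum>y\<in>B - F. H x y)"
      by (simp add: norm_triangle_ineq)
    also have "\<dots> \<le> sqrt \<epsilon> + sqrt \<epsilon>"
    proof (rule add_mono)
      show "cmod (\<Sum>x\<in>A - F. \<Sum>y\<in>B. H x y) \<le> sqrt \<epsilon>"
        using block[of "A - F" B] small[of "A - F" B] A B by (meson Diff_mono finite_Diff order_refl order_trans Diff_subset)
      show "cmod (\<Sum>x\<in>F. \<Sum>y\<in>B - F. H x y) \<le> sqrt \<epsilon>"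
        using block[of F "B - F"] small[of "B - F" F] F B
        by (metis Diff_mono Diff_subset finite_Diff mult.commute order_refl order_trans)
    qed
    finally show ?thesis by simp
  qed
  \<comment> \<open>The limit in B is taken for fixed A, and only then the limit in A: this is the
    order of the iterated sum.\<close>
  have "cmod (sum t A - (\<Sum>x\<in>F. \<Sum>y\<in>F. H x y)) \<le> 2 * sqrt \<epsilon>"
    if A: "finite A" "F \<subseteq> A" "A \<subseteq> X" for A
    by (rule tendsto_upperbound[OF tendsto_norm[OF tendsto_diff[OF rows[OF A(3)] tendsto_const]]])
      (use rect[OF A] F in \<open>auto simp: eventually_finite_subsets_at_top intro!: exI[of _ F]\<close>)
  then have "cmod (infsum t X - (\<Sum>x\<in>F. \<Sum>y\<in>F. H x y)) \<le> 2 * sqrt \<epsilon>"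
    by (intro tendsto_upperbound[OF tendsto_norm[OF tendsto_diff[OF lim tendsto_const]]])
      (use F in \<open>auto simp: eventually_finite_subsets_at_top intro!: exI[of _ F]\<close>)
  then show ?thesis unfolding t_def .
qed

text \<open>Cauchy-Schwarz leaves only diagonal blocks of the Schur product of \<open>G\<close> with
  the transpose of \<open>E\<close>. As \<open>E\<close> is at most the identity, these are at most
  the blocks of \<open>G\<close> times the identity, which are sums of diagonal entries. The bound
  thus no longer contains \<open>E\<close>.\<close>

lemma psd_effect_block_bound:
  assumes G: "psd X G" and E: "psd X E" and E1: "psd X (\<lambda>x y. kdelta x y - E x y)"
    and A: "finite A" "A \<subseteq> X" and B: "finite B" "B \<subseteq> X"
  shows "cmod (\<Sum>x\<in>A. \<Sum>y\<in>B. G x y * E y x)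
    \<le> sqrt (\<Sum>x\<in>A. Re (G x x)) * sqrt (\<Sum>y\<in>B. Re (G y y))"
proof -
  have H: "psd X (\<lambda>x y. G x y * E y x)"
    by (rule psd_mult[OF G psd_transpose[OF E]])
  have H1: "psd X (\<lambda>x y. G x y * (kdelta y x - E y x))"
    using psd_mult[OF G psd_transpose[OF E1]] .
  have le: "0 \<le> Re (\<Sum>x\<in>C. \<Sum>y\<in>C. G x y * E y x) \<and>
      Re (\<Sum>x\<in>C. \<Sum>y\<in>C. G x y * E y x) \<le> (\<Sum>x\<in>C. Re (G x x))" if "finite C" "C \<subseteq> X" for C
  proof -
    have "(\<Sum>x\<in>C. \<Sum>y\<in>C. G x y * kdelta y x) = (\<Sum>x\<in>C. \<Sum>y\<in>C. if x = y then G x x else 0)"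
      by (intro sum.cong refl) (auto simp: kdelta_def)
    also have "\<dots> = (\<Sum>x\<in>C. G x x)" using that by simp
    finally have d: "(\<Sum>x\<in>C. \<Sum>y\<in>C. G x y * kdelta y x) = (\<Sum>x\<in>C. G x x)" .
    have "0 \<le> (\<Sum>x\<in>C. \<Sum>y\<in>C. G x y * (kdelta y x - E y x))"
      by (rule psd_sum_nonneg[OF H1 that])
    then have "0 \<le> (\<Sum>x\<in>C. G x x) - (\<Sum>x\<in>C. \<Sum>y\<in>C. G x y * E y x)"
      by (simp only: right_diff_distrib sum_subtractf d)
    moreover have "0 \<le> (\<Sum>x\<in>C. \<Sum>y\<in>C. G x y * E y x)"
      by (rule psd_sum_nonneg[OF H that])
    ultimately show ?thesis by (simp add: less_eq_complex_def)
  qed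
  have "cmod (\<Sum>x\<in>A. \<Sum>y\<in>B. G x y * E y x)
      \<le> sqrt (Re (\<Sum>x\<in>A. \<Sum>y\<in>A. G x y * E y x)) * sqrt (Re (\<Sum>x\<in>B. \<Sum>y\<in>B. G x y * E y x))"
    by (rule psd_cauchy_schwarz[OF H A B])
  also have "\<dots> \<le> sqrt (\<Sum>x\<in>A. Re (G x x)) * sqrt (\<Sum>y\<in>B. Re (G y y))"
    using le[OF A] le[OF B] by (intro mult_mono real_sqrt_le_mono) auto
  finally show ?thesis .
qed

section \<open>Matrix elements and traces of tensor products\<close>

lemma infsum_single_support:
  assumes "x \<in> X" "\<And>y. y \<in> X \<Longrightarrow> y \<noteq> x \<Longrightarrow> f y = 0"
  shows "infsum f X = (f x :: complex)"
proof -
  have "infsum f X = infsum f {x}"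
    by (rule infsum_cong_neutral) (use assms in auto)
  then show ?thesis by simp
qed

lemma mat_elem_apply: "x \<in> X \<Longrightarrow> mat_elem X T x y = T (ket y) x"
  unfolding mat_elem_def ell2_inner_def
  by (subst infsum_single_support[of x]) (auto simp: ket_def)

lemma tensor_operator_ket:
  assumes "x \<in> X" "y \<in> X"
  shows "tensor_operator X K \<pi> Y T (ket y) x = (\<Prod>k\<in>K. mat_elem (Y k) (T k) (\<pi> k x) (\<pi> k y))"
  unfolding tensor_operator_def using assms
  by (simp, subst infsum_single_support[of y]) (auto simp: ket_def)

text \<open>Both sides unfold to the same iterated sum, whether or not it converges: the inner sum
  is the action of the first operator, the outer one the trace.\<close>

lemma op_trace_tensor_comp:
  "op_trace X (tensor_operator X K1 \<pi>1 Y1 T1 \<circ> tensor_operator X K2 \<pi>2 Y2 T2)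
   = (\<Sum>\<^sub>\<infinity>x\<in>X. \<Sum>\<^sub>\<infinity>y\<in>X. (\<Prod>k\<in>K1. mat_elem (Y1 k) (T1 k) (\<pi>1 k x) (\<pi>1 k y)) *
        (\<Prod>k\<in>K2. mat_elem (Y2 k) (T2 k) (\<pi>2 k y) (\<pi>2 k x)))"
  unfolding op_trace_def
proof (rule infsum_cong)
  fix x assume x: "x \<in> X"
  show "mat_elem X (tensor_operator X K1 \<pi>1 Y1 T1 \<circ> tensor_operator X K2 \<pi>2 Y2 T2) x x
    = (\<Sum>\<^sub>\<infinity>y\<in>X. (\<Prod>k\<in>K1. mat_elem (Y1 k) (T1 k) (\<pi>1 k x) (\<pi>1 k y)) *
        (\<Prod>k\<in>K2. mat_elem (Y2 k) (T2 k) (\<pi>2 k y) (\<pi>2 k x)))"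
    unfolding mat_elem_apply[OF x] o_def
    unfolding tensor_operator_def[of X K1]
    using x by (simp, intro infsum_cong) (simp add: tensor_operator_ket)
qed

section \<open>Operators, factorisation of finite sums, geometric means\<close>

lemma finite_support_ell2:
  assumes "finite F" "F \<subseteq> X"
  shows "(\<lambda>x. if x \<in> F then v x else 0) \<in> ell2 X"
proof -
  have "(\<lambda>x. (cmod (v x))\<^sup>2) summable_on F" using assms by simp
  then have "(\<lambda>x. (cmod (if x \<in> F then v x else 0))\<^sup>2) summable_on X"
    by (rule summable_on_cong_neutral[THEN iffD1, rotated -1]) (use assms in auto)
  then show ?thesis using assms by (auto simp: ell2_def)
qed

lemma ket_ell2: "x \<in> X \<Longrightarrow> ket x \<in> ell2 X"
  using finite_support_ell2[of "{x}" X "\<lambda>_. 1"] by (simp add: ket_def)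

lemma bounded_operator_apply_finite:
  assumes "bounded_operator X T" "finite F" "F \<subseteq> X"
  shows "T (\<lambda>x. if x \<in> F then v x else 0) = (\<lambda>x. \<Sum>y\<in>F. v y * T (ket y) x)"
proof -
  have add: "\<And>u v. u \<in> ell2 X \<Longrightarrow> v \<in> ell2 X \<Longrightarrow> T (\<lambda>x. u x + v x) = (\<lambda>x. T u x + T v x)"
    and scale: "\<And>c v. v \<in> ell2 X \<Longrightarrow> T (\<lambda>x. c * v x) = (\<lambda>x. c * T v x)"
    using assms(1) by (auto simp: bounded_operator_def)
  show ?thesis using assms(2,3)
  proof (induction F rule: finite_induct)
    case empty
    have "(\<lambda>x. 0) \<in> ell2 X" using finite_support_ell2[of "{}" X] by simp
    from scale[OF this, of 0] show ?case by simp
  next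
    case (insert z F)
    let ?w = "\<lambda>x. if x \<in> F then v x else 0"
    have split: "(\<lambda>x. if x \<in> insert z F then v x else 0) = (\<lambda>x. v z * ket z x + ?w x)"
      using insert.hyps by (auto simp: ket_def)
    have k: "ket z \<in> ell2 X" using insert.prems by (intro ket_ell2) auto
    have "(\<lambda>x. if x \<in> {z} then v x else 0) \<in> ell2 X"
      by (rule finite_support_ell2) (use insert.prems in auto)
    also have "(\<lambda>x. if x \<in> {z} then v x else 0) = (\<lambda>x. v z * ket z x)"
      by (auto simp: ket_def)
    finally have "T (\<lambda>x. v z * ket z x + ?w x) = (\<lambda>x. T (\<lambda>x. v z * ket z x) x + T ?w x)"
      using insert.hyps insert.prems by (intro add finite_support_ell2) auto
    then show ?case
      unfolding split using insert by (simp add: scale[OF k])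
  qed
qed

text \<open>Finite quadratic forms of the kernel are those of \<open>T\<close> at finitely supported
  vectors, where linearity expresses \<open>T\<close> through its matrix elements.\<close>

lemma positive_operator_psd:
  assumes "positive_operator X T"
  shows "psd X (mat_elem X T)"
proof (rule psdI)
  fix F and v :: "'a \<Rightarrow> complex"
  assume F: "finite F" "F \<subseteq> X"
  let ?w = "\<lambda>x. if x \<in> F then v x else 0"
  have "bounded_operator X T" using assms by (simp add: positive_operator_def)
  note ap = bounded_operator_apply_finite[OF this F, of v]
  have "ell2_inner X ?w (T ?w) \<in> \<real>\<^sub>\<ge>\<^sub>0"
    using assms finite_support_ell2[OF F] by (auto simp: positive_operator_def)
  moreover have "ell2_inner X ?w (T ?w) = (\<Sum>\<^sub>\<infinity>x\<in>F. cnj (v x) * T ?w x)"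
    unfolding ell2_inner_def by (rule infsum_cong_neutral) (use F in auto)
  moreover have "\<dots> = (\<Sum>x\<in>F. \<Sum>y\<in>F. cnj (v x) * mat_elem X T x y * v y)"
    using F mat_elem_apply[of _ X T] unfolding ap
    by (auto simp: sum_distrib_left mult_ac subset_iff intro!: sum.cong)
  ultimately show "0 \<le> (\<Sum>x\<in>F. \<Sum>y\<in>F. cnj (v x) * mat_elem X T x y * v y)"
    by (auto simp: less_eq_complex_def complex_nonneg_Reals_iff)
qed

lemma measurement_mat_elem_sum:
  assumes "two_outcome_measurement X E" "x \<in> X" "y \<in> X"
  shows "mat_elem X (E 1) x y + mat_elem X (E (-1)) x y = kdelta x y"
proof -
  have "(\<lambda>x. E 1 (ket y) x + E (-1) (ket y) x) = ket y"
    using assms ket_ell2[OF assms(3)] by (auto simp: two_outcome_measurement_def)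
  from fun_cong[OF this, of x] show ?thesis
    using assms by (simp add: mat_elem_apply ket_def kdelta_def)
qed

lemma density_operator_psd: "density_operator X T \<Longrightarrow> psd X (mat_elem X T)"
  by (simp add: density_operator_def positive_operator_psd)

lemma density_operator_diag_sum_le:
  assumes "density_operator X T" "finite F" "F \<subseteq> X"
  shows "(\<Sum>x\<in>F. Re (mat_elem X T x x)) \<le> 1"
proof -
  have "((\<lambda>x. Re (mat_elem X T x x)) has_sum Re 1) X"
    using assms by (intro has_sum_Re) (simp add: density_operator_def)
  then have "((\<lambda>x. Re (mat_elem X T x x)) has_sum 1) X" by simp
  then show ?thesis
    by (rule finite_sum_le_has_sum[OF _ assms(2,3)])
      (use psd_diag[OF density_operator_psd[OF assms(1)]] in \<open>auto simp: less_eq_complex_def\<close>)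
qed

section \<open>Factorisation of sums over product sets\<close>

definition depends_on :: "'k set \<Rightarrow> (('k \<Rightarrow> 'b) \<Rightarrow> 'c) \<Rightarrow> bool" where
  "depends_on A f \<longleftrightarrow> (\<forall>z w. (\<forall>p\<in>A. z p = w p) \<longrightarrow> f z = f w)"

lemma depends_onD: "depends_on A f \<Longrightarrow> (\<And>p. p \<in> A \<Longrightarrow> z p = w p) \<Longrightarrow> f z = f w"
  by (auto simp: depends_on_def)

lemma depends_on_mono: "depends_on A f \<Longrightarrow> A \<subseteq> B \<Longrightarrow> depends_on B f"
  unfolding depends_on_def by blast

lemma depends_on_prod:
  "(\<And>i. i \<in> I \<Longrightarrow> depends_on A (f i)) \<Longrightarrow> depends_on A (\<lambda>z. \<Prod>i\<in>I. f i z :: complex)"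
  unfolding depends_on_def by (intro allI impI prod.cong refl) blast

lemma sum_PiE_Un:
  fixes f g :: "('k \<Rightarrow> 'b) \<Rightarrow> complex"
  assumes "A \<inter> B = {}" "depends_on A f" "depends_on B g"
  shows "(\<Sum>z\<in>Pi\<^sub>E (A \<union> B) F. f z * g z) = (\<Sum>z\<in>Pi\<^sub>E A F. f z) * (\<Sum>z\<in>Pi\<^sub>E B F. g z)"
proof -
  \<comment> \<open>Gluing of a point over A and a point over B. Outside A it follows v, which is
    \<open>undefined\<close> off B, so the result is again extensional.\<close>
  define h where "h = (\<lambda>(u, v). \<lambda>p. if p \<in> A then u p else v p :: 'b)"
  have bij: "bij_betw h (Pi\<^sub>E A F \<times> Pi\<^sub>E B F) (Pi\<^sub>E (A \<union> B) F)"
  proof (rule bij_betw_byWitness[where f' = "\<lambda>z. (restrict z A, restrict z B)"])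
    show "\<forall>a\<in>Pi\<^sub>E A F \<times> Pi\<^sub>E B F. (restrict (h a) A, restrict (h a) B) = a"
    proof
      fix a assume "a \<in> Pi\<^sub>E A F \<times> Pi\<^sub>E B F"
      then obtain u v where a: "a = (u, v)" and uv: "u \<in> Pi\<^sub>E A F" "v \<in> Pi\<^sub>E B F" by blast
      have "restrict (h (u, v)) A = u"
        using PiE_arb[OF uv(1)] by (auto simp: h_def fun_eq_iff)
      moreover have "restrict (h (u, v)) B p = v p" for p
        using PiE_arb[OF uv(2), of p] assms(1) by (cases "p \<in> B") (auto simp: h_def)
      ultimately show "(restrict (h a) A, restrict (h a) B) = a"
        by (simp add: a fun_eq_iff)
    qed
    show "\<forall>z\<in>Pi\<^sub>E (A \<union> B) F. h (restrict z A, restrict z B) = z"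
    proof (intro ballI ext)
      fix z p assume "z \<in> Pi\<^sub>E (A \<union> B) F"
      then show "h (restrict z A, restrict z B) p = z p"
        using PiE_arb[of z "A \<union> B" F p] by (simp add: h_def restrict_def)
    qed
    show "h ` (Pi\<^sub>E A F \<times> Pi\<^sub>E B F) \<subseteq> Pi\<^sub>E (A \<union> B) F"
    proof
      fix y assume "y \<in> h ` (Pi\<^sub>E A F \<times> Pi\<^sub>E B F)"
      then obtain u v where y: "y = h (u, v)" and uv: "u \<in> Pi\<^sub>E A F" "v \<in> Pi\<^sub>E B F" by blast
      show "y \<in> Pi\<^sub>E (A \<union> B) F"
        unfolding y using PiE_mem[OF uv(1)] PiE_mem[OF uv(2)] PiE_arb[OF uv(2)]
        by (intro PiE_I) (auto simp: h_def)
    qed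
    show "(\<lambda>z. (restrict z A, restrict z B)) ` Pi\<^sub>E (A \<union> B) F \<subseteq> Pi\<^sub>E A F \<times> Pi\<^sub>E B F"
      by auto
  qed
  \<comment> \<open>\<open>depends_on\<close> compares arbitrary total functions, so it applies
    although h (u, v) and u lie in different product sets.\<close>
  have fh: "f (h (u, v)) = f u" for u v
    by (rule depends_onD[OF assms(2)]) (simp add: h_def)
  have gh: "g (h (u, v)) = g v" for u v
    by (rule depends_onD[OF assms(3)]) (use assms(1) in \<open>auto simp: h_def\<close>)
  have "(\<Sum>z\<in>Pi\<^sub>E (A \<union> B) F. f z * g z) = (\<Sum>a\<in>Pi\<^sub>E A F \<times> Pi\<^sub>E B F. f (h a) * g (h a))"
    by (rule sum.reindex_bij_betw[OF bij, symmetric])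
  also have "\<dots> = (\<Sum>(u, v)\<in>Pi\<^sub>E A F \<times> Pi\<^sub>E B F. f u * g v)"
    by (intro sum.cong refl) (auto simp: fh gh)
  also have "\<dots> = (\<Sum>z\<in>Pi\<^sub>E A F. f z) * (\<Sum>z\<in>Pi\<^sub>E B F. g z)"
    by (simp add: sum_product sum.cartesian_product)
  finally show ?thesis .
qed

lemma sum_PiE_UN:
  fixes f :: "'i \<Rightarrow> ('k \<Rightarrow> 'b) \<Rightarrow> complex"
  assumes "finite I" "disjoint_family_on B I" "\<And>i. i \<in> I \<Longrightarrow> depends_on (B i) (f i)"
  shows "(\<Sum>z\<in>Pi\<^sub>E (\<Union>i\<in>I. B i) F. \<Prod>i\<in>I. f i z) = (\<Prod>i\<in>I. \<Sum>z\<in>Pi\<^sub>E (B i) F. f i z)"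
  using assms
proof (induction I rule: finite_induct)
  case (insert j I)
  have "B j \<inter> (\<Union>i\<in>I. B i) = {}"
    using insert.prems(1) insert.hyps by (auto simp: disjoint_family_on_def)
  moreover have "depends_on (\<Union>i\<in>I. B i) (\<lambda>z. \<Prod>i\<in>I. f i z)"
    by (rule depends_on_prod) (use insert.prems(2) in \<open>auto intro: depends_on_mono\<close>)
  moreover have "disjoint_family_on B I"
    using insert.prems(1) by (rule disjoint_family_on_mono[rotated]) auto
  ultimately show ?case
    using insert by (simp add: sum_PiE_Un)
qed simp

text \<open>For fixed \<open>z\<close> the inner sum factorises over the blocks; its factors read
  only their own block of \<open>z\<close>, so the outer sum factorises too.\<close>

lemma sum_sum_PiE_UN:
  fixes f :: "'i \<Rightarrow> ('k \<Rightarrow> 'b) \<Rightarrow> ('k \<Rightarrow> 'b) \<Rightarrow> complex"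
  assumes "finite I" "disjoint_family_on B I"
    and 1: "\<And>i w. i \<in> I \<Longrightarrow> depends_on (B i) (\<lambda>z. f i z w)"
    and 2: "\<And>i z. i \<in> I \<Longrightarrow> depends_on (B i) (f i z)"
  shows "(\<Sum>z\<in>Pi\<^sub>E (\<Union>i\<in>I. B i) F. \<Sum>w\<in>Pi\<^sub>E (\<Union>i\<in>I. B i) F. \<Prod>i\<in>I. f i z w)
    = (\<Prod>i\<in>I. \<Sum>z\<in>Pi\<^sub>E (B i) F. \<Sum>w\<in>Pi\<^sub>E (B i) F. f i z w)"
proof -
  have "depends_on (B i) (\<lambda>z. \<Sum>w\<in>Pi\<^sub>E (B i) F. f i z w)" if "i \<in> I" for i
    unfolding depends_on_def
  proof (intro allI impI sum.cong refl)
    fix z z' w :: "'k \<Rightarrow> 'b" assume "\<forall>p\<in>B i. z p = z' p"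
    then show "f i z w = f i z' w" using depends_onD[OF 1[OF that]] by blast
  qed
  then show ?thesis
    by (simp add: sum_PiE_UN[OF assms(1,2) 2] sum_PiE_UN[OF assms(1,2)])
qed

text \<open>AM-GM applied to \<open>p i / c i\<close> and to \<open>q i / c i\<close>.\<close>

lemma geometric_means_add_le:
  fixes p q c :: "'i \<Rightarrow> real"
  assumes "finite S" "S \<noteq> {}"
    and pq: "\<And>i. i \<in> S \<Longrightarrow> 0 \<le> p i" "\<And>i. i \<in> S \<Longrightarrow> 0 \<le> q i" "\<And>i. i \<in> S \<Longrightarrow> p i + q i \<le> c i"
    and c: "\<And>i. i \<in> S \<Longrightarrow> 0 < c i"
  shows "(\<Prod>i\<in>S. p i) powr (1 / card S) + (\<Prod>i\<in>S. q i) powr (1 / card S)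
    \<le> (\<Prod>i\<in>S. c i) powr (1 / card S)"
proof -
  let ?C = "(\<Prod>i\<in>S. c i) powr (1 / card S)"
  have scale: "(\<Prod>i\<in>S. r i) powr (1 / card S) = ?C * (\<Prod>i\<in>S. r i / c i) powr (1 / card S)" for r
  proof -
    have "(\<Prod>i\<in>S. r i) = (\<Prod>i\<in>S. c i) * (\<Prod>i\<in>S. r i / c i)"
      unfolding prod.distrib[symmetric] by (rule prod.cong) (use c in force)+
    then show ?thesis by (simp only: powr_mult)
  qed
  have card: "0 < real (card S)" using assms by (simp add: card_gt_0_iff)
  have "(\<Prod>i\<in>S. p i / c i) powr (1 / card S) + (\<Prod>i\<in>S. q i / c i) powr (1 / card S)
      \<le> (\<Sum>i\<in>S. p i / c i / card S) + (\<Sum>i\<in>S. q i / c i / card S)"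
    by (intro add_mono arith_geom_mean assms divide_nonneg_pos c)
  also have "\<dots> = (\<Sum>i\<in>S. (p i + q i) / c i / card S)"
    by (simp add: sum.distrib add_divide_distrib)
  also have "\<dots> \<le> (\<Sum>i\<in>S. 1 / card S)"
    by (intro sum_mono divide_right_mono) (use pq(3) c in \<open>auto simp: divide_le_eq\<close>)
  also have "\<dots> = 1" using card by simp
  finally have "?C * ((\<Prod>i\<in>S. p i / c i) powr (1 / card S) + (\<Prod>i\<in>S. q i / c i) powr (1 / card S)) \<le> ?C * 1"
    by (rule mult_left_mono) simp
  then show ?thesis by (simp add: scale[of p] scale[of q] distrib_left)
qed

section \<open>Kernels of observables\<close>

lemma psd_finiteI:
  assumes "finite X" "\<And>v. 0 \<le> (\<Sum>x\<in>X. \<Sum>y\<in>X. cnj (v x) * K x y * v y)"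
  shows "psd X K"
proof (rule psdI)
  fix F and v :: "'a \<Rightarrow> complex"
  assume F: "finite F" "F \<subseteq> X"
  let ?u = "\<lambda>x. if x \<in> F then v x else 0"
  have "(\<Sum>x\<in>X. \<Sum>y\<in>X. cnj (?u x) * K x y * ?u y) = (\<Sum>x\<in>F. \<Sum>y\<in>X. cnj (?u x) * K x y * ?u y)"
    by (rule sum.mono_neutral_right) (use assms(1) F in auto)
  also have "\<dots> = (\<Sum>x\<in>F. \<Sum>y\<in>F. cnj (?u x) * K x y * ?u y)"
    by (intro sum.cong refl sum.mono_neutral_right) (use assms(1) F in auto)
  also have "\<dots> = (\<Sum>x\<in>F. \<Sum>y\<in>F. cnj (v x) * K x y * v y)"
    by (intro sum.cong refl) auto
  finally show "0 \<le> (\<Sum>x\<in>F. \<Sum>y\<in>F. cnj (v x) * K x y * v y)"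
    using assms(2)[of ?u] by (rule subst)
qed

text \<open>The kernel of the 2 by 2 operator matrix with rows \<open>(D, C)\<close> and \<open>(C, E)\<close>.\<close>

definition block :: "('x \<Rightarrow> 'x \<Rightarrow> complex) \<Rightarrow> ('x \<Rightarrow> 'x \<Rightarrow> complex) \<Rightarrow> ('x \<Rightarrow> 'x \<Rightarrow> complex) \<Rightarrow>
    'x \<times> bool \<Rightarrow> 'x \<times> bool \<Rightarrow> complex" where
  "block D C E p q = (if snd p then (if snd q then D else C) else (if snd q then C else E)) (fst p) (fst q)"

text \<open>The sum runs over \<open>Y\<close> only: for a kernel on a larger set this is the square
  of its compression to \<open>Y\<close>, not the compression of its square.\<close>

definition ksq :: "'x set \<Rightarrow> ('x \<Rightarrow> 'x \<Rightarrow> complex) \<Rightarrow> 'x \<Rightarrow> 'x \<Rightarrow> complex" where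
  "ksq Y A x y = (\<Sum>w\<in>Y. A x w * A w y)"

definition observable :: "'x set \<Rightarrow> ('x \<Rightarrow> 'x \<Rightarrow> complex) \<Rightarrow> bool" where
  "observable Y A \<longleftrightarrow> psd Y (\<lambda>x y. kdelta x y + A x y) \<and> psd Y (\<lambda>x y. kdelta x y - A x y)"

lemma observable_hermitian:
  assumes "observable Y A" "x \<in> Y" "y \<in> Y" shows "A y x = cnj (A x y)"
  using psd_hermitian[of Y "\<lambda>x y. kdelta x y + A x y" x y] assms
  by (cases "x = y") (auto simp: observable_def kdelta_def)

text \<open>For hermitian A, the product of the block column (A, 1) with its adjoint has the blocks
  A^2, A, A and 1, so the block kernel is a Gram kernel.\<close>

lemma psd_block_square:
  assumes "finite Y" and herm: "\<And>x y. x \<in> Y \<Longrightarrow> y \<in> Y \<Longrightarrow> A y x = cnj (A x y)"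
  shows "psd (Y \<times> UNIV) (block (ksq Y A) A kdelta)"
proof -
  define f where "f w p = (if snd p then A (fst p) w else kdelta (fst p) w)" for w and p :: "'a \<times> bool"
  have "psd (Y \<times> UNIV) (\<lambda>p q. \<Sum>w\<in>Y. f w p * cnj (f w q))"
    by (intro psd_sum psd_rank_one)
  then show ?thesis
  proof (rule psd_cong)
    fix p q :: "'a \<times> bool" assume pq: "p \<in> Y \<times> UNIV" "q \<in> Y \<times> UNIV"
    obtain x b y c where [simp]: "p = (x, b)" "q = (y, c)" by (metis surj_pair)
    have Y: "x \<in> Y" "y \<in> Y" using pq by auto
    have k: "kdelta u w * g w = (if w = u then g u else 0)" for u w and g :: "'a \<Rightarrow> complex"
      by (auto simp: kdelta_def)
    have kc: "cnj (kdelta u w) = kdelta u w" for u w :: 'a by (simp add: kdelta_def)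
    have 1: "(\<Sum>w\<in>Y. A x w * cnj (A y w)) = ksq Y A x y"
      unfolding ksq_def using herm[OF Y(2)] by (intro sum.cong refl) simp
    have 2: "(\<Sum>w\<in>Y. A x w * cnj (kdelta y w)) = A x y"
      unfolding kc using assms(1) Y by (simp add: mult.commute[of "A x _"] k)
    have 3: "(\<Sum>w\<in>Y. kdelta x w * cnj (A y w)) = A x y"
      using assms(1) Y by (simp add: k[where g = "\<lambda>w. cnj (A y w)"] herm[OF Y(2,1)])
    have 4: "(\<Sum>w\<in>Y. kdelta x w * cnj (kdelta y w)) = kdelta x y"
      using assms(1) Y by (simp add: kc k) (simp add: kdelta_def)
    show "(\<Sum>w\<in>Y. f w p * cnj (f w q)) = block (ksq Y A) A kdelta p q"
      by (cases b; cases c; simp add: f_def block_def 1 2 3 4)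
  qed
qed

text \<open>The matrix with rows (1, A) and (A, 1) is half the sum of 1 + A tensored with the
  all-ones 2 by 2 matrix and 1 - A tensored with the rank-one matrix of the sign vector
  \<open>\<sigma>\<close>.\<close>

lemma psd_block_observable:
  assumes "observable Y A"
  shows "psd (Y \<times> UNIV) (block kdelta A kdelta)"
proof -
  define \<sigma> :: "bool \<Rightarrow> complex" where "\<sigma> b = (if b then 1 else - 1)" for b
  have p: "psd Y (\<lambda>x y. kdelta x y + A x y)" "psd Y (\<lambda>x y. kdelta x y - A x y)"
    using assms by (auto simp: observable_def)
  have 1: "psd (Y \<times> UNIV) (\<lambda>p q. kdelta (fst p) (fst q) + A (fst p) (fst q))"
    by (rule psd_pullback[OF p(1), of fst]) auto
  have 2: "psd (Y \<times> UNIV) (\<lambda>p q. (kdelta (fst p) (fst q) - A (fst p) (fst q)) * (\<sigma> (snd p) * cnj (\<sigma> (snd q))))"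
    by (intro psd_mult psd_rank_one, rule psd_pullback[OF p(2), of fst]) auto
  have "psd (Y \<times> UNIV) (\<lambda>p q. 1/2 * (kdelta (fst p) (fst q) + A (fst p) (fst q)
      + (kdelta (fst p) (fst q) - A (fst p) (fst q)) * (\<sigma> (snd p) * cnj (\<sigma> (snd q)))))"
    by (intro psd_scale psd_add 1 2) (simp add: less_eq_complex_def)
  then show ?thesis
    by (rule psd_cong) (auto simp: block_def \<sigma>_def field_simps)
qed

lemma psd_one_minus_square:
  assumes "finite Y" and A: "observable Y A"
  shows "psd Y (\<lambda>x y. kdelta x y - ksq Y A x y)"
proof (rule psd_finiteI[OF assms(1)])
  fix v :: "'a \<Rightarrow> complex"
  define a where "a x = (\<Sum>y\<in>Y. A x y * v y)" for x
  \<comment> \<open>The block matrix is tested at the vector with components -A v and v. Its form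
    there is |v|^2 - |A v|^2, which is the form of 1 - A^2.\<close>
  define u where "u p = (if snd p then - a (fst p) else v (fst p))" for p :: "'a \<times> bool"
  have herm: "A y x = cnj (A x y)" if "x \<in> Y" "y \<in> Y" for x y
    by (rule observable_hermitian[OF A that])
  have ca: "(\<Sum>x\<in>Y. cnj (v x) * A x w) = cnj (a w)" if "w \<in> Y" for w
    unfolding a_def cnj_sum using herm[OF that] by (intro sum.cong refl) simp
  have k: "(\<Sum>x\<in>Y. \<Sum>y\<in>Y. cnj (f x) * kdelta x y * g y) = (\<Sum>x\<in>Y. cnj (f x) * g x)" for f g :: "'a \<Rightarrow> complex"
  proof -
    have "(\<Sum>x\<in>Y. \<Sum>y\<in>Y. cnj (f x) * kdelta x y * g y)
        = (\<Sum>x\<in>Y. \<Sum>y\<in>Y. if x = y then cnj (f x) * g x else 0)"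
      by (intro sum.cong refl) (auto simp: kdelta_def)
    then show ?thesis using assms(1) by simp
  qed
  have s1: "(\<Sum>x\<in>Y. \<Sum>y\<in>Y. cnj (f x) * A x y * v y) = (\<Sum>x\<in>Y. cnj (f x) * a x)" for f
    by (simp add: a_def sum_distrib_left mult.assoc)
  have s2: "(\<Sum>x\<in>Y. \<Sum>y\<in>Y. cnj (v x) * A x y * g y) = (\<Sum>y\<in>Y. cnj (a y) * g y)" for g
    by (subst sum.swap) (simp add: ca sum_distrib_right[symmetric])
  have U: "(\<Sum>p\<in>Y \<times> (UNIV :: bool set). h p) = (\<Sum>x\<in>Y. h (x, True)) + (\<Sum>x\<in>Y. h (x, False))"
    for h :: "'a \<times> bool \<Rightarrow> complex"
    by (simp add: sum.cartesian_product' UNIV_bool sum.distrib add.commute)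
  have "0 \<le> (\<Sum>p\<in>Y \<times> UNIV. \<Sum>q\<in>Y \<times> UNIV. cnj (u p) * block kdelta A kdelta p q * u q)"
    by (rule psdD[OF psd_block_observable[OF A]]) (use assms(1) in auto)
  also have "\<dots> = (\<Sum>x\<in>Y. cnj (v x) * v x) - (\<Sum>x\<in>Y. cnj (a x) * a x)"
    unfolding U
    by (simp add: u_def block_def sum.distrib sum_subtractf k s1 s2 sum_negf)
  also have "(\<Sum>x\<in>Y. cnj (a x) * a x) = (\<Sum>x\<in>Y. \<Sum>y\<in>Y. cnj (v x) * ksq Y A x y * v y)"
  proof -
    have "(\<Sum>x\<in>Y. \<Sum>y\<in>Y. cnj (v x) * ksq Y A x y * v y)
        = (\<Sum>x\<in>Y. \<Sum>w\<in>Y. cnj (v x) * A x w * a w)"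
    proof (rule sum.cong[OF refl])
      fix x
      have "(\<Sum>y\<in>Y. cnj (v x) * ksq Y A x y * v y) = (\<Sum>y\<in>Y. \<Sum>w\<in>Y. cnj (v x) * A x w * (A w y * v y))"
        by (simp add: ksq_def sum_distrib_left sum_distrib_right mult.assoc)
      also have "\<dots> = (\<Sum>w\<in>Y. \<Sum>y\<in>Y. cnj (v x) * A x w * (A w y * v y))"
        by (rule sum.swap)
      finally show "(\<Sum>y\<in>Y. cnj (v x) * ksq Y A x y * v y) = (\<Sum>w\<in>Y. cnj (v x) * A x w * a w)"
        by (simp add: a_def sum_distrib_left)
    qed
    then show ?thesis by (simp add: s2)
  qed
  finally show "0 \<le> (\<Sum>x\<in>Y. \<Sum>y\<in>Y. cnj (v x) * (kdelta x y - ksq Y A x y) * v y)"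
    by (simp add: right_diff_distrib left_diff_distrib sum_subtractf k)
qed

definition half_sum :: "('x \<Rightarrow> 'x \<Rightarrow> complex) \<Rightarrow> ('x \<Rightarrow> 'x \<Rightarrow> complex) \<Rightarrow> 'x \<Rightarrow> 'x \<Rightarrow> complex" where
  "half_sum A B x y = (A x y + B x y) / 2"

definition half_diff :: "('x \<Rightarrow> 'x \<Rightarrow> complex) \<Rightarrow> ('x \<Rightarrow> 'x \<Rightarrow> complex) \<Rightarrow> 'x \<Rightarrow> 'x \<Rightarrow> complex" where
  "half_diff A B x y = (A x y - B x y) / 2"

text \<open>The cross terms A B + B A of the two squares cancel, also for non-commuting A and B;
  what remains is the mean of two instances of \<open>psd_one_minus_square\<close>.\<close>

lemma psd_one_minus_half_squares:
  assumes "finite Y" "observable Y A" "observable Y B"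
  shows "psd Y (\<lambda>x y. kdelta x y - (ksq Y (half_sum A B) x y + ksq Y (half_diff A B) x y))"
proof -
  have eq: "ksq Y (half_sum A B) x y + ksq Y (half_diff A B) x y = 1/2 * ksq Y A x y + 1/2 * ksq Y B x y" for x y
    unfolding ksq_def sum_distrib_left sum.distrib[symmetric]
    by (intro sum.cong refl) (simp add: half_sum_def half_diff_def field_simps)
  have "psd Y (\<lambda>x y. 1/2 * (kdelta x y - ksq Y A x y) + 1/2 * (kdelta x y - ksq Y B x y))"
    by (intro psd_add psd_scale psd_one_minus_square assms) (simp_all add: less_eq_complex_def)
  then show ?thesis
    unfolding eq by (rule psd_cong) (simp add: field_simps)
qed

lemma half_hermitian:
  assumes "observable Y A" "observable Y B" "x \<in> Y" "y \<in> Y"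
  shows "half_sum A B y x = cnj (half_sum A B x y)" "half_diff A B y x = cnj (half_diff A B x y)"
  by (simp_all add: half_sum_def half_diff_def
      observable_hermitian[OF assms(1,3,4)] observable_hermitian[OF assms(2,3,4)])

lemma psd_block_half:
  assumes "finite Y" "observable Y A" "observable Y B"
  shows "psd (Y \<times> UNIV) (block (ksq Y (half_sum A B)) (half_sum A B) kdelta)"
    "psd (Y \<times> UNIV) (block (ksq Y (half_diff A B)) (half_diff A B) kdelta)"
  by (rule psd_block_square[OF assms(1)], erule (1) half_hermitian[OF assms(2,3)])+

lemma psd_ksq:
  assumes "finite Y" and herm: "\<And>x y. x \<in> Y \<Longrightarrow> y \<in> Y \<Longrightarrow> A y x = cnj (A x y)"
  shows "psd Y (ksq Y A)"
  using psd_pullback[OF psd_block_square[OF assms], where \<pi> = "\<lambda>x. (x, True)" and X = Y]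
  by (simp add: block_def image_subset_iff)

lemma psd_ksq_half:
  assumes "finite Y" "observable Y A" "observable Y B"
  shows "psd Y (ksq Y (half_sum A B))" "psd Y (ksq Y (half_diff A B))"
  by (rule psd_ksq[OF assms(1)], erule (1) half_hermitian[OF assms(2,3)])+

section \<open>Finite networks\<close>

lemma nonneg_complex_Re: "0 \<le> z \<Longrightarrow> z = complex_of_real (Re z)"
  by (simp add: less_eq_complex_def complex_eq_iff)

lemma sqrt_prod: "sqrt (\<Prod>i\<in>I. f i) = (\<Prod>i\<in>I. sqrt (f i))"
  by (induction I rule: infinite_finite_induct) (auto simp: real_sqrt_mult)

lemma prod_of_bool: "finite A \<Longrightarrow> (\<Prod>i\<in>A. of_bool (P i)) = (of_bool (\<forall>i\<in>A. P i) :: complex)"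
  by (induction A rule: finite_induct) auto

text \<open>A truncated network: \<open>S\<close> are its quantum sources, \<open>F (s, i)\<close> is a finite part of the basis of the
  system that \<open>s\<close> sends to \<open>i\<close>, and \<open>\<rho> s\<close> is the subnormalised state of \<open>s\<close>. Below, \<open>qs i\<close> are the quantum
  sources of party \<open>i\<close>, \<open>Y i\<close> is the basis of its space, and \<open>Z Q\<close> that of all systems sent by the
  sources in \<open>Q\<close>.\<close>

locale finite_network =
  fixes n :: nat and S :: "nat set" and R :: "nat \<Rightarrow> nat set"
    and F :: "nat \<times> nat \<Rightarrow> 'b set" and \<rho> :: "nat \<Rightarrow> (nat \<Rightarrow> 'b) \<Rightarrow> (nat \<Rightarrow> 'b) \<Rightarrow> complex"
  assumes finite_S: "finite S"
    and R_subset: "\<And>s. s \<in> S \<Longrightarrow> R s \<subseteq> {1..n}"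
    and finite_F: "\<And>s i. s \<in> S \<Longrightarrow> i \<in> R s \<Longrightarrow> finite (F (s, i))"
    and rho_psd: "\<And>s. s \<in> S \<Longrightarrow> psd (\<Pi>\<^sub>E i\<in>R s. F (s, i)) (\<rho> s)"
    and rho_trace: "\<And>s. s \<in> S \<Longrightarrow> (\<Sum>w\<in>(\<Pi>\<^sub>E i\<in>R s. F (s, i)). Re (\<rho> s w w)) \<le> 1"
begin

definition src :: "nat \<Rightarrow> (nat \<times> nat \<Rightarrow> 'b) \<Rightarrow> nat \<Rightarrow> 'b" where
  "src s z = (\<lambda>i\<in>R s. z (s, i))"

definition qs :: "nat \<Rightarrow> nat set" where
  "qs i = {s \<in> S. i \<in> R s}"

definition par :: "nat \<Rightarrow> (nat \<times> nat \<Rightarrow> 'b) \<Rightarrow> nat \<Rightarrow> 'b" where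
  "par i z = (\<lambda>s\<in>qs i. z (s, i))"

definition Y :: "nat \<Rightarrow> (nat \<Rightarrow> 'b) set" where
  "Y i = (\<Pi>\<^sub>E s\<in>qs i. F (s, i))"

definition Z :: "nat set \<Rightarrow> (nat \<times> nat \<Rightarrow> 'b) set" where
  "Z Q = Pi\<^sub>E (Sigma Q R) F"

definition G :: "nat set \<Rightarrow> (nat \<times> nat \<Rightarrow> 'b) \<Rightarrow> (nat \<times> nat \<Rightarrow> 'b) \<Rightarrow> complex" where
  "G Q z w = (\<Prod>s\<in>Q. \<rho> s (src s z) (src s w))"

text \<open>Identity on the systems that the source \<open>s\<close> sends to parties outside \<open>\<Gamma>\<close>.\<close>

definition eps :: "nat set \<Rightarrow> nat \<Rightarrow> (nat \<times> nat \<Rightarrow> 'b) \<Rightarrow> (nat \<times> nat \<Rightarrow> 'b) \<Rightarrow> complex" where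
  "eps \<Gamma> s z w = kdelta (\<lambda>j\<in>R s - \<Gamma>. z (s, j)) (\<lambda>j\<in>R s - \<Gamma>. w (s, j))"

text \<open>The expectation of \<open>K\<close>, acting on the parties in \<open>\<Gamma>\<close> only, in the state of the sources \<open>Q\<close>.\<close>

definition tau :: "nat set \<Rightarrow> nat set \<Rightarrow> ((nat \<times> nat \<Rightarrow> 'b) \<Rightarrow> (nat \<times> nat \<Rightarrow> 'b) \<Rightarrow> complex) \<Rightarrow> complex" where
  "tau \<Gamma> Q K = (\<Sum>z\<in>Z Q. \<Sum>w\<in>Z Q. (\<Prod>s\<in>Q. \<rho> s (src s z) (src s w) * eps \<Gamma> s z w) * K z w)"

lemma finite_R: "s \<in> S \<Longrightarrow> finite (R s)"
  using R_subset finite_subset by blast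

lemma finite_subset_S: "Q \<subseteq> S \<Longrightarrow> finite Q"
  using finite_S finite_subset by blast

lemma finite_Z: "Q \<subseteq> S \<Longrightarrow> finite (Z Q)"
  unfolding Z_def using finite_F finite_R finite_subset_S by (intro finite_PiE finite_SigmaI) auto

lemma finite_Y: "finite (Y i)"
  unfolding Y_def by (intro finite_PiE) (auto simp: qs_def finite_S finite_F)

lemma qs_subset: "qs i \<subseteq> S"
  by (auto simp: qs_def)

lemma src_Z: "z \<in> Z Q \<Longrightarrow> s \<in> Q \<Longrightarrow> src s z \<in> (\<Pi>\<^sub>E i\<in>R s. F (s, i))"
  by (auto simp: src_def Z_def PiE_iff)

lemma par_Z: "z \<in> Z Q \<Longrightarrow> qs i \<subseteq> Q \<Longrightarrow> par i z \<in> Y i"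
  by (auto simp: par_def Y_def Z_def PiE_iff qs_def subset_iff)

lemma psd_src: "Q \<subseteq> S \<Longrightarrow> s \<in> Q \<Longrightarrow> psd (Z Q) (\<lambda>z w. \<rho> s (src s z) (src s w))"
  by (rule psd_pullback[OF rho_psd]) (auto dest: src_Z)

lemma psd_G: "Q \<subseteq> S \<Longrightarrow> psd (Z Q) (G Q)"
  unfolding G_def by (intro psd_prod psd_src)

lemma psd_eps: "psd X (eps \<Gamma> s)"
  unfolding eps_def by (rule psd_pullback[OF psd_kdelta, of _ _ UNIV]) auto

lemma tau_nonneg:
  assumes "Q \<subseteq> S" "psd (Z Q) K" shows "0 \<le> tau \<Gamma> Q K"
  unfolding tau_def
  by (rule psd_sum_nonneg[OF _ finite_Z[OF assms(1)] order_refl])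
    (intro psd_mult psd_prod psd_src psd_eps assms)

text \<open>The trace of a product state is the product of the traces of the sources, since the
  factor of s reads only the coordinates (s, i). Each of these traces lies between 0 and 1.\<close>

lemma trace_G:
  assumes Q: "Q \<subseteq> S"
  shows "0 \<le> (\<Sum>z\<in>Z Q. G Q z z)" and "Re (\<Sum>z\<in>Z Q. G Q z z) \<le> 1"
proof -
  show "0 \<le> (\<Sum>z\<in>Z Q. G Q z z)"
    by (intro sum_nonneg psd_diag[OF psd_G[OF Q]])
  define t where "t s = (\<Sum>w\<in>(\<Pi>\<^sub>E i\<in>R s. F (s, i)). Re (\<rho> s w w))" for s
  have U: "Sigma Q R = (\<Union>s\<in>Q. {s} \<times> R s)" by auto
  have "(\<Sum>z\<in>Z Q. G Q z z) = (\<Prod>s\<in>Q. \<Sum>z\<in>Pi\<^sub>E ({s} \<times> R s) F. \<rho> s (src s z) (src s z))"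
    unfolding Z_def U G_def
  proof (rule sum_PiE_UN[OF finite_subset_S[OF Q]])
    show "disjoint_family_on (\<lambda>s. {s} \<times> R s) Q" by (auto simp: disjoint_family_on_def)
    show "depends_on ({s} \<times> R s) (\<lambda>z. \<rho> s (src s z) (src s z))" for s
      unfolding depends_on_def
    proof (intro allI impI)
      fix z w :: "nat \<times> nat \<Rightarrow> 'b" assume "\<forall>p\<in>{s} \<times> R s. z p = w p"
      then have "src s z = src s w" by (auto simp: src_def fun_eq_iff)
      then show "\<rho> s (src s z) (src s z) = \<rho> s (src s w) (src s w)" by simp
    qed
  qed
  also have "\<dots> = (\<Prod>s\<in>Q. complex_of_real (t s))"
  proof (rule prod.cong[OF refl])
    fix s assume s: "s \<in> Q"
    have bij: "bij_betw (src s) (Pi\<^sub>E ({s} \<times> R s) F) (\<Pi>\<^sub>E i\<in>R s. F (s, i))"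
    proof (rule bij_betw_byWitness[where f' = "\<lambda>w. \<lambda>p\<in>{s} \<times> R s. w (snd p)"])
      show "\<forall>z\<in>Pi\<^sub>E ({s} \<times> R s) F. (\<lambda>p\<in>{s} \<times> R s. src s z (snd p)) = z"
      proof (intro ballI ext)
        fix z p assume "z \<in> Pi\<^sub>E ({s} \<times> R s) F"
        then show "(\<lambda>p\<in>{s} \<times> R s. src s z (snd p)) p = z p"
        proof (cases "p \<in> {s} \<times> R s")
          case True
          then obtain i where "p = (s, i)" "i \<in> R s" by blast
          then show ?thesis by (simp add: src_def)
        next
          case False
          show ?thesis using PiE_arb[OF \<open>z \<in> _\<close> False] False by (simp only: restrict_def if_False)
        qed
      qed
      show "\<forall>w\<in>\<Pi>\<^sub>E i\<in>R s. F (s, i). src s (\<lambda>p\<in>{s} \<times> R s. w (snd p)) = w"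
      proof (intro ballI ext)
        fix w p assume "w \<in> (\<Pi>\<^sub>E i\<in>R s. F (s, i))"
        then show "src s (\<lambda>p\<in>{s} \<times> R s. w (snd p)) p = w p"
          using PiE_arb[of w "R s" _ p] by (cases "p \<in> R s") (simp_all add: src_def)
      qed
      show "src s ` Pi\<^sub>E ({s} \<times> R s) F \<subseteq> (\<Pi>\<^sub>E i\<in>R s. F (s, i))"
        unfolding src_def
      proof (intro image_subsetI restrict_PiE_iff[THEN iffD2] ballI)
        fix z i assume z: "z \<in> Pi\<^sub>E ({s} \<times> R s) F" and "i \<in> R s"
        then show "z (s, i) \<in> F (s, i)" by (intro PiE_mem[OF z]) simp
      qed
      show "(\<lambda>w. \<lambda>p\<in>{s} \<times> R s. w (snd p)) ` (\<Pi>\<^sub>E i\<in>R s. F (s, i)) \<subseteq> Pi\<^sub>E ({s} \<times> R s) F"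
      proof (intro image_subsetI restrict_PiE_iff[THEN iffD2] ballI)
        fix w p assume w: "w \<in> (\<Pi>\<^sub>E i\<in>R s. F (s, i))" and "p \<in> {s} \<times> R s"
        then obtain i where "p = (s, i)" "i \<in> R s" by blast
        with PiE_mem[OF w] show "w (snd p) \<in> F p" by simp
      qed
    qed
    have "(\<Sum>z\<in>Pi\<^sub>E ({s} \<times> R s) F. \<rho> s (src s z) (src s z)) = (\<Sum>w\<in>(\<Pi>\<^sub>E i\<in>R s. F (s, i)). \<rho> s w w)"
      by (rule sum.reindex_bij_betw[OF bij])
    also have "\<dots> = (\<Sum>w\<in>(\<Pi>\<^sub>E i\<in>R s. F (s, i)). complex_of_real (Re (\<rho> s w w)))"
      using s Q by (intro sum.cong refl nonneg_complex_Re psd_diag[OF rho_psd]) auto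
    finally show "(\<Sum>z\<in>Pi\<^sub>E ({s} \<times> R s) F. \<rho> s (src s z) (src s z)) = complex_of_real (t s)"
      by (simp add: t_def)
  qed
  also have "\<dots> = complex_of_real (\<Prod>s\<in>Q. t s)" by simp
  finally have eq: "Re (\<Sum>z\<in>Z Q. G Q z z) = (\<Prod>s\<in>Q. t s)" by (simp only: Re_complex_of_real)
  have "0 \<le> t s" if "s \<in> Q" for s
    unfolding t_def using psd_diag[OF rho_psd] that Q
    by (intro sum_nonneg) (auto simp: less_eq_complex_def)
  moreover have "t s \<le> 1" if "s \<in> Q" for s
    unfolding t_def using rho_trace that Q by auto
  ultimately show "Re (\<Sum>z\<in>Z Q. G Q z z) \<le> 1"
    unfolding eq by (intro prod_le_1) auto
qed

text \<open>For the identity on all systems the double sum collapses to its diagonal.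
  \<open>eps\<close> supplies the identity outside \<Gamma>, and \<open>K\<close> has to supply the
  rest.\<close>

lemma tau_kdelta:
  assumes "Q \<subseteq> S"
    and "\<And>z w. z \<in> Z Q \<Longrightarrow> w \<in> Z Q \<Longrightarrow> (\<Prod>s\<in>Q. eps \<Gamma> s z w) * K z w = kdelta z w"
  shows "tau \<Gamma> Q K = (\<Sum>z\<in>Z Q. G Q z z)"
proof -
  have "tau \<Gamma> Q K = (\<Sum>z\<in>Z Q. \<Sum>w\<in>Z Q. if z = w then G Q z z else 0)"
    unfolding tau_def prod.distrib
    by (intro sum.cong refl) (simp add: mult.assoc assms(2) G_def kdelta_def)
  then show ?thesis using finite_Z[OF assms(1)] by simp
qed

lemma prod_eps_par:
  assumes "finite Q" "\<Gamma> \<subseteq> {1..n}" "Q \<subseteq> S"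
  shows "(\<Prod>s\<in>Q. eps \<Gamma> s z w) = of_bool (\<forall>s\<in>Q. \<forall>j\<in>R s - \<Gamma>. z (s, j) = w (s, j))"
proof -
  have e: "eps \<Gamma> s z w = of_bool (\<forall>j\<in>R s - \<Gamma>. z (s, j) = w (s, j))" for s
    by (auto simp: eps_def kdelta_def fun_eq_iff restrict_def of_bool_def)
  show ?thesis unfolding e using assms(1) by (induction Q rule: finite_induct) auto
qed

lemma kdelta_par: "kdelta (par j w) (par j z) = of_bool (\<forall>s\<in>qs j. z (s, j) = w (s, j))"
  by (auto simp: par_def kdelta_def fun_eq_iff restrict_def of_bool_def) metis

lemma Z_eqI:
  assumes "z \<in> Z Q" "w \<in> Z Q" "\<And>s j. s \<in> Q \<Longrightarrow> j \<in> R s \<Longrightarrow> z (s, j) = w (s, j)"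
  shows "z = w"
  by (rule PiE_ext[OF assms(1,2)[unfolded Z_def]]) (use assms(3) in auto)

lemma prod_kdelta_par:
  assumes "z \<in> Z S" "w \<in> Z S"
  shows "(\<Prod>j\<in>{1..n}. kdelta (par j w) (par j z)) = kdelta w z"
proof -
  have "(\<forall>j\<in>{1..n}. \<forall>s\<in>qs j. z (s, j) = w (s, j)) \<longleftrightarrow> w = z"
  proof
    assume eq: "\<forall>j\<in>{1..n}. \<forall>s\<in>qs j. z (s, j) = w (s, j)"
    show "w = z"
    proof (rule Z_eqI[OF assms(2,1)])
      fix s j assume sj: "s \<in> S" "j \<in> R s"
      then have "j \<in> {1..n}" "s \<in> qs j" using R_subset[of s] by (auto simp: qs_def)
      with eq show "w (s, j) = z (s, j)" by simp
    qed
  qed simp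
  then show ?thesis
    by (simp add: kdelta_par prod_of_bool) (simp add: kdelta_def)
qed

text \<open>Both sides say that \<open>z\<close> and \<open>w\<close> agree on all systems of
  parties outside \<Gamma>. The identity is regrouped from parties to sources, along which the state
  factorises.\<close>

lemma prod_kdelta_par_outside:
  assumes "\<Gamma> \<subseteq> {1..n}"
  shows "(\<Prod>j\<in>{1..n} - \<Gamma>. kdelta (par j w) (par j z)) = (\<Prod>s\<in>S. eps \<Gamma> s z w)"
proof -
  have "(\<forall>j\<in>{1..n} - \<Gamma>. \<forall>s\<in>qs j. z (s, j) = w (s, j)) \<longleftrightarrow> (\<forall>s\<in>S. \<forall>j\<in>R s - \<Gamma>. z (s, j) = w (s, j))"
    using R_subset by (auto simp: qs_def)
  then show ?thesis
    by (simp add: kdelta_par prod_of_bool prod_eps_par[OF finite_S assms])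
qed

section \<open>Expectations for a set of independent parties\<close>

context
  fixes \<Gamma> :: "nat set"
  assumes Gamma: "\<Gamma> \<subseteq> {1..n}"
    and indep: "\<And>i j. i \<in> \<Gamma> \<Longrightarrow> j \<in> \<Gamma> \<Longrightarrow> i \<noteq> j \<Longrightarrow> qs i \<inter> qs j = {}"
begin

lemma R_inter_Gamma: "i \<in> \<Gamma> \<Longrightarrow> s \<in> qs i \<Longrightarrow> R s \<inter> \<Gamma> = {i}"
  using indep[of i] by (auto simp: qs_def)

lemma psd_party_pullback:
  "psd (Y i) K \<Longrightarrow> psd (Z (qs i)) (\<lambda>z w. K (par i w) (par i z))"
  by (rule psd_transpose, rule psd_pullback[of "Y i" K "par i"]) (auto simp: par_Z)

lemma tau_party_nonneg:
  "psd (Y i) K \<Longrightarrow> 0 \<le> tau \<Gamma> (qs i) (\<lambda>z w. K (par i w) (par i z))"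
  by (intro tau_nonneg psd_party_pullback qs_subset)

text \<open>Linearity and positivity of \<open>tau\<close> reduce the claim to the expectation of
  the identity, which is a trace and hence at most 1.\<close>

lemma tau_party_add_le:
  assumes i: "i \<in> \<Gamma>" and K: "psd (Y i) (\<lambda>x y. kdelta x y - (K x y + K' x y))"
  shows "Re (tau \<Gamma> (qs i) (\<lambda>z w. K (par i w) (par i z)))
    + Re (tau \<Gamma> (qs i) (\<lambda>z w. K' (par i w) (par i z))) \<le> 1"
proof -
  have "0 \<le> tau \<Gamma> (qs i) (\<lambda>z w. kdelta (par i w) (par i z) - (K (par i w) (par i z) + K' (par i w) (par i z)))"
    using tau_party_nonneg[OF K] .
  also have "\<dots> = tau \<Gamma> (qs i) (\<lambda>z w. kdelta (par i w) (par i z))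
      - (tau \<Gamma> (qs i) (\<lambda>z w. K (par i w) (par i z)) + tau \<Gamma> (qs i) (\<lambda>z w. K' (par i w) (par i z)))"
    by (simp add: tau_def right_diff_distrib distrib_left sum_subtractf sum.distrib)
  also have "tau \<Gamma> (qs i) (\<lambda>z w. kdelta (par i w) (par i z)) = (\<Sum>z\<in>Z (qs i). G (qs i) z z)"
  proof (rule tau_kdelta[OF qs_subset])
    fix z w assume zw: "z \<in> Z (qs i)" "w \<in> Z (qs i)"
    \<comment> \<open>A source of party i reaches no other party in \<Gamma>, so agreement at i and
      at the parties outside \<Gamma> is agreement everywhere.\<close>
    have "(\<forall>s\<in>qs i. \<forall>j\<in>R s - \<Gamma>. z (s, j) = w (s, j)) \<and> (\<forall>s\<in>qs i. z (s, i) = w (s, i)) \<longleftrightarrow> z = w"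
    proof
      assume eq: "(\<forall>s\<in>qs i. \<forall>j\<in>R s - \<Gamma>. z (s, j) = w (s, j)) \<and> (\<forall>s\<in>qs i. z (s, i) = w (s, i))"
      show "z = w"
      proof (rule Z_eqI[OF zw])
        fix s j assume "s \<in> qs i" "j \<in> R s"
        then show "z (s, j) = w (s, j)"
          using eq R_inter_Gamma[OF i, of s] by (cases "j \<in> \<Gamma>") auto
      qed
    qed auto
    then show "(\<Prod>s\<in>qs i. eps \<Gamma> s z w) * kdelta (par i w) (par i z) = kdelta z w"
      unfolding kdelta_par prod_eps_par[OF finite_subset_S[OF qs_subset] Gamma qs_subset]
      by (simp add: kdelta_def of_bool_conj[symmetric] del: of_bool_conj)
  qed
  finally show ?thesis
    using trace_G(2)[OF qs_subset, of i] by (simp add: less_eq_complex_def)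
qed

text \<open>Independence partitions the sources into the groups \<open>qs i\<close> for i in
  \<Gamma> and the remaining ones. State, identities and operators split along this partition, and
  so does the double sum.\<close>

lemma functional_factorizes:
  fixes D :: "nat \<Rightarrow> (nat \<Rightarrow> 'b) \<Rightarrow> (nat \<Rightarrow> 'b) \<Rightarrow> complex"
  shows "(\<Sum>z\<in>Z S. \<Sum>w\<in>Z S. G S z w *
       (\<Prod>i\<in>{1..n}. if i \<in> \<Gamma> then D i (par i w) (par i z) else kdelta (par i w) (par i z)))
    = tau \<Gamma> (S - (\<Union>i\<in>\<Gamma>. qs i)) (\<lambda>z w. 1) * (\<Prod>i\<in>\<Gamma>. tau \<Gamma> (qs i) (\<lambda>z w. D i (par i w) (par i z)))"
proof -
  have fin: "finite \<Gamma>" and zero: "0 \<notin> \<Gamma>" using Gamma finite_subset by auto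
  \<comment> \<open>Parties are numbered from 1, so index 0 is free for the sources received by no
    party in \<Gamma>. Their operator is the kernel 1, which leaves the identity to
    \<open>eps\<close>.\<close>
  define Q where "Q k = (if k = 0 then S - (\<Union>i\<in>\<Gamma>. qs i) else qs k)" for k
  define K where "K k z w = (if k = 0 then 1 else D k (par k w) (par k z))" for k z w
  define f where "f k z w = (\<Prod>s\<in>Q k. \<rho> s (src s z) (src s w) * eps \<Gamma> s z w) * K k z w" for k z w
  let ?I = "insert 0 \<Gamma>"
  have QS: "Q k \<subseteq> S" for k by (auto simp: Q_def qs_def)
  have disj: "Q k \<inter> Q l = {}" if "k \<in> ?I" "l \<in> ?I" "k \<noteq> l" for k l
    using that indep zero by (auto simp: Q_def)
  have UQ: "(\<Union>k\<in>?I. Q k) = S"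
  proof -
    have "(\<Union>k\<in>\<Gamma>. Q k) = (\<Union>k\<in>\<Gamma>. qs k)"
      using zero by (intro SUP_cong refl) (auto simp: Q_def)
    moreover have "(\<Union>k\<in>\<Gamma>. qs k) \<subseteq> S" by (auto simp: qs_def)
    ultimately show ?thesis by (auto simp: Q_def[of 0])
  qed
  have UZ: "Sigma S R = (\<Union>k\<in>?I. Sigma (Q k) R)"
    using UQ by blast
  have srcdep: "src s z = src s w" if "\<forall>p\<in>Sigma (Q k) R. z p = w p" "s \<in> Q k" for s k and z w :: "nat \<times> nat \<Rightarrow> 'b"
    using that by (auto simp: src_def fun_eq_iff)
  have epsdep: "(\<lambda>j\<in>R s - \<Gamma>. z (s, j)) = (\<lambda>j\<in>R s - \<Gamma>. w (s, j))"
    if "\<forall>p\<in>Sigma (Q k) R. z p = w p" "s \<in> Q k" for s k and z w :: "nat \<times> nat \<Rightarrow> 'b"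
    using that by (auto simp: fun_eq_iff)
  have pardep: "par k z = par k w" if "\<forall>p\<in>Sigma (Q k) R. z p = w p" "k \<noteq> 0" for k and z w :: "nat \<times> nat \<Rightarrow> 'b"
    using that by (auto simp: par_def fun_eq_iff Q_def qs_def)
  have Kdep: "K k z u = K k w u" "K k u z = K k u w"
    if "\<forall>p\<in>Sigma (Q k) R. z p = w p" for k u and z w :: "nat \<times> nat \<Rightarrow> 'b"
    using pardep[OF that] by (auto simp: K_def)
  have int: "G S z w * (\<Prod>i\<in>{1..n}. if i \<in> \<Gamma> then D i (par i w) (par i z) else kdelta (par i w) (par i z))
      = (\<Prod>k\<in>?I. f k z w)" for z w
  proof -
    have "(\<Prod>i\<in>{1..n}. if i \<in> \<Gamma> then D i (par i w) (par i z) else kdelta (par i w) (par i z))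
      = (\<Prod>i\<in>{1..n} - \<Gamma>. kdelta (par i w) (par i z)) * (\<Prod>i\<in>\<Gamma>. D i (par i w) (par i z))"
      by (subst prod.subset_diff[OF Gamma]) auto
    also have "\<dots> = (\<Prod>s\<in>S. eps \<Gamma> s z w) * (\<Prod>k\<in>?I. K k z w)"
    proof -
      have "(\<Prod>k\<in>\<Gamma>. K k z w) = (\<Prod>i\<in>\<Gamma>. D i (par i w) (par i z))"
        by (rule prod.cong[OF refl]) (use zero in \<open>auto simp: K_def\<close>)
      moreover have "K 0 z w = 1" by (simp add: K_def)
      ultimately show ?thesis
        unfolding prod_kdelta_par_outside[OF Gamma] by (simp only: prod.insert[OF fin zero] mult_1)
    qed
    finally have "G S z w * (\<Prod>i\<in>{1..n}. if i \<in> \<Gamma> then D i (par i w) (par i z) else kdelta (par i w) (par i z))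
      = (\<Prod>s\<in>S. \<rho> s (src s z) (src s w) * eps \<Gamma> s z w) * (\<Prod>k\<in>?I. K k z w)"
      by (simp add: G_def prod.distrib)
    also have "(\<Prod>s\<in>S. \<rho> s (src s z) (src s w) * eps \<Gamma> s z w)
       = (\<Prod>s\<in>(\<Union>k\<in>?I. Q k). \<rho> s (src s z) (src s w) * eps \<Gamma> s z w)"
      unfolding UQ ..
    also have "\<dots> = (\<Prod>k\<in>?I. \<Prod>s\<in>Q k. \<rho> s (src s z) (src s w) * eps \<Gamma> s z w)"
      by (rule prod.UNION_disjoint) (use fin disj finite_subset_S[OF QS] in auto)
    finally show ?thesis by (simp only: f_def prod.distrib)
  qed
  have "(\<Sum>z\<in>Z S. \<Sum>w\<in>Z S. \<Prod>k\<in>?I. f k z w)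
     = (\<Prod>k\<in>?I. \<Sum>z\<in>Z (Q k). \<Sum>w\<in>Z (Q k). f k z w)"
    unfolding Z_def UZ
  proof (rule sum_sum_PiE_UN)
    show "finite ?I" using fin by simp
    show "disjoint_family_on (\<lambda>k. Sigma (Q k) R) ?I"
      unfolding disjoint_family_on_def
    proof (intro ballI impI)
      fix k l assume "k \<in> ?I" "l \<in> ?I" "k \<noteq> l"
      from disj[OF this] show "Sigma (Q k) R \<inter> Sigma (Q l) R = {}" by auto
    qed
    show "depends_on (Sigma (Q k) R) (\<lambda>z. f k z w)" for k w
      unfolding depends_on_def
    proof (intro allI impI)
      fix u v :: "nat \<times> nat \<Rightarrow> 'b" assume uv: "\<forall>p\<in>Sigma (Q k) R. u p = v p"
      have "(\<Prod>s\<in>Q k. \<rho> s (src s u) (src s w) * eps \<Gamma> s u w)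
          = (\<Prod>s\<in>Q k. \<rho> s (src s v) (src s w) * eps \<Gamma> s v w)"
        by (rule prod.cong[OF refl]) (simp only: eps_def srcdep[OF uv] epsdep[OF uv])
      then show "f k u w = f k v w"
        by (simp only: f_def Kdep(1)[OF uv])
    qed
    show "depends_on (Sigma (Q k) R) (f k z)" for k z
      unfolding depends_on_def
    proof (intro allI impI)
      fix u v :: "nat \<times> nat \<Rightarrow> 'b" assume uv: "\<forall>p\<in>Sigma (Q k) R. u p = v p"
      have "(\<Prod>s\<in>Q k. \<rho> s (src s z) (src s u) * eps \<Gamma> s z u)
          = (\<Prod>s\<in>Q k. \<rho> s (src s z) (src s v) * eps \<Gamma> s z v)"
        by (rule prod.cong[OF refl]) (simp only: eps_def srcdep[OF uv] epsdep[OF uv])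
      then show "f k z u = f k z v"
        by (simp only: f_def Kdep(2)[OF uv])
    qed
  qed
  also have "\<dots> = (\<Prod>k\<in>?I. tau \<Gamma> (Q k) (K k))"
    by (simp only: tau_def f_def)
  also have "\<dots> = tau \<Gamma> (Q 0) (K 0) * (\<Prod>k\<in>\<Gamma>. tau \<Gamma> (Q k) (K k))"
    by (rule prod.insert[OF fin zero])
  also have "(\<Prod>k\<in>\<Gamma>. tau \<Gamma> (Q k) (K k)) = (\<Prod>i\<in>\<Gamma>. tau \<Gamma> (qs i) (\<lambda>z w. D i (par i w) (par i z)))"
  proof (rule prod.cong[OF refl])
    fix k assume "k \<in> \<Gamma>"
    then have "k \<noteq> 0" using zero by (cases "k = 0") simp_all
    then show "tau \<Gamma> (Q k) (K k) = tau \<Gamma> (qs k) (\<lambda>z w. D k (par k w) (par k z))"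
      by (simp add: Q_def K_def[abs_def])
  qed
  finally show ?thesis
    unfolding int by (simp add: Q_def K_def[abs_def])
qed

text \<open>The remaining sources reach only parties outside \<Gamma>, where \<open>eps\<close> is
  already the full identity, so this expectation is a trace.\<close>

lemma tau_rest_bounds:
  "0 \<le> tau \<Gamma> (S - (\<Union>i\<in>\<Gamma>. qs i)) (\<lambda>z w. 1)"
  "Re (tau \<Gamma> (S - (\<Union>i\<in>\<Gamma>. qs i)) (\<lambda>z w. 1)) \<le> 1"
proof -
  let ?Q = "S - (\<Union>i\<in>\<Gamma>. qs i)"
  have "tau \<Gamma> ?Q (\<lambda>z w. 1) = (\<Sum>z\<in>Z ?Q. G ?Q z z)"
  proof (rule tau_kdelta)
    fix z w assume zw: "z \<in> Z ?Q" "w \<in> Z ?Q"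
    have "R s - \<Gamma> = R s" if "s \<in> ?Q" for s using that by (auto simp: qs_def)
    then have "(\<forall>s\<in>?Q. \<forall>j\<in>R s - \<Gamma>. z (s, j) = w (s, j)) \<longleftrightarrow> z = w"
      using Z_eqI[OF zw] by metis
    moreover have "(\<Prod>s\<in>?Q. eps \<Gamma> s z w) = of_bool (\<forall>s\<in>?Q. \<forall>j\<in>R s - \<Gamma>. z (s, j) = w (s, j))"
      by (rule prod_eps_par) (use Gamma finite_S in auto)
    ultimately show "(\<Prod>s\<in>?Q. eps \<Gamma> s z w) * 1 = kdelta z w"
      by (simp only: kdelta_def mult_1_right)
  qed auto
  with trace_G[of ?Q] show "0 \<le> tau \<Gamma> ?Q (\<lambda>z w. 1)" "Re (tau \<Gamma> ?Q (\<lambda>z w. 1)) \<le> 1"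
    by auto
qed

text \<open>Cauchy-Schwarz for the state, applied to the product of the \<open>C i\<close> over \<open>\<Gamma>\<close> and the product
  over the other parties; the former gives a product state expectation because \<open>\<Gamma>\<close> is independent.\<close>

lemma correlator_bound:
  fixes C D :: "nat \<Rightarrow> (nat \<Rightarrow> 'b) \<Rightarrow> (nat \<Rightarrow> 'b) \<Rightarrow> complex"
  assumes in_Gamma: "\<And>i. i \<in> \<Gamma> \<Longrightarrow> psd (Y i \<times> UNIV) (block (D i) (C i) kdelta)"
    and off_Gamma: "\<And>i. i \<in> {1..n} - \<Gamma> \<Longrightarrow> psd (Y i \<times> UNIV) (block kdelta (C i) kdelta)"
  shows "cmod (\<Sum>z\<in>Z S. \<Sum>w\<in>Z S. G S z w * (\<Prod>i\<in>{1..n}. C i (par i w) (par i z)))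
    \<le> (\<Prod>i\<in>\<Gamma>. sqrt (Re (tau \<Gamma> (qs i) (\<lambda>z w. D i (par i w) (par i z)))))"
proof -
  define D' where "D' i = (if i \<in> \<Gamma> then D i else kdelta)" for i
  \<comment> \<open>One Boolean tag is shared by all parties. H is positive as a Schur product; its
    True-False block is the correlator, its True-True block the expectation of the operators
    \<open>D i\<close>, and its False-False block the trace of the state.\<close>
  define H where "H p q = G S (fst p) (fst q) *
      (\<Prod>i\<in>{1..n}. block (D' i) (C i) kdelta (par i (fst q), snd q) (par i (fst p), snd p))"
    for p q :: "(nat \<times> nat \<Rightarrow> 'b) \<times> bool"
  have H: "psd (Z S \<times> UNIV) H"
    unfolding H_def
  proof (intro psd_mult psd_prod)
    show "psd (Z S \<times> UNIV) (\<lambda>p q. G S (fst p) (fst q))"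
      by (rule psd_pullback[OF psd_G[OF order_refl]]) auto
    fix i assume i: "i \<in> {1..n}"
    have b: "psd (Y i \<times> UNIV) (block (D' i) (C i) kdelta)"
      using in_Gamma[of i] off_Gamma[of i] i by (auto simp: D'_def)
    have "psd (Z S \<times> UNIV) (\<lambda>p q. block (D' i) (C i) kdelta (par i (fst p), snd p) (par i (fst q), snd q))"
      by (rule psd_pullback[OF b, of "\<lambda>p. (par i (fst p), snd p)"]) (auto simp: par_Z qs_subset)
    then show "psd (Z S \<times> UNIV) (\<lambda>p q. block (D' i) (C i) kdelta (par i (fst q), snd q) (par i (fst p), snd p))"
      by (rule psd_transpose)
  qed
  have s: "(\<Sum>p\<in>Z S \<times> {b}. h p) = (\<Sum>z\<in>Z S. h (z, b))" for b :: bool and h :: "_ \<Rightarrow> complex"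
  proof -
    have "Z S \<times> {b} = (\<lambda>z. (z, b)) ` Z S" by auto
    then show ?thesis by (simp add: sum.reindex inj_on_def)
  qed
  have CS: "cmod (\<Sum>p\<in>Z S \<times> {True}. \<Sum>q\<in>Z S \<times> {False}. H p q)
     \<le> sqrt (Re (\<Sum>p\<in>Z S \<times> {True}. \<Sum>q\<in>Z S \<times> {True}. H p q)) *
       sqrt (Re (\<Sum>p\<in>Z S \<times> {False}. \<Sum>q\<in>Z S \<times> {False}. H p q))"
    by (rule psd_cauchy_schwarz[OF H]) (auto simp: finite_Z)
  have TF: "(\<Sum>p\<in>Z S \<times> {True}. \<Sum>q\<in>Z S \<times> {False}. H p q)
     = (\<Sum>z\<in>Z S. \<Sum>w\<in>Z S. G S z w * (\<Prod>i\<in>{1..n}. C i (par i w) (par i z)))"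
    unfolding s by (simp add: H_def block_def)
  have "(\<Sum>p\<in>Z S \<times> {True}. \<Sum>q\<in>Z S \<times> {True}. H p q)
     = (\<Sum>z\<in>Z S. \<Sum>w\<in>Z S. G S z w *
       (\<Prod>i\<in>{1..n}. if i \<in> \<Gamma> then D i (par i w) (par i z) else kdelta (par i w) (par i z)))"
    unfolding s by (intro sum.cong refl arg_cong2[where f = "(*)"] prod.cong) (auto simp: H_def block_def D'_def intro!: prod.cong)
  also note functional_factorizes
  finally have TT: "(\<Sum>p\<in>Z S \<times> {True}. \<Sum>q\<in>Z S \<times> {True}. H p q)
     = tau \<Gamma> (S - (\<Union>i\<in>\<Gamma>. qs i)) (\<lambda>z w. 1) * (\<Prod>i\<in>\<Gamma>. tau \<Gamma> (qs i) (\<lambda>z w. D i (par i w) (par i z)))" .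
  have "(\<Sum>p\<in>Z S \<times> {False}. \<Sum>q\<in>Z S \<times> {False}. H p q)
     = (\<Sum>z\<in>Z S. \<Sum>w\<in>Z S. if z = w then G S z z else 0)"
    unfolding s
  proof (intro sum.cong refl)
    fix z w assume zw: "z \<in> Z S" "w \<in> Z S"
    have "H (z, False) (w, False) = G S z w * (\<Prod>j\<in>{1..n}. kdelta (par j w) (par j z))"
      by (simp add: H_def block_def)
    also have "\<dots> = (if z = w then G S z z else 0)"
      unfolding prod_kdelta_par[OF zw] by (simp add: kdelta_def)
    finally show "H (z, False) (w, False) = (if z = w then G S z z else 0)" .
  qed
  then have FF: "(\<Sum>p\<in>Z S \<times> {False}. \<Sum>q\<in>Z S \<times> {False}. H p q) = (\<Sum>z\<in>Z S. G S z z)"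
    using finite_Z[OF order_refl] by simp
  define a where "a i = tau \<Gamma> (qs i) (\<lambda>z w. D i (par i w) (par i z))" for i
  have a: "0 \<le> a i" if "i \<in> \<Gamma>" for i
  proof -
    have "psd (Y i) (D i)"
      using psd_pullback[OF in_Gamma[OF that], where \<pi> = "\<lambda>x. (x, True)" and X = "Y i"]
      by (simp add: block_def image_subset_iff)
    then show ?thesis unfolding a_def by (rule tau_party_nonneg)
  qed
  have "(\<Prod>i\<in>\<Gamma>. a i) = (\<Prod>i\<in>\<Gamma>. complex_of_real (Re (a i)))"
    by (intro prod.cong refl nonneg_complex_Re a)
  then have pa: "(\<Prod>i\<in>\<Gamma>. a i) = complex_of_real (\<Prod>i\<in>\<Gamma>. Re (a i))" by simp
  have Re_mult: "Re (t * complex_of_real x) = Re t * x" for t x by simp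
  have nn: "0 \<le> (\<Prod>i\<in>\<Gamma>. Re (a i))"
    using a by (intro prod_nonneg) (auto simp: less_eq_complex_def)
  have "Re (\<Sum>p\<in>Z S \<times> {True}. \<Sum>q\<in>Z S \<times> {True}. H p q) \<le> 1 * (\<Prod>i\<in>\<Gamma>. Re (a i))"
    unfolding TT a_def[symmetric] pa Re_mult by (rule mult_right_mono[OF tau_rest_bounds(2) nn])
  moreover have "Re (\<Sum>p\<in>Z S \<times> {False}. \<Sum>q\<in>Z S \<times> {False}. H p q) \<le> 1"
    unfolding FF by (rule trace_G(2)) simp
  moreover have "0 \<le> Re (\<Sum>p\<in>Z S \<times> {False}. \<Sum>q\<in>Z S \<times> {False}. H p q)"
    unfolding FF using trace_G(1)[of S] by (simp add: less_eq_complex_def)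
  ultimately have "sqrt (Re (\<Sum>p\<in>Z S \<times> {True}. \<Sum>q\<in>Z S \<times> {True}. H p q)) *
       sqrt (Re (\<Sum>p\<in>Z S \<times> {False}. \<Sum>q\<in>Z S \<times> {False}. H p q)) \<le> sqrt (\<Prod>i\<in>\<Gamma>. Re (a i)) * 1"
    using nn by (intro mult_mono) auto
  with CS TF show ?thesis
    by (simp add: a_def sqrt_prod)
qed

end

end

section \<open>Truncation of a network model\<close>

locale network_model =
  fixes n m :: nat and \<Lambda> :: "nat \<Rightarrow> nat set" and L :: "nat set" and M :: "('l, 'b) net_model"
  assumes network: "network n m \<Lambda>" and L_subset: "L \<subseteq> {1..m}" and valid: "valid_model n m \<Lambda> L M"
begin

definition S :: "nat set" where
  "S = {1..m} - L"

abbreviation R :: "nat \<Rightarrow> nat set" where "R \<equiv> receivers n \<Lambda>"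

abbreviation X :: "(nat \<times> nat \<Rightarrow> 'b) set" where "X \<equiv> global_basis n m \<Lambda> L M"

definition rho :: "nat \<Rightarrow> (nat \<Rightarrow> 'b) \<Rightarrow> (nat \<Rightarrow> 'b) \<Rightarrow> complex" where
  "rho s = mat_elem (source_basis n \<Lambda> M s) (state M s)"

definition eff :: "nat \<Rightarrow> (nat \<Rightarrow> 'l) \<Rightarrow> nat \<Rightarrow> int \<Rightarrow> (nat \<Rightarrow> 'b) \<Rightarrow> (nat \<Rightarrow> 'b) \<Rightarrow> complex" where
  "eff i \<xi> y b = mat_elem (party_basis \<Lambda> L M i) (effect M i \<xi> y b)"

definition glob :: "(nat \<times> nat \<Rightarrow> 'b) \<Rightarrow> (nat \<times> nat \<Rightarrow> 'b) \<Rightarrow> complex" where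
  "glob z w = (\<Prod>s\<in>S. rho s (source_part n \<Lambda> s z) (source_part n \<Lambda> s w))"

definition geff :: "(nat \<Rightarrow> 'l) \<Rightarrow> (nat \<Rightarrow> int) \<Rightarrow> (nat \<Rightarrow> nat) \<Rightarrow> (nat \<times> nat \<Rightarrow> 'b) \<Rightarrow> (nat \<times> nat \<Rightarrow> 'b) \<Rightarrow> complex" where
  "geff \<omega> a x z w = (\<Prod>i\<in>{1..n}. eff i (restrict \<omega> (\<Lambda> i \<inter> L)) (x i) (a i) (party_part \<Lambda> L i z) (party_part \<Lambda> L i w))"

lemma Lambda_subset: "i \<in> {1..n} \<Longrightarrow> \<Lambda> i \<subseteq> {1..m}"
  using network by (auto simp: network_def)

lemma density: "s \<in> S \<Longrightarrow> density_operator (source_basis n \<Lambda> M s) (state M s)"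
  using valid by (auto simp: valid_model_def S_def)

lemma global_basis_eq: "X = Pi\<^sub>E (Sigma S R) (\<lambda>(s, i). basis M s i)"
  by (simp add: global_basis_def S_def)

lemma rho_psd: "s \<in> S \<Longrightarrow> psd (source_basis n \<Lambda> M s) (rho s)"
  unfolding rho_def by (rule density_operator_psd[OF density])

lemma measurement:
  "i \<in> {1..n} \<Longrightarrow> y \<in> {0, 1} \<Longrightarrow> \<xi> \<in> space (Pi\<^sub>M (\<Lambda> i \<inter> L) (hidden M)) \<Longrightarrow>
    two_outcome_measurement (party_basis \<Lambda> L M i) (effect M i \<xi> y)"
  using valid by (auto simp: valid_model_def)

lemma eff_psd:
  assumes "i \<in> {1..n}" "y \<in> {0, 1}" "\<xi> \<in> space (Pi\<^sub>M (\<Lambda> i \<inter> L) (hidden M))" "b \<in> {1, -1}"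
  shows "psd (party_basis \<Lambda> L M i) (eff i \<xi> y b)"
  unfolding eff_def
  by (rule positive_operator_psd) (use measurement[OF assms(1-3)] assms(4) in \<open>auto simp: two_outcome_measurement_def\<close>)

lemma eff_sum:
  assumes "i \<in> {1..n}" "y \<in> {0, 1}" "\<xi> \<in> space (Pi\<^sub>M (\<Lambda> i \<inter> L) (hidden M))"
    and "u \<in> party_basis \<Lambda> L M i" "v \<in> party_basis \<Lambda> L M i"
  shows "eff i \<xi> y 1 u v + eff i \<xi> y (-1) u v = kdelta u v"
  unfolding eff_def by (rule measurement_mat_elem_sum[OF measurement[OF assms(1-3)] assms(4,5)])

lemma eff_complement_psd:
  assumes "i \<in> {1..n}" "y \<in> {0, 1}" "\<xi> \<in> space (Pi\<^sub>M (\<Lambda> i \<inter> L) (hidden M))" "b \<in> {1, -1}"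
  shows "psd (party_basis \<Lambda> L M i) (\<lambda>u v. kdelta u v - eff i \<xi> y b u v)"
proof -
  have "- b \<in> {1, -1}" using assms(4) by auto
  from eff_psd[OF assms(1-3) this] show ?thesis
  proof (rule psd_cong)
    fix u v assume "u \<in> party_basis \<Lambda> L M i" "v \<in> party_basis \<Lambda> L M i"
    from eff_sum[OF assms(1-3) this] assms(4)
    show "eff i \<xi> y (- b) u v = kdelta u v - eff i \<xi> y b u v"
      by (auto simp: algebra_simps)
  qed
qed

lemma global_basis_mem: "z \<in> X \<Longrightarrow> s \<in> S \<Longrightarrow> i \<in> R s \<Longrightarrow> z (s, i) \<in> basis M s i"
  unfolding global_basis_eq by (drule PiE_mem[of _ _ _ "(s, i)"]) auto

lemma party_source: "i \<in> {1..n} \<Longrightarrow> s \<in> \<Lambda> i - L \<Longrightarrow> s \<in> S \<and> i \<in> R s"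
  using Lambda_subset[of i] by (auto simp: receivers_def S_def)

lemma source_part_basis: "z \<in> X \<Longrightarrow> s \<in> S \<Longrightarrow> source_part n \<Lambda> s z \<in> source_basis n \<Lambda> M s"
  unfolding source_part_def source_basis_def restrict_PiE_iff using global_basis_mem by blast

lemma party_part_basis: "z \<in> X \<Longrightarrow> i \<in> {1..n} \<Longrightarrow> party_part \<Lambda> L i z \<in> party_basis \<Lambda> L M i"
  unfolding party_part_def party_basis_def restrict_PiE_iff
  using global_basis_mem party_source by blast

lemma glob_psd: "psd X glob"
  unfolding glob_def
  by (intro psd_prod psd_pullback[OF rho_psd]) (auto simp: source_part_basis)

lemma restrict_space:
  "\<omega> \<in> space (Pi\<^sub>M L (hidden M)) \<Longrightarrow> restrict \<omega> (\<Lambda> i \<inter> L) \<in> space (Pi\<^sub>M (\<Lambda> i \<inter> L) (hidden M))"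
  by (auto simp: space_PiM)

lemma outcomes_mem: "a \<in> outcomes n \<Longrightarrow> i \<in> {1..n} \<Longrightarrow> a i \<in> {1, -1}"
  unfolding outcomes_def by (rule PiE_mem)

lemma inputs_mem: "x \<in> inputs n \<Longrightarrow> i \<in> {1..n} \<Longrightarrow> x i \<in> {0, 1}"
  unfolding inputs_def by (rule PiE_mem)

text \<open>For the upper bound, the effects are compared with the identities of the parties; the
  product of these is the identity on \<open>X\<close>, because the party parts together determine
  every coordinate.\<close>

lemma geff_psd:
  assumes "\<omega> \<in> space (Pi\<^sub>M L (hidden M))" "a \<in> outcomes n" "x \<in> inputs n"
  shows "psd X (geff \<omega> a x)" "psd X (\<lambda>z w. kdelta z w - geff \<omega> a x z w)"
proof -
  let ?e = "\<lambda>i. eff i (restrict \<omega> (\<Lambda> i \<inter> L)) (x i) (a i)"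
  have 1: "psd X (\<lambda>z w. ?e i (party_part \<Lambda> L i z) (party_part \<Lambda> L i w))" if "i \<in> {1..n}" for i
    by (rule psd_pullback[OF eff_psd[OF that inputs_mem[OF assms(3) that] restrict_space[OF assms(1)] outcomes_mem[OF assms(2) that]]])
      (use that party_part_basis in blast)
  have 2: "psd X (\<lambda>z w. kdelta (party_part \<Lambda> L i z) (party_part \<Lambda> L i w) - ?e i (party_part \<Lambda> L i z) (party_part \<Lambda> L i w))"
    if "i \<in> {1..n}" for i
    by (rule psd_pullback[OF eff_complement_psd[OF that inputs_mem[OF assms(3) that] restrict_space[OF assms(1)] outcomes_mem[OF assms(2) that]]])
      (use that party_part_basis in blast)
  show "psd X (geff \<omega> a x)"
    unfolding geff_def by (intro psd_prod 1)
  have "psd X (\<lambda>z w. (\<Prod>i\<in>{1..n}. kdelta (party_part \<Lambda> L i z) (party_part \<Lambda> L i w)) - geff \<omega> a x z w)"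
    unfolding geff_def by (intro psd_prod_mono 1 2) auto
  then show "psd X (\<lambda>z w. kdelta z w - geff \<omega> a x z w)"
  proof (rule psd_cong)
    fix z w assume zw: "z \<in> X" "w \<in> X"
    have "(\<forall>i\<in>{1..n}. party_part \<Lambda> L i z = party_part \<Lambda> L i w) \<longleftrightarrow> z = w"
    proof
      assume eq: "\<forall>i\<in>{1..n}. party_part \<Lambda> L i z = party_part \<Lambda> L i w"
      show "z = w"
      proof (rule PiE_ext[OF zw[unfolded global_basis_eq]])
        fix p assume "p \<in> (SIGMA s:S. R s)"
        then obtain s i where p: "p = (s, i)" and s: "s \<in> S" "i \<in> {1..n}" "s \<in> \<Lambda> i"
          by (auto simp: receivers_def)
        then have "s \<in> \<Lambda> i - L" by (simp add: S_def)
        from s have "party_part \<Lambda> L i z s = party_part \<Lambda> L i w s" using eq by simp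
        then show "z p = w p" using \<open>s \<in> \<Lambda> i - L\<close> by (simp add: p party_part_def)
      qed
    qed simp
    then show "(\<Prod>i\<in>{1..n}. kdelta (party_part \<Lambda> L i z) (party_part \<Lambda> L i w)) - geff \<omega> a x z w
       = kdelta z w - geff \<omega> a x z w"
      unfolding kdelta_def by (simp add: prod_of_bool)
  qed
qed

lemma op_trace_eq:
  "op_trace X (global_state n m \<Lambda> L M \<circ> global_effect n m \<Lambda> L M \<omega> a x)
    = (\<Sum>\<^sub>\<infinity>z\<in>X. \<Sum>\<^sub>\<infinity>w\<in>X. glob z w * geff \<omega> a x w z)"
  unfolding global_state_def global_effect_def op_trace_tensor_comp
  by (simp add: glob_def geff_def rho_def eff_def S_def)

end

locale network_box = network_model n m \<Lambda> L M
  for n m :: nat and \<Lambda> :: "nat \<Rightarrow> nat set" and L :: "nat set" and M :: "('l, 'b) net_model" +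
  fixes F :: "nat \<times> nat \<Rightarrow> 'b set"
  assumes finite_box: "\<And>s i. s \<in> S \<Longrightarrow> i \<in> R s \<Longrightarrow> finite (F (s, i))"
    and box_basis: "\<And>s i. s \<in> S \<Longrightarrow> i \<in> R s \<Longrightarrow> F (s, i) \<subseteq> basis M s i"
begin

lemma source_box_subset: "s \<in> S \<Longrightarrow> (\<Pi>\<^sub>E i\<in>R s. F (s, i)) \<subseteq> source_basis n \<Lambda> M s"
  unfolding source_basis_def by (intro PiE_mono box_basis)

sublocale finite_network n S R F rho
proof
  show "psd (\<Pi>\<^sub>E i\<in>R s. F (s, i)) (rho s)" if "s \<in> S" for s
    by (rule psd_subset[OF rho_psd[OF that] source_box_subset[OF that]])
  show "(\<Sum>w\<in>(\<Pi>\<^sub>E i\<in>R s. F (s, i)). Re (rho s w w)) \<le> 1" if s: "s \<in> S" for s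
    unfolding rho_def
  proof (rule density_operator_diag_sum_le[OF density[OF s] _ source_box_subset[OF s]])
    show "finite (\<Pi>\<^sub>E i\<in>R s. F (s, i))"
      by (rule finite_PiE) (use s finite_box in \<open>auto simp: receivers_def\<close>)
  qed
  show "R s \<subseteq> {1..n}" for s by (auto simp: receivers_def)
qed (use finite_box in \<open>auto simp: S_def\<close>)

lemma qs_eq: "i \<in> {1..n} \<Longrightarrow> qs i = \<Lambda> i - L"
  using party_source[of i] by (auto simp: qs_def receivers_def) (simp add: S_def)

lemma par_eq: "i \<in> {1..n} \<Longrightarrow> par i z = party_part \<Lambda> L i z"
  by (simp add: par_def party_part_def qs_eq)

lemma src_eq: "src s z = source_part n \<Lambda> s z"
  by (simp add: src_def source_part_def)

lemma glob_eq: "glob z w = G S z w"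
  by (simp add: glob_def G_def src_eq)

lemma Z_subset: "Z S \<subseteq> X"
  unfolding Z_def global_basis_eq
  by (rule PiE_mono) (use box_basis in auto)

lemma Y_subset: "i \<in> {1..n} \<Longrightarrow> Y i \<subseteq> party_basis \<Lambda> L M i"
  unfolding Y_def party_basis_def qs_eq
  by (rule PiE_mono) (use box_basis party_source in blast)

definition trunc :: "(nat \<Rightarrow> 'l) \<Rightarrow> (nat \<Rightarrow> int) \<Rightarrow> (nat \<Rightarrow> nat) \<Rightarrow> complex" where
  "trunc \<omega> a x = (\<Sum>z\<in>Z S. \<Sum>w\<in>Z S. glob z w * geff \<omega> a x w z)"

end

section \<open>Approximation of the trace by boxes\<close>

context network_model
begin

text \<open>The coordinate projections of \<open>A\<close> are finite, and their product contains
  \<open>A\<close>. This passes from finite sets, which express infinite sums, to boxes, on which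
  sources and parties factorise.\<close>

lemma box_exists:
  assumes "finite A" "A \<subseteq> X"
  shows "\<exists>F. network_box n m \<Lambda> L M F \<and> A \<subseteq> Pi\<^sub>E (Sigma S R) F"
proof (intro exI conjI)
  let ?F = "\<lambda>p. (\<lambda>z. z p) ` A"
  show "network_box n m \<Lambda> L M ?F"
  proof
    fix s i assume si: "s \<in> S" "i \<in> R s"
    show "(\<lambda>z. z (s, i)) ` A \<subseteq> basis M s i"
      using global_basis_mem[OF _ si] assms(2) by blast
  qed (use assms(1) in auto)
  show "A \<subseteq> Pi\<^sub>E (Sigma S R) ?F"
  proof
    fix z assume z: "z \<in> A"
    then have "z \<in> extensional (Sigma S R)"
      using assms(2) unfolding global_basis_eq by (meson PiE_iff subsetD)
    then show "z \<in> Pi\<^sub>E (Sigma S R) ?F" using z by (auto simp: PiE_iff)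
  qed
qed

lemma glob_diag_nonneg: "z \<in> X \<Longrightarrow> 0 \<le> Re (glob z z)"
  using psd_diag[OF glob_psd] by (simp add: less_eq_complex_def)

text \<open>Enlarging \<open>A\<close> to a box only adds nonnegative diagonal entries, and on a box
  the trace is a product over the sources.\<close>

lemma glob_trace_le:
  assumes "finite A" "A \<subseteq> X" shows "(\<Sum>z\<in>A. Re (glob z z)) \<le> 1"
proof -
  obtain F where "network_box n m \<Lambda> L M F" and A: "A \<subseteq> Pi\<^sub>E (Sigma S R) F"
    using box_exists[OF assms] by blast
  then interpret network_box n m \<Lambda> L M F by simp
  have "(\<Sum>z\<in>A. Re (glob z z)) \<le> (\<Sum>z\<in>Z S. Re (glob z z))"
    by (rule sum_mono2) (use A Z_subset glob_diag_nonneg in \<open>auto simp: Z_def[symmetric] finite_Z\<close>)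
  also have "\<dots> \<le> 1"
    using trace_G(2)[OF order_refl] by (simp add: glob_eq)
  finally show ?thesis .
qed

lemma truncation_error:
  assumes "0 < \<epsilon>"
  shows "\<exists>F. network_box n m \<Lambda> L M F \<and>
    (\<forall>\<omega>\<in>space (Pi\<^sub>M L (hidden M)). \<forall>a\<in>outcomes n. \<forall>x\<in>inputs n.
      \<bar>Re (op_trace X (global_state n m \<Lambda> L M \<circ> global_effect n m \<Lambda> L M \<omega> a x))
        - Re (network_box.trunc n m \<Lambda> L M F \<omega> a x)\<bar> \<le> \<epsilon>)"
proof -
  define g where "g z = Re (glob z z)" for z
  define vals where "vals = sum g ` {A. finite A \<and> A \<subseteq> X}"
  have bdd: "bdd_above vals"
    unfolding vals_def g_def by (rule bdd_aboveI2[where M = 1]) (use glob_trace_le in auto)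
  have g_nonneg: "0 \<le> sum g A" if "A \<subseteq> X" for A
    unfolding g_def using glob_diag_nonneg that by (intro sum_nonneg) auto
  have "vals \<noteq> {}" by (auto simp: vals_def)
  \<comment> \<open>The weight outside the box is then at most (\<epsilon>/2)^2, which
    \<open>iterated_infsum_truncation\<close> turns into the error 2 (\<epsilon>/2) = \<epsilon>.
    The supremum of the finite traces serves as the total weight.\<close>
  then obtain t where "t \<in> vals" "Sup vals - (\<epsilon> / 2)\<^sup>2 < t"
    using less_cSup_iff[OF _ bdd, of "Sup vals - (\<epsilon> / 2)\<^sup>2"] assms by auto
  then obtain A where A: "finite A" "A \<subseteq> X" "Sup vals - (\<epsilon> / 2)\<^sup>2 < sum g A"
    by (auto simp: vals_def)
  obtain F where F: "network_box n m \<Lambda> L M F" and AF: "A \<subseteq> Pi\<^sub>E (Sigma S R) F"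
    using box_exists[OF A(1,2)] by blast
  interpret network_box n m \<Lambda> L M F by (rule F)
  have AZ: "A \<subseteq> Z S" using AF by (simp add: Z_def)
  have tail: "sum g B \<le> (\<epsilon> / 2)\<^sup>2" if B: "finite B" "B \<subseteq> X - Z S" for B
  proof -
    have "sum g A + sum g B = sum g (A \<union> B)"
      by (rule sum.union_disjoint[symmetric]) (use A B AZ in auto)
    also have "\<dots> \<le> Sup vals"
      by (rule cSup_upper[OF _ bdd]) (use A B in \<open>auto simp: vals_def\<close>)
    finally show ?thesis using A(3) by simp
  qed
  have "\<bar>Re (op_trace X (global_state n m \<Lambda> L M \<circ> global_effect n m \<Lambda> L M \<omega> a x)) - Re (trunc \<omega> a x)\<bar> \<le> \<epsilon>"
    if \<omega>: "\<omega> \<in> space (Pi\<^sub>M L (hidden M))" and a: "a \<in> outcomes n" and x: "x \<in> inputs n" for \<omega> a x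
  proof -
    have "cmod (op_trace X (global_state n m \<Lambda> L M \<circ> global_effect n m \<Lambda> L M \<omega> a x) - trunc \<omega> a x)
        \<le> 2 * sqrt ((\<epsilon> / 2)\<^sup>2)"
      unfolding op_trace_eq trunc_def
    proof (rule iterated_infsum_truncation[where g = g])
      show "cmod (\<Sum>z\<in>A. \<Sum>w\<in>B. glob z w * geff \<omega> a x w z) \<le> sqrt (sum g A) * sqrt (sum g B)"
        if "finite A" "A \<subseteq> X" "finite B" "B \<subseteq> X" for A B
        unfolding g_def by (rule psd_effect_block_bound[OF glob_psd geff_psd[OF \<omega> a x] that])
      show "sum g A \<le> 1" if "finite A" "A \<subseteq> X" for A
        unfolding g_def by (rule glob_trace_le[OF that])
    qed (use g_nonneg tail Z_subset finite_Z in auto)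
    also have "\<dots> = \<epsilon>" using assms by simp
    finally show ?thesis
      using abs_Re_le_cmod[of "op_trace X (global_state n m \<Lambda> L M \<circ> global_effect n m \<Lambda> L M \<omega> a x) - trunc \<omega> a x"]
      by simp
  qed
  then show ?thesis using F by blast
qed

lemma hidden_prob_space: "prob_space (Pi\<^sub>M L (hidden M))"
  by (rule prob_space_PiM) (use valid in \<open>simp add: valid_model_def\<close>)

lemma eff_measurable:
  assumes "i \<in> {1..n}" "y \<in> {0, 1}" "b \<in> {1, -1}" "u \<in> party_basis \<Lambda> L M i" "v \<in> party_basis \<Lambda> L M i"
  shows "(\<lambda>\<xi>. eff i \<xi> y b u v) \<in> borel_measurable (Pi\<^sub>M (\<Lambda> i \<inter> L) (hidden M))"
  unfolding eff_def mat_elem_def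
  using valid assms ket_ell2[OF assms(4)] ket_ell2[OF assms(5)] unfolding valid_model_def by blast

lemma restrict_measurable:
  "(\<lambda>\<omega>. restrict \<omega> (\<Lambda> i \<inter> L)) \<in> measurable (Pi\<^sub>M L (hidden M)) (Pi\<^sub>M (\<Lambda> i \<inter> L) (hidden M))"
  by (rule measurable_restrict_subset) auto

end

context network_box
begin

text \<open>On a box only finite sums of products of matrix elements occur, to which weak
  measurability of the effects applies directly.\<close>

lemma trunc_measurable:
  assumes "a \<in> outcomes n" "x \<in> inputs n"
  shows "(\<lambda>\<omega>. trunc \<omega> a x) \<in> borel_measurable (Pi\<^sub>M L (hidden M))"
  unfolding trunc_def geff_def
proof (intro borel_measurable_sum borel_measurable_times borel_measurable_prod borel_measurable_const)
  fix z w i assume "z \<in> Z S" "w \<in> Z S" and i: "i \<in> {1..n}"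
  then have "z \<in> X" "w \<in> X" using Z_subset by auto
  then show "(\<lambda>\<omega>. eff i (restrict \<omega> (\<Lambda> i \<inter> L)) (x i) (a i) (party_part \<Lambda> L i w) (party_part \<Lambda> L i z))
      \<in> borel_measurable (Pi\<^sub>M L (hidden M))"
    by (intro measurable_compose[OF restrict_measurable eff_measurable] i outcomes_mem[OF assms(1) i]
        inputs_mem[OF assms(2) i] party_part_basis)
qed

lemma trunc_bound:
  assumes "\<omega> \<in> space (Pi\<^sub>M L (hidden M))" "a \<in> outcomes n" "x \<in> inputs n"
  shows "cmod (trunc \<omega> a x) \<le> 1"
proof -
  have t: "(\<Sum>z\<in>Z S. Re (glob z z)) \<le> 1" by (rule glob_trace_le[OF finite_Z Z_subset]) simp
  have t0: "0 \<le> (\<Sum>z\<in>Z S. Re (glob z z))"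
    using glob_diag_nonneg Z_subset by (intro sum_nonneg) auto
  have "cmod (trunc \<omega> a x) \<le> sqrt (\<Sum>z\<in>Z S. Re (glob z z)) * sqrt (\<Sum>z\<in>Z S. Re (glob z z))"
    unfolding trunc_def
    by (rule psd_effect_block_bound[OF glob_psd geff_psd[OF assms]]) (auto simp: finite_Z Z_subset)
  then show ?thesis using t t0 by simp
qed

lemma trunc_integrable:
  assumes "a \<in> outcomes n" "x \<in> inputs n"
  shows "integrable (Pi\<^sub>M L (hidden M)) (\<lambda>\<omega>. Re (trunc \<omega> a x))"
proof -
  interpret prob_space "Pi\<^sub>M L (hidden M)" by (rule hidden_prob_space)
  show ?thesis
  proof (rule integrable_const_bound[where B = 1])
    show "AE \<omega> in Pi\<^sub>M L (hidden M). norm (Re (trunc \<omega> a x)) \<le> 1"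
      using trunc_bound[OF _ assms] abs_Re_le_cmod order_trans by (intro AE_I2) (auto, blast)
    show "(\<lambda>\<omega>. Re (trunc \<omega> a x)) \<in> borel_measurable (Pi\<^sub>M L (hidden M))"
      using trunc_measurable[OF assms] by simp
  qed
qed

end

section \<open>Convergence of the truncated probabilities\<close>

context network_model
begin

lemma model_prob_approximation:
  "\<exists>F. (\<forall>k. network_box n m \<Lambda> L M (F k)) \<and>
    (\<forall>a\<in>outcomes n. \<forall>x\<in>inputs n.
      (\<lambda>k. \<integral>\<omega>. Re (network_box.trunc n m \<Lambda> L M (F k) \<omega> a x) \<partial>(Pi\<^sub>M L (hidden M)))
        \<longlonglongrightarrow> model_prob n m \<Lambda> L M a x)"
proof -
  interpret prob_space "Pi\<^sub>M L (hidden M)" by (rule hidden_prob_space)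
  let ?P = "Pi\<^sub>M L (hidden M)"
  let ?T = "\<lambda>\<omega> a x. Re (op_trace X (global_state n m \<Lambda> L M \<circ> global_effect n m \<Lambda> L M \<omega> a x))"
  let ?t = "\<lambda>F \<omega> a x. Re (network_box.trunc n m \<Lambda> L M F \<omega> a x)"
  have "\<forall>k. \<exists>F. network_box n m \<Lambda> L M F \<and>
    (\<forall>\<omega>\<in>space ?P. \<forall>a\<in>outcomes n. \<forall>x\<in>inputs n. \<bar>?T \<omega> a x - ?t F \<omega> a x\<bar> \<le> inverse (real (Suc k)))"
    using truncation_error by simp
  then obtain F where F: "\<And>k. network_box n m \<Lambda> L M (F k)"
    and err: "\<And>k \<omega> a x. \<omega> \<in> space ?P \<Longrightarrow> a \<in> outcomes n \<Longrightarrow> x \<in> inputs n \<Longrightarrow>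
      \<bar>?T \<omega> a x - ?t (F k) \<omega> a x\<bar> \<le> inverse (real (Suc k))"
    by metis
  have "(\<lambda>k. \<integral>\<omega>. ?t (F k) \<omega> a x \<partial>?P) \<longlonglongrightarrow> model_prob n m \<Lambda> L M a x"
    if a: "a \<in> outcomes n" and x: "x \<in> inputs n" for a x
  proof -
    have int: "integrable ?P (\<lambda>\<omega>. ?t (F k) \<omega> a x)" for k
      by (rule network_box.trunc_integrable[OF F a x])
    \<comment> \<open>The trace may be a sum over an uncountable basis; it is measurable as the
      pointwise limit of a sequence of truncations.\<close>
    have "(\<lambda>\<omega>. ?T \<omega> a x) \<in> borel_measurable ?P"
    proof (rule borel_measurable_LIMSEQ_real)
      show "(\<lambda>\<omega>. ?t (F k) \<omega> a x) \<in> borel_measurable ?P" for k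
        using int by (rule borel_measurable_integrable)
      fix \<omega> assume \<omega>: "\<omega> \<in> space ?P"
      have "(\<lambda>k. ?T \<omega> a x - ?t (F k) \<omega> a x) \<longlonglongrightarrow> 0"
        by (rule tendsto_rabs_zero_cancel, rule tendsto_sandwich[OF _ _ tendsto_const LIMSEQ_inverse_real_of_nat])
          (use err[OF \<omega> a x] in auto)
      from tendsto_diff[OF tendsto_const[of "?T \<omega> a x"] this]
      show "(\<lambda>k. ?t (F k) \<omega> a x) \<longlonglongrightarrow> ?T \<omega> a x" by simp
    qed
    then have intd: "integrable ?P (\<lambda>\<omega>. ?T \<omega> a x - ?t (F k) \<omega> a x)" for k
      using borel_measurable_integrable[OF int[of k]] err[OF _ a x, of _ k]
      by (intro integrable_const_bound[where B = "inverse (real (Suc k))"] AE_I2) auto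
    have eq: "model_prob n m \<Lambda> L M a x - (\<integral>\<omega>. ?t (F k) \<omega> a x \<partial>?P) = (\<integral>\<omega>. ?T \<omega> a x - ?t (F k) \<omega> a x \<partial>?P)" for k
    proof -
      \<comment> \<open>The trace is a bounded error plus an integrable truncation. Its
        integrability is what allows the integral of the difference to be split.\<close>
      have "integrable ?P (\<lambda>\<omega>. ?T \<omega> a x)"
        using Bochner_Integration.integrable_add[OF intd[of k] int[of k]] by simp
      from Bochner_Integration.integral_diff[OF this int] show ?thesis
        by (simp add: model_prob_def)
    qed
    have bd: "\<bar>model_prob n m \<Lambda> L M a x - (\<integral>\<omega>. ?t (F k) \<omega> a x \<partial>?P)\<bar> \<le> inverse (real (Suc k))" for k
    proof -
      have "\<bar>\<integral>\<omega>. ?T \<omega> a x - ?t (F k) \<omega> a x \<partial>?P\<bar> \<le> (\<integral>\<omega>. \<bar>?T \<omega> a x - ?t (F k) \<omega> a x\<bar> \<partial>?P)"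
        by (rule integral_abs_bound)
      also have "\<dots> \<le> inverse (real (Suc k))"
        by (rule integral_le_const[OF integrable_abs[OF intd] AE_I2[OF err[OF _ a x]]])
      finally show ?thesis unfolding eq .
    qed
    have "(\<lambda>k. model_prob n m \<Lambda> L M a x - (\<integral>\<omega>. ?t (F k) \<omega> a x \<partial>?P)) \<longlonglongrightarrow> 0"
      by (rule tendsto_rabs_zero_cancel, rule tendsto_sandwich[OF _ _ tendsto_const LIMSEQ_inverse_real_of_nat])
        (use bd in auto)
    from tendsto_diff[OF tendsto_const[of "model_prob n m \<Lambda> L M a x"] this]
    show ?thesis by simp
  qed
  then show ?thesis using F by blast
qed

end

section \<open>The inequality\<close>

lemma indep_vars_PiM_coordinates:
  assumes "\<And>i. i \<in> I \<Longrightarrow> prob_space (N i)" "I \<noteq> {}"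
  shows "prob_space.indep_vars (Pi\<^sub>M I N) N (\<lambda>i \<omega>. \<omega> i) I"
proof -
  interpret prob_space "Pi\<^sub>M I N" by (rule prob_space_PiM[OF assms(1)])
  have "distr (Pi\<^sub>M I N) (Pi\<^sub>M I N) (\<lambda>x. \<lambda>i\<in>I. x i) = distr (Pi\<^sub>M I N) (Pi\<^sub>M I N) (\<lambda>x. x)"
    by (rule distr_cong) (auto simp: space_PiM)
  also have "\<dots> = Pi\<^sub>M I N" by (rule distr_id)
  also have "\<dots> = Pi\<^sub>M I (\<lambda>i. distr (Pi\<^sub>M I N) (N i) (\<lambda>\<omega>. \<omega> i))"
    by (rule PiM_cong[OF refl], rule distr_PiM_component[OF assms(1), symmetric])
  finally show ?thesis
    by (subst indep_vars_iff_distr_eq_PiM'[OF assms(2)]) auto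
qed

text \<open>The coordinates of a product of probability spaces are independent, hence so are their
  restrictions to disjoint index sets. This turns an average over the hidden variables into a
  product over \<Gamma>.\<close>

lemma integral_prod_disjoint_coordinates:
  fixes f :: "'i \<Rightarrow> ('k \<Rightarrow> 'a) \<Rightarrow> real"
  assumes N: "\<And>k. k \<in> I \<Longrightarrow> prob_space (N k)" "I \<noteq> {}"
    and J: "finite J" "disjoint_family_on K J" "\<And>j. j \<in> J \<Longrightarrow> K j \<subseteq> I"
    and f: "\<And>j. j \<in> J \<Longrightarrow> f j \<in> borel_measurable (Pi\<^sub>M (K j) N)"
    and int: "\<And>j. j \<in> J \<Longrightarrow> integrable (Pi\<^sub>M I N) (\<lambda>\<omega>. f j (restrict \<omega> (K j)))"
  shows "(\<integral>\<omega>. (\<Prod>j\<in>J. f j (restrict \<omega> (K j))) \<partial>(Pi\<^sub>M I N)) = (\<Prod>j\<in>J. \<integral>\<omega>. f j (restrict \<omega> (K j)) \<partial>(Pi\<^sub>M I N))"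
    and "integrable (Pi\<^sub>M I N) (\<lambda>\<omega>. \<Prod>j\<in>J. f j (restrict \<omega> (K j)))"
proof -
  interpret prob_space "Pi\<^sub>M I N" by (rule prob_space_PiM[OF N(1)])
  have "indep_vars (\<lambda>j. Pi\<^sub>M (K j) N) (\<lambda>j \<omega>. restrict (\<lambda>i. \<omega> i) (K j)) J"
    by (rule indep_vars_restrict[OF indep_vars_PiM_coordinates[OF N] J(3,2)])
  then have "indep_vars (\<lambda>_. borel) (\<lambda>j \<omega>. f j (restrict \<omega> (K j))) J"
    by (rule indep_vars_compose2) (rule f)
  from indep_vars_lebesgue_integral[OF J(1) this int] indep_vars_integrable[OF J(1) this int]
  show "(\<integral>\<omega>. (\<Prod>j\<in>J. f j (restrict \<omega> (K j))) \<partial>(Pi\<^sub>M I N)) = (\<Prod>j\<in>J. \<integral>\<omega>. f j (restrict \<omega> (K j)) \<partial>(Pi\<^sub>M I N))"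
    and "integrable (Pi\<^sub>M I N) (\<lambda>\<omega>. \<Prod>j\<in>J. f j (restrict \<omega> (K j)))"
    by auto
qed

lemma sum_inputs_outcomes_prod:
  fixes h :: "nat \<Rightarrow> nat \<Rightarrow> int \<Rightarrow> complex"
  shows "(\<Sum>x\<in>inputs n. \<Sum>a\<in>outcomes n. \<Prod>i\<in>{1..n}. h i (x i) (a i))
    = (\<Prod>i\<in>{1..n}. \<Sum>y\<in>{0, 1}. \<Sum>b\<in>{1, -1}. h i y b)"
proof -
  have "(\<Prod>i\<in>{1..n}. \<Sum>y\<in>{0, 1}. \<Sum>b\<in>{1, -1}. h i y b)
      = (\<Sum>x\<in>inputs n. \<Prod>i\<in>{1..n}. \<Sum>b\<in>{1, -1}. h i (x i) b)"
    unfolding inputs_def by (rule prod_sum_PiE) auto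
  also have "\<dots> = (\<Sum>x\<in>inputs n. \<Sum>a\<in>outcomes n. \<Prod>i\<in>{1..n}. h i (x i) (a i))"
    unfolding outcomes_def by (intro sum.cong refl prod_sum_PiE) auto
  finally show ?thesis ..
qed

text \<open>The square of the left side falls short of 2 (a + b) by (\<surd>a - \<surd>b)^2, so
  equality requires a = b = 1/2. This is the origin of \<surd>2 in the bound.\<close>

lemma sqrt_add_sqrt_le:
  assumes "0 \<le> a" "0 \<le> b" "a + b \<le> 1" shows "sqrt a + sqrt b \<le> sqrt 2"
proof (rule real_le_rsqrt)
  have "(sqrt a + sqrt b)\<^sup>2 = 2 * (a + b) - (sqrt a - sqrt b)\<^sup>2"
    using assms by (simp add: power2_sum power2_diff)
  also have "\<dots> \<le> 2 * 1 - 0"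
    using assms(3) by (intro diff_mono mult_left_mono) auto
  finally show "(sqrt a + sqrt b)\<^sup>2 \<le> 2" by simp
qed

section \<open>Observables of the parties\<close>

context network_model
begin

definition obs :: "nat \<Rightarrow> (nat \<Rightarrow> 'l) \<Rightarrow> nat \<Rightarrow> (nat \<Rightarrow> 'b) \<Rightarrow> (nat \<Rightarrow> 'b) \<Rightarrow> complex" where
  "obs i \<xi> y u v = eff i \<xi> y 1 u v - eff i \<xi> y (-1) u v"

text \<open>As the two effects add up to the identity, 1 + A is twice the effect of outcome 1 and 1
  - A twice that of outcome -1.\<close>

lemma observable_obs:
  assumes i: "i \<in> {1..n}" and y: "y \<in> {0, 1}" and \<xi>: "\<xi> \<in> space (Pi\<^sub>M (\<Lambda> i \<inter> L) (hidden M))"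
  shows "observable (party_basis \<Lambda> L M i) (obs i \<xi> y)"
proof -
  have two: "(0::complex) \<le> 2" by (simp add: less_eq_complex_def)
  have "psd (party_basis \<Lambda> L M i) (\<lambda>u v. 2 * eff i \<xi> y 1 u v)"
    by (intro psd_scale eff_psd[OF assms] two) simp
  then have 1: "psd (party_basis \<Lambda> L M i) (\<lambda>u v. kdelta u v + obs i \<xi> y u v)"
    by (rule psd_cong) (simp add: obs_def eff_sum[OF assms, symmetric])
  have "psd (party_basis \<Lambda> L M i) (\<lambda>u v. 2 * eff i \<xi> y (-1) u v)"
    by (intro psd_scale eff_psd[OF assms] two) simp
  then have 2: "psd (party_basis \<Lambda> L M i) (\<lambda>u v. kdelta u v - obs i \<xi> y u v)"
    by (rule psd_cong) (simp add: obs_def eff_sum[OF assms, symmetric])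
  show ?thesis unfolding observable_def using 1 2 by blast
qed

lemma obs_measurable:
  assumes "i \<in> {1..n}" "y \<in> {0, 1}" "u \<in> party_basis \<Lambda> L M i" "v \<in> party_basis \<Lambda> L M i"
  shows "(\<lambda>\<xi>. obs i \<xi> y u v) \<in> borel_measurable (Pi\<^sub>M (\<Lambda> i \<inter> L) (hidden M))"
  unfolding obs_def by (intro borel_measurable_diff eff_measurable assms) auto

end

section \<open>Correlators on a box and their averages over the hidden variables\<close>

context network_box
begin

abbreviation loc :: "(nat \<Rightarrow> 'l) \<Rightarrow> nat \<Rightarrow> nat \<Rightarrow> 'l" where
  "loc \<omega> i \<equiv> restrict \<omega> (\<Lambda> i \<inter> L)"

definition corr :: "(nat \<Rightarrow> (nat \<Rightarrow> 'b) \<Rightarrow> (nat \<Rightarrow> 'b) \<Rightarrow> complex) \<Rightarrow> complex" where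
  "corr C = (\<Sum>z\<in>Z S. \<Sum>w\<in>Z S. G S z w * (\<Prod>i\<in>{1..n}. C i (par i w) (par i z)))"

definition trunc_prob :: "(nat \<Rightarrow> int) \<Rightarrow> (nat \<Rightarrow> nat) \<Rightarrow> real" where
  "trunc_prob a x = (\<integral>\<omega>. Re (trunc \<omega> a x) \<partial>(Pi\<^sub>M L (hidden M)))"

definition comb :: "(nat \<Rightarrow> nat \<Rightarrow> real) \<Rightarrow> (nat \<Rightarrow> 'l) \<Rightarrow> nat \<Rightarrow> (nat \<Rightarrow> 'b) \<Rightarrow> (nat \<Rightarrow> 'b) \<Rightarrow> complex" where
  "comb c \<omega> i u v = c i 0 * obs i (loc \<omega> i) 0 u v + c i 1 * obs i (loc \<omega> i) 1 u v"

text \<open>Inputs and outcomes enter through products over the parties, so the sums over them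
  distribute and leave at each party its combination of observables. The formal multilinear
  expansion thus becomes an average of correlators at fixed hidden variables.\<close>

lemma expectation_trunc:
  "expectation_of n trunc_prob c = (\<integral>\<omega>. Re (corr (comb c \<omega>)) \<partial>(Pi\<^sub>M L (hidden M)))"
proof -
  define \<kappa> where "\<kappa> x a = (\<Prod>i\<in>{1..n}. c i (x i)) * of_int (\<Prod>i\<in>{1..n}. a i)" for x :: "nat \<Rightarrow> nat" and a :: "nat \<Rightarrow> int"
  have pt: "(\<Sum>x\<in>inputs n. \<Sum>a\<in>outcomes n. \<kappa> x a * Re (trunc \<omega> a x)) = Re (corr (comb c \<omega>))" for \<omega>
  proof -
    have "(\<Sum>x\<in>inputs n. \<Sum>a\<in>outcomes n. \<kappa> x a * Re (trunc \<omega> a x))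
        = Re (\<Sum>x\<in>inputs n. \<Sum>a\<in>outcomes n. of_real (\<kappa> x a) * trunc \<omega> a x)"
      by simp
    also have "(\<Sum>x\<in>inputs n. \<Sum>a\<in>outcomes n. of_real (\<kappa> x a) * trunc \<omega> a x)
        = (\<Sum>x\<in>inputs n. \<Sum>a\<in>outcomes n. \<Sum>p\<in>Z S \<times> Z S. glob (fst p) (snd p) * (of_real (\<kappa> x a) * geff \<omega> a x (snd p) (fst p)))"
      by (simp add: trunc_def sum_distrib_left sum.cartesian_product' mult_ac)
    also have "\<dots> = (\<Sum>x\<in>inputs n. \<Sum>p\<in>Z S \<times> Z S. \<Sum>a\<in>outcomes n. glob (fst p) (snd p) * (of_real (\<kappa> x a) * geff \<omega> a x (snd p) (fst p)))"
      by (intro sum.cong refl sum.swap)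
    also have "\<dots> = (\<Sum>p\<in>Z S \<times> Z S. \<Sum>x\<in>inputs n. \<Sum>a\<in>outcomes n. glob (fst p) (snd p) * (of_real (\<kappa> x a) * geff \<omega> a x (snd p) (fst p)))"
      by (rule sum.swap)
    also have "\<dots> = (\<Sum>p\<in>Z S \<times> Z S. G S (fst p) (snd p) * (\<Prod>i\<in>{1..n}. comb c \<omega> i (par i (snd p)) (par i (fst p))))"
    proof (rule sum.cong[OF refl])
      fix p :: "(nat \<times> nat \<Rightarrow> 'b) \<times> (nat \<times> nat \<Rightarrow> 'b)"
      let ?h = "\<lambda>i y b. of_real (c i y) * of_int b * eff i (loc \<omega> i) y b (par i (snd p)) (par i (fst p))"
      have k: "of_real (\<kappa> x a) * geff \<omega> a x (snd p) (fst p) = (\<Prod>i\<in>{1..n}. ?h i (x i) (a i))" for x a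
        by (simp add: \<kappa>_def geff_def prod.distrib par_eq)
      have "(\<Prod>i\<in>{1..n}. \<Sum>y\<in>{0, 1}. \<Sum>b\<in>{1, -1}. ?h i y b)
          = (\<Prod>i\<in>{1..n}. comb c \<omega> i (par i (snd p)) (par i (fst p)))"
        by (rule prod.cong[OF refl]) (simp add: comb_def obs_def right_diff_distrib)
      with sum_inputs_outcomes_prod[of ?h n] have hs:
        "(\<Sum>x\<in>inputs n. \<Sum>a\<in>outcomes n. \<Prod>i\<in>{1..n}. ?h i (x i) (a i))
          = (\<Prod>i\<in>{1..n}. comb c \<omega> i (par i (snd p)) (par i (fst p)))"
        by (rule trans)
      show "(\<Sum>x\<in>inputs n. \<Sum>a\<in>outcomes n. glob (fst p) (snd p) * (of_real (\<kappa> x a) * geff \<omega> a x (snd p) (fst p)))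
          = G S (fst p) (snd p) * (\<Prod>i\<in>{1..n}. comb c \<omega> i (par i (snd p)) (par i (fst p)))"
        unfolding sum_distrib_left[symmetric] k hs glob_eq ..
    qed
    also have "\<dots> = corr (comb c \<omega>)"
      by (simp add: corr_def sum.cartesian_product')
    finally show ?thesis .
  qed
  have "expectation_of n trunc_prob c = (\<Sum>x\<in>inputs n. \<Sum>a\<in>outcomes n. \<kappa> x a * trunc_prob a x)"
    by (simp add: expectation_of_def full_correlator_def \<kappa>_def sum_distrib_left mult.assoc)
  also have "\<dots> = (\<Sum>x\<in>inputs n. \<Sum>a\<in>outcomes n. \<integral>\<omega>. \<kappa> x a * Re (trunc \<omega> a x) \<partial>(Pi\<^sub>M L (hidden M)))"
    by (simp add: trunc_prob_def)
  also have "\<dots> = (\<integral>\<omega>. (\<Sum>x\<in>inputs n. \<Sum>a\<in>outcomes n. \<kappa> x a * Re (trunc \<omega> a x)) \<partial>(Pi\<^sub>M L (hidden M)))"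
  proof -
    have int: "integrable (Pi\<^sub>M L (hidden M)) (\<lambda>\<omega>. \<kappa> x a * Re (trunc \<omega> a x))"
      if "x \<in> inputs n" "a \<in> outcomes n" for x a
      by (rule integrable_mult_right, rule trunc_integrable[OF that(2,1)])
    then show ?thesis by (simp add: Bochner_Integration.integral_sum Bochner_Integration.integrable_sum)
  qed
  finally show ?thesis by (simp only: pt)
qed

lemma observable_box:
  assumes "i \<in> {1..n}" "y \<in> {0, 1}" "\<xi> \<in> space (Pi\<^sub>M (\<Lambda> i \<inter> L) (hidden M))"
  shows "observable (Y i) (obs i \<xi> y)"
  using observable_obs[OF assms] psd_subset[OF _ Y_subset[OF assms(1)]]
  by (auto simp: observable_def)

text \<open>The expectation of (A^+)^2, given the hidden variables \<open>\<xi>\<close> of party i,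
  in the truncated state of its quantum sources; the square is that of the truncated
  observable.\<close>

definition plus_sq :: "nat set \<Rightarrow> nat \<Rightarrow> (nat \<Rightarrow> 'l) \<Rightarrow> real" where
  "plus_sq \<Gamma> i \<xi> = Re (tau \<Gamma> (qs i) (\<lambda>z w. ksq (Y i) (half_sum (obs i \<xi> 0) (obs i \<xi> 1)) (par i w) (par i z)))"

definition minus_sq :: "nat set \<Rightarrow> nat \<Rightarrow> (nat \<Rightarrow> 'l) \<Rightarrow> real" where
  "minus_sq \<Gamma> i \<xi> = Re (tau \<Gamma> (qs i) (\<lambda>z w. ksq (Y i) (half_diff (obs i \<xi> 0) (obs i \<xi> 1)) (par i w) (par i z)))"

context
  fixes \<Gamma> :: "nat set"
  assumes Gamma: "\<Gamma> \<subseteq> {1..n}" and indep: "independent_parties \<Lambda> \<Gamma>"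
begin

lemma qs_disjoint: "i \<in> \<Gamma> \<Longrightarrow> j \<in> \<Gamma> \<Longrightarrow> i \<noteq> j \<Longrightarrow> qs i \<inter> qs j = {}"
  using Gamma indep qs_eq[of i] qs_eq[of j] by (auto simp: independent_parties_def subset_iff)

lemma Gamma_mem: "i \<in> \<Gamma> \<Longrightarrow> i \<in> {1..n}"
  using Gamma by blast

lemma sq_bounds:
  assumes i: "i \<in> \<Gamma>" and \<xi>: "\<xi> \<in> space (Pi\<^sub>M (\<Lambda> i \<inter> L) (hidden M))"
  shows "0 \<le> plus_sq \<Gamma> i \<xi>" "0 \<le> minus_sq \<Gamma> i \<xi>" "plus_sq \<Gamma> i \<xi> + minus_sq \<Gamma> i \<xi> \<le> 1"
proof -
  have o: "observable (Y i) (obs i \<xi> 0)" "observable (Y i) (obs i \<xi> 1)"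
    by (rule observable_box[OF Gamma_mem[OF i] _ \<xi>], simp)+
  show "0 \<le> plus_sq \<Gamma> i \<xi>"
    using tau_party_nonneg[OF Gamma qs_disjoint psd_ksq_half(1)[OF finite_Y o]]
    by (simp add: plus_sq_def less_eq_complex_def)
  show "0 \<le> minus_sq \<Gamma> i \<xi>"
    using tau_party_nonneg[OF Gamma qs_disjoint psd_ksq_half(2)[OF finite_Y o]]
    by (simp add: minus_sq_def less_eq_complex_def)
  show "plus_sq \<Gamma> i \<xi> + minus_sq \<Gamma> i \<xi> \<le> 1"
    unfolding plus_sq_def minus_sq_def
    by (rule tau_party_add_le[OF Gamma qs_disjoint i psd_one_minus_half_squares[OF finite_Y o]])
qed

lemma sq_measurable:
  assumes i: "i \<in> \<Gamma>"
  shows "plus_sq \<Gamma> i \<in> borel_measurable (Pi\<^sub>M (\<Lambda> i \<inter> L) (hidden M))"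
    "minus_sq \<Gamma> i \<in> borel_measurable (Pi\<^sub>M (\<Lambda> i \<inter> L) (hidden M))"
proof -
  have o: "(\<lambda>\<xi>. obs i \<xi> y u v) \<in> borel_measurable (Pi\<^sub>M (\<Lambda> i \<inter> L) (hidden M))"
    if "y \<in> {0, 1}" "u \<in> Y i" "v \<in> Y i" for y u v
    by (rule obs_measurable[OF Gamma_mem[OF i] that(1)]) (use that Y_subset[OF Gamma_mem[OF i]] in auto)
  show "plus_sq \<Gamma> i \<in> borel_measurable (Pi\<^sub>M (\<Lambda> i \<inter> L) (hidden M))"
    unfolding plus_sq_def[abs_def] tau_def ksq_def half_sum_def
    by (intro borel_measurable_Re measurable_compose[OF _ borel_measurable_Re] borel_measurable_sum borel_measurable_times borel_measurable_const
        borel_measurable_divide borel_measurable_add o par_Z) auto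
  show "minus_sq \<Gamma> i \<in> borel_measurable (Pi\<^sub>M (\<Lambda> i \<inter> L) (hidden M))"
    unfolding minus_sq_def[abs_def] tau_def ksq_def half_diff_def
    by (intro measurable_compose[OF _ borel_measurable_Re] borel_measurable_sum borel_measurable_times borel_measurable_const
        borel_measurable_divide borel_measurable_diff o par_Z) auto
qed

text \<open>A party without quantum sources has scalar observables \<open>a\<close> and \<open>b\<close> in \<open>[-1, 1]\<close>, for which
  \<open>\<bar>a + b\<bar> + \<bar>a - b\<bar> \<le> 2\<close>.\<close>

lemma sq_local:
  assumes i: "i \<in> \<Gamma>" and local: "\<Lambda> i \<subseteq> L" and \<xi>: "\<xi> \<in> space (Pi\<^sub>M (\<Lambda> i \<inter> L) (hidden M))"
  shows "sqrt (plus_sq \<Gamma> i \<xi>) + sqrt (minus_sq \<Gamma> i \<xi>) \<le> 1"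
proof -
  \<comment> \<open>The only element of a product over the empty index set.\<close>
  let ?u = "\<lambda>_. undefined :: 'b"
  have q: "qs i = {}" using local qs_eq[OF Gamma_mem[OF i]] by auto
  have Y: "Y i = {?u}" by (simp add: Y_def q)
  have par: "par i z = ?u" for z by (auto simp: par_def q)
  have Z: "Z {} = {?u}" by (simp add: Z_def)
  define a b where "a = Re (obs i \<xi> 0 ?u ?u)" and "b = Re (obs i \<xi> 1 ?u ?u)"
  have sc: "Im (obs i \<xi> y ?u ?u) = 0 \<and> \<bar>Re (obs i \<xi> y ?u ?u)\<bar> \<le> 1" if "y \<in> {0, 1}" for y
  proof -
    have "observable (Y i) (obs i \<xi> y)" by (rule observable_box[OF Gamma_mem[OF i] that \<xi>])
    then have "psd (Y i) (\<lambda>x y'. kdelta x y' + obs i \<xi> y x y')" "psd (Y i) (\<lambda>x y'. kdelta x y' - obs i \<xi> y x y')"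
      by (auto simp: observable_def)
    from psd_diag[OF this(1), of ?u] psd_diag[OF this(2), of ?u] show ?thesis
      by (auto simp: Y kdelta_def less_eq_complex_def)
  qed
  have ab: "obs i \<xi> 0 ?u ?u = of_real a" "obs i \<xi> (Suc 0) ?u ?u = of_real b" "\<bar>a\<bar> \<le> 1" "\<bar>b\<bar> \<le> 1"
    using sc[of 0] sc[of 1] by (auto simp: a_def b_def complex_eq_iff)
  have "plus_sq \<Gamma> i \<xi> = ((a + b) / 2)\<^sup>2"
    by (simp add: plus_sq_def q tau_def Z par ksq_def Y half_sum_def ab power2_eq_square)
  moreover have "minus_sq \<Gamma> i \<xi> = ((a - b) / 2)\<^sup>2"
    by (simp add: minus_sq_def q tau_def Z par ksq_def Y half_diff_def ab power2_eq_square)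
  moreover have "\<bar>(a + b) / 2\<bar> + \<bar>(a - b) / 2\<bar> \<le> 1"
    using ab(3,4) by (simp add: abs_le_iff) (simp add: abs_if field_simps)
  ultimately show ?thesis by (simp only: real_sqrt_abs)
qed

text \<open>At fixed hidden variables the network is purely quantum. \<open>correlator_bound\<close>
  applies with the squares of A^+ or A^- as the operators \<open>D i\<close>, while the parties
  outside \<Gamma> enter only as contractions.\<close>

lemma corr_bound:
  assumes \<omega>: "\<omega> \<in> space (Pi\<^sub>M L (hidden M))"
  shows "\<bar>Re (corr (comb (\<lambda>i. if i \<in> \<Gamma> then A_plus else A_obs 0) \<omega>))\<bar> \<le> (\<Prod>i\<in>\<Gamma>. sqrt (plus_sq \<Gamma> i (loc \<omega> i)))"
    "\<bar>Re (corr (comb (\<lambda>i. if i \<in> \<Gamma> then A_minus else A_obs 1) \<omega>))\<bar> \<le> (\<Prod>i\<in>\<Gamma>. sqrt (minus_sq \<Gamma> i (loc \<omega> i)))"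
proof -
  have o: "observable (Y i) (obs i (loc \<omega> i) y)" if "i \<in> {1..n}" "y \<in> {0, 1}" for i y
    by (rule observable_box[OF that restrict_space[OF \<omega>]])
  have oo: "observable (Y i) (obs i (loc \<omega> i) 0)" "observable (Y i) (obs i (loc \<omega> i) 1)" if "i \<in> \<Gamma>" for i
    using o[OF Gamma_mem[OF that], of 0] o[OF Gamma_mem[OF that], of 1] by auto
  let ?cp = "comb (\<lambda>i. if i \<in> \<Gamma> then A_plus else A_obs 0) \<omega>"
  let ?cm = "comb (\<lambda>i. if i \<in> \<Gamma> then A_minus else A_obs 1) \<omega>"
  have cp: "?cp i = (if i \<in> \<Gamma> then half_sum (obs i (loc \<omega> i) 0) (obs i (loc \<omega> i) 1) else obs i (loc \<omega> i) 0)" for i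
    by (auto simp: comb_def half_sum_def A_plus_def A_obs_def fun_eq_iff field_simps)
  have cm: "?cm i = (if i \<in> \<Gamma> then half_diff (obs i (loc \<omega> i) 0) (obs i (loc \<omega> i) 1) else obs i (loc \<omega> i) 1)" for i
    by (auto simp: comb_def half_diff_def A_minus_def A_obs_def fun_eq_iff field_simps)
  have "cmod (corr ?cp) \<le> (\<Prod>i\<in>\<Gamma>. sqrt (plus_sq \<Gamma> i (loc \<omega> i)))"
    unfolding corr_def plus_sq_def
  proof (rule correlator_bound[OF Gamma qs_disjoint])
    show "psd (Y i \<times> UNIV) (block (ksq (Y i) (half_sum (obs i (loc \<omega> i) 0) (obs i (loc \<omega> i) 1))) (?cp i) kdelta)"
      if i: "i \<in> \<Gamma>" for i
    proof -
      have "?cp i = half_sum (obs i (loc \<omega> i) 0) (obs i (loc \<omega> i) 1)" using cp i by simp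
      then show ?thesis using psd_block_half(1)[OF finite_Y oo[OF i]] by simp
    qed
    show "psd (Y i \<times> UNIV) (block kdelta (?cp i) kdelta)" if i: "i \<in> {1..n} - \<Gamma>" for i
    proof -
      have "?cp i = obs i (loc \<omega> i) 0" using cp i by simp
      then show ?thesis using psd_block_observable[OF o[of i 0]] i by simp
    qed
  qed
  then show "\<bar>Re (corr ?cp)\<bar> \<le> (\<Prod>i\<in>\<Gamma>. sqrt (plus_sq \<Gamma> i (loc \<omega> i)))"
    using abs_Re_le_cmod order_trans by blast
  have "cmod (corr ?cm) \<le> (\<Prod>i\<in>\<Gamma>. sqrt (minus_sq \<Gamma> i (loc \<omega> i)))"
    unfolding corr_def minus_sq_def
  proof (rule correlator_bound[OF Gamma qs_disjoint])
    show "psd (Y i \<times> UNIV) (block (ksq (Y i) (half_diff (obs i (loc \<omega> i) 0) (obs i (loc \<omega> i) 1))) (?cm i) kdelta)"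
      if i: "i \<in> \<Gamma>" for i
    proof -
      have "?cm i = half_diff (obs i (loc \<omega> i) 0) (obs i (loc \<omega> i) 1)" using cm i by simp
      then show ?thesis using psd_block_half(2)[OF finite_Y oo[OF i]] by simp
    qed
    show "psd (Y i \<times> UNIV) (block kdelta (?cm i) kdelta)" if i: "i \<in> {1..n} - \<Gamma>" for i
    proof -
      have "?cm i = obs i (loc \<omega> i) 1" using cm i by simp
      then show ?thesis using psd_block_observable[OF o[of i 1]] i by simp
    qed
  qed
  then show "\<bar>Re (corr ?cm)\<bar> \<le> (\<Prod>i\<in>\<Gamma>. sqrt (minus_sq \<Gamma> i (loc \<omega> i)))"
    using abs_Re_le_cmod order_trans by blast
qed

lemma trunc_inequality:
  assumes i0: "i0 \<in> \<Gamma>" "\<Lambda> i0 \<subseteq> L"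
  shows "\<bar>expectation_of n trunc_prob (\<lambda>i. if i \<in> \<Gamma> then A_plus else A_obs 0)\<bar> powr (1 / card \<Gamma>)
     + \<bar>expectation_of n trunc_prob (\<lambda>i. if i \<in> \<Gamma> then A_minus else A_obs 1)\<bar> powr (1 / card \<Gamma>)
    \<le> 2 powr ((real (card \<Gamma>) - 1) / (2 * real (card \<Gamma>)))"
proof -
  let ?P = "Pi\<^sub>M L (hidden M)"
  interpret prob_space ?P by (rule hidden_prob_space)
  have fin: "finite \<Gamma>" using Gamma finite_subset by blast
  have card: "0 < card \<Gamma>" using fin i0 by (auto simp: card_gt_0_iff)
  have prob: "prob_space (hidden M s)" if "s \<in> L" for s
    using valid that by (auto simp: valid_model_def)
  have "\<Lambda> i0 \<noteq> {}" using network Gamma_mem[OF i0(1)] by (auto simp: network_def)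
  \<comment> \<open>Party \<open>i0\<close> receives at least one source, and all its sources are
    local; independence of the coordinates is stated for a nonempty index set.\<close>
  then have L: "L \<noteq> {}" using i0(2) by auto
  have disj: "disjoint_family_on (\<lambda>i. \<Lambda> i \<inter> L) \<Gamma>"
    using indep by (auto simp: disjoint_family_on_def independent_parties_def)
  define f g where "f i \<xi> = sqrt (plus_sq \<Gamma> i \<xi>)" and "g i \<xi> = sqrt (minus_sq \<Gamma> i \<xi>)" for i \<xi>
  have meas: "f i \<in> borel_measurable (Pi\<^sub>M (\<Lambda> i \<inter> L) (hidden M))"
    "g i \<in> borel_measurable (Pi\<^sub>M (\<Lambda> i \<inter> L) (hidden M))" if "i \<in> \<Gamma>" for i
    unfolding f_def g_def using sq_measurable[OF that] by measurable
  have bd: "0 \<le> f i (loc \<omega> i)" "0 \<le> g i (loc \<omega> i)" "f i (loc \<omega> i) \<le> 1" "g i (loc \<omega> i) \<le> 1"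
    "f i (loc \<omega> i) + g i (loc \<omega> i) \<le> (if i = i0 then 1 else sqrt 2)"
    if i: "i \<in> \<Gamma>" and \<omega>: "\<omega> \<in> space ?P" for i \<omega>
    using sq_bounds[OF i restrict_space[OF \<omega>]] sqrt_add_sqrt_le[OF sq_bounds[OF i restrict_space[OF \<omega>]]]
      sq_local[OF i0 restrict_space[OF \<omega>]]
    by (auto simp: f_def g_def)
  have int: "integrable ?P (\<lambda>\<omega>. f i (loc \<omega> i))" "integrable ?P (\<lambda>\<omega>. g i (loc \<omega> i))" if "i \<in> \<Gamma>" for i
    using bd[OF that] measurable_compose[OF restrict_measurable meas(1)[OF that]] measurable_compose[OF restrict_measurable meas(2)[OF that]]
    by (auto intro!: integrable_const_bound[where B = 1] AE_I2)
  define p q where "p i = (\<integral>\<omega>. f i (loc \<omega> i) \<partial>?P)" and "q i = (\<integral>\<omega>. g i (loc \<omega> i) \<partial>?P)" for i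
  \<comment> \<open>Upper bounds for \<open>p i + q i\<close>. Their product is \<surd>2 to the
    power \<open>card \<Gamma> - 1\<close>.\<close>
  define c where "c i = (if i = i0 then 1 else sqrt 2)" for i
  note prodf = integral_prod_disjoint_coordinates[where f = f and I = L, OF prob L fin disj _ meas(1) int(1)]
  note prodg = integral_prod_disjoint_coordinates[where f = g and I = L, OF prob L fin disj _ meas(2) int(2)]
  have I: "\<bar>expectation_of n trunc_prob (\<lambda>i. if i \<in> \<Gamma> then A_plus else A_obs 0)\<bar> \<le> (\<Prod>i\<in>\<Gamma>. p i)"
  proof -
    have "\<bar>\<integral>\<omega>. Re (corr (comb (\<lambda>i. if i \<in> \<Gamma> then A_plus else A_obs 0) \<omega>)) \<partial>?P\<bar> \<le> (\<integral>\<omega>. (\<Prod>i\<in>\<Gamma>. f i (loc \<omega> i)) \<partial>?P)"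
    proof (rule order_trans[OF integral_abs_bound integral_mono'])
      show "integrable ?P (\<lambda>\<omega>. \<Prod>i\<in>\<Gamma>. f i (loc \<omega> i))" by (rule prodf(2)) auto
      fix \<omega> assume \<omega>: "\<omega> \<in> space ?P"
      from corr_bound(1)[OF \<omega>] show "\<bar>Re (corr (comb (\<lambda>i. if i \<in> \<Gamma> then A_plus else A_obs 0) \<omega>))\<bar>
          \<le> (\<Prod>i\<in>\<Gamma>. f i (loc \<omega> i))" by (simp only: f_def)
      show "0 \<le> (\<Prod>i\<in>\<Gamma>. f i (loc \<omega> i))" by (intro prod_nonneg bd(1)[OF _ \<omega>]) auto
    qed
    then show ?thesis unfolding expectation_trunc p_def using prodf(1) by simp
  qed
  have J: "\<bar>expectation_of n trunc_prob (\<lambda>i. if i \<in> \<Gamma> then A_minus else A_obs 1)\<bar> \<le> (\<Prod>i\<in>\<Gamma>. q i)"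
  proof -
    have "\<bar>\<integral>\<omega>. Re (corr (comb (\<lambda>i. if i \<in> \<Gamma> then A_minus else A_obs 1) \<omega>)) \<partial>?P\<bar> \<le> (\<integral>\<omega>. (\<Prod>i\<in>\<Gamma>. g i (loc \<omega> i)) \<partial>?P)"
    proof (rule order_trans[OF integral_abs_bound integral_mono'])
      show "integrable ?P (\<lambda>\<omega>. \<Prod>i\<in>\<Gamma>. g i (loc \<omega> i))" by (rule prodg(2)) auto
      fix \<omega> assume \<omega>: "\<omega> \<in> space ?P"
      from corr_bound(2)[OF \<omega>] show "\<bar>Re (corr (comb (\<lambda>i. if i \<in> \<Gamma> then A_minus else A_obs 1) \<omega>))\<bar>
          \<le> (\<Prod>i\<in>\<Gamma>. g i (loc \<omega> i))" by (simp only: g_def)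
      show "0 \<le> (\<Prod>i\<in>\<Gamma>. g i (loc \<omega> i))" by (intro prod_nonneg bd(2)[OF _ \<omega>]) auto
    qed
    then show ?thesis unfolding expectation_trunc q_def using prodg(1) by simp
  qed
  have pq: "p i + q i \<le> c i" if "i \<in> \<Gamma>" for i
  proof -
    have "p i + q i = (\<integral>\<omega>. f i (loc \<omega> i) + g i (loc \<omega> i) \<partial>?P)"
      unfolding p_def q_def by (rule Bochner_Integration.integral_add[symmetric, OF int[OF that]])
    also have "\<dots> \<le> c i"
      unfolding c_def
      by (rule integral_le_const[OF Bochner_Integration.integrable_add[OF int[OF that]] AE_I2[OF bd(5)[OF that]]])
    finally show ?thesis .
  qed
  have pq0: "0 \<le> p i" "0 \<le> q i" if "i \<in> \<Gamma>" for i
    unfolding p_def q_def using bd(1,2)[OF that] by (auto intro!: integral_nonneg_AE AE_I2)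
  have "\<bar>expectation_of n trunc_prob (\<lambda>i. if i \<in> \<Gamma> then A_plus else A_obs 0)\<bar> powr (1 / card \<Gamma>)
     + \<bar>expectation_of n trunc_prob (\<lambda>i. if i \<in> \<Gamma> then A_minus else A_obs 1)\<bar> powr (1 / card \<Gamma>)
    \<le> (\<Prod>i\<in>\<Gamma>. p i) powr (1 / card \<Gamma>) + (\<Prod>i\<in>\<Gamma>. q i) powr (1 / card \<Gamma>)"
    by (intro add_mono powr_mono2 I J) auto
  also have "\<dots> \<le> (\<Prod>i\<in>\<Gamma>. c i) powr (1 / card \<Gamma>)"
    by (rule geometric_means_add_le[OF fin]) (use i0 pq pq0 in \<open>auto simp: c_def\<close>)
  also have "(\<Prod>i\<in>\<Gamma>. c i) = sqrt 2 ^ (card \<Gamma> - 1)"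
  proof -
    have "(\<Prod>i\<in>\<Gamma>. c i) = c i0 * (\<Prod>i\<in>\<Gamma> - {i0}. c i)" by (rule prod.remove[OF fin i0(1)])
    also have "(\<Prod>i\<in>\<Gamma> - {i0}. c i) = (\<Prod>i\<in>\<Gamma> - {i0}. sqrt 2)" by (rule prod.cong) (auto simp: c_def)
    finally show ?thesis using i0 fin by (simp add: c_def card_Diff_singleton)
  qed
  also have "sqrt 2 ^ (card \<Gamma> - 1) = 2 powr (1/2 * real (card \<Gamma> - 1))"
    unfolding powr_powr[symmetric] by (simp add: powr_half_sqrt powr_realpow)
  also have "(2 powr (1/2 * real (card \<Gamma> - 1))) powr (1 / card \<Gamma>) = 2 powr ((real (card \<Gamma>) - 1) / (2 * real (card \<Gamma>)))"
    unfolding powr_powr using card by (simp add: of_nat_diff)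
  finally show ?thesis .
qed

end

end

text \<open>The minimum exists: at m + 1 the condition holds vacuously, as {1..m} has no subset of
  that size. A larger \<open>L\<close> contains a set of exactly the critical size, and the party
  found for that set also works for \<open>L\<close>.\<close>

lemma critical_levelD:
  assumes "L \<subseteq> {1..m}" "critical_level m \<Lambda> \<Gamma> \<le> card L"
  shows "\<exists>i\<in>\<Gamma>. \<Lambda> i \<subseteq> L"
proof -
  let ?P = "\<lambda>v. \<forall>L. L \<subseteq> {1..m} \<and> card L = v \<longrightarrow> (\<exists>i\<in>\<Gamma>. \<Lambda> i \<subseteq> L)"
  have "?P (Suc m)"
  proof (intro allI impI)
    fix L assume L: "L \<subseteq> {1..m} \<and> card L = Suc m"
    then have "card L \<le> card {1..m}" by (intro card_mono) auto
    then show "\<exists>i\<in>\<Gamma>. \<Lambda> i \<subseteq> L" using L by simp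
  qed
  then have P: "?P (critical_level m \<Lambda> \<Gamma>)"
    unfolding critical_level_def by (rule LeastI)
  obtain L' where L': "L' \<subseteq> L" "card L' = critical_level m \<Lambda> \<Gamma>"
    by (rule obtain_subset_with_card_n[OF assms(2)])
  then have "\<exists>i\<in>\<Gamma>. \<Lambda> i \<subseteq> L'" using P assms(1) by blast
  then show ?thesis using L' by blast
qed

theorem theorem1:
  fixes n m h w :: nat
    and \<Lambda> :: "nat \<Rightarrow> nat set"
    and \<Gamma> :: "nat set"
    and P :: "(nat \<Rightarrow> int) \<Rightarrow> (nat \<Rightarrow> nat) \<Rightarrow> real"
    and I J :: real
  assumes "network n m \<Lambda>"
    and "h = max_independence_number n \<Lambda>"
    and "\<Gamma> \<subseteq> {1..n}" and "independent_parties \<Lambda> \<Gamma>" and "card \<Gamma> = h"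
    and "w = critical_level m \<Lambda> \<Gamma>"
    and "QNL TYPE('l) TYPE('b) n m \<Lambda> w P"
    and "I = expectation_of n P (\<lambda>i. if i \<in> \<Gamma> then A_plus else A_obs 0)"
    and "J = expectation_of n P (\<lambda>i. if i \<in> \<Gamma> then A_minus else A_obs 1)"
  shows "\<bar>I\<bar> powr (1 / real h) + \<bar>J\<bar> powr (1 / real h) \<le> 2 powr ((real h - 1) / (2 * real h))"
proof -
  obtain L and M :: "('l, 'b) net_model" where L: "L \<subseteq> {1..m}" "w \<le> card L"
    and valid: "valid_model n m \<Lambda> L M"
    and P: "\<And>a x. a \<in> outcomes n \<Longrightarrow> x \<in> inputs n \<Longrightarrow> P a x = model_prob n m \<Lambda> L M a x"
    using assms(7) unfolding QNL_def by blast
  obtain i0 where i0: "i0 \<in> \<Gamma>" "\<Lambda> i0 \<subseteq> L"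
    using critical_levelD[OF L(1)] L(2) assms(6) by blast
  interpret network_model n m \<Lambda> L M
    using assms(1) L(1) valid by unfold_locales
  obtain F where F: "\<And>k. network_box n m \<Lambda> L M (F k)"
    and lim: "\<And>a x. a \<in> outcomes n \<Longrightarrow> x \<in> inputs n \<Longrightarrow>
      (\<lambda>k. \<integral>\<omega>. Re (network_box.trunc n m \<Lambda> L M (F k) \<omega> a x) \<partial>(Pi\<^sub>M L (hidden M))) \<longlonglongrightarrow> P a x"
  proof -
    obtain F where F: "\<forall>k. network_box n m \<Lambda> L M (F k)"
      and l: "\<forall>a\<in>outcomes n. \<forall>x\<in>inputs n.
        (\<lambda>k. \<integral>\<omega>. Re (network_box.trunc n m \<Lambda> L M (F k) \<omega> a x) \<partial>(Pi\<^sub>M L (hidden M)))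
          \<longlonglongrightarrow> model_prob n m \<Lambda> L M a x"
      using model_prob_approximation by (elim exE conjE)
    show ?thesis
    proof (rule that[of F])
      show "network_box n m \<Lambda> L M (F k)" for k using F by blast
      show "(\<lambda>k. \<integral>\<omega>. Re (network_box.trunc n m \<Lambda> L M (F k) \<omega> a x) \<partial>(Pi\<^sub>M L (hidden M))) \<longlonglongrightarrow> P a x"
        if "a \<in> outcomes n" "x \<in> inputs n" for a x
        unfolding P[OF that] using l that by blast
    qed
  qed
  let ?T = "\<lambda>k. network_box.trunc_prob n m \<Lambda> L M (F k)"
  have conv: "(\<lambda>k. expectation_of n (?T k) c) \<longlonglongrightarrow> expectation_of n P c" for c
    unfolding expectation_of_def full_correlator_def network_box.trunc_prob_def[OF F]
    by (intro tendsto_intros lim)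
  have fin: "finite \<Gamma>" using assms(3) finite_subset by blast
  have h: "0 < h" using fin i0(1) assms(5) by (auto simp: card_gt_0_iff)
  \<comment> \<open>The exponent 1/h is positive, so the power is continuous also at 0, which may be
    the limit.\<close>
  have powr_lim: "(\<lambda>k. \<bar>expectation_of n (?T k) c\<bar> powr (1 / real h)) \<longlonglongrightarrow> \<bar>expectation_of n P c\<bar> powr (1 / real h)" for c
    by (intro tendsto_powr' tendsto_rabs conv tendsto_const) (use h in auto)
  show ?thesis
    unfolding assms(8,9)
  \<comment> \<open>Every box satisfies the inequality with the same right-hand side, so it passes
    to the limit.\<close>
  proof (rule LIMSEQ_le_const2[OF tendsto_add[OF powr_lim powr_lim]], intro exI allI impI)
    fix k
    show "\<bar>expectation_of n (?T k) (\<lambda>i. if i \<in> \<Gamma> then A_plus else A_obs 0)\<bar> powr (1 / real h)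
      + \<bar>expectation_of n (?T k) (\<lambda>i. if i \<in> \<Gamma> then A_minus else A_obs 1)\<bar> powr (1 / real h)
      \<le> 2 powr ((real h - 1) / (2 * real h))"
      using network_box.trunc_inequality[OF F assms(3,4) i0] by (simp add: assms(5))
  qed
qed

end
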